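(* Let $\Omega\subset\mathbb{C}$ be a bounded domain bounded by finitely many disjoint $C^\infty$ smooth simple closed curves, and let $f:\Omega\to D_1(0)$ be a proper holomorphic map onto the unit disc with zeroes at $a_1,\dots,a_N$ of multiplicities $M(1),\dots,M(N)$. Let $\phi$ be a positive $C^\infty$ weight function on $b\Omega$ and $\sigma(z,w)$ the weighted Szegő kernel with respect to $\phi$. Then there are constants $c_{ijnm}\in\mathbb{C}$ such that for all $z,w\in\Omega$ $$\sigma(z,w)=\frac{1}{1-f(z)\overline{f(w)}}\sum_{i,j=1}^{N}\sum_{n=0}^{M(i)}\sum_{m=0}^{M(j)}c_{ijnm}\,\sigma_{\bar n}(z,a_i)\,\overline{\sigma_{\bar m}(w,a_j)}.$$
   Context: $H^2(b\Omega)$ is the closure in $L^2(b\Omega,ds)$ of the boundary values of holomorphic functions on $\Omega$ that are $C^\infty$ up to the boundary; it is also the closed subspace of $L^2_\phi(b\Omega)$ ($L^2$ with respect to $\phi\,ds$) obtained in the same way. The weighted Szegő kernel $\sigma(z,w)$ is the kernel of the orthogonal projection of $L^2_\phi(b\Omega)$ onto $H^2(b\Omega)$, so that $h(z)=\int_{b\Omega}\sigma(z,w)h(w)\phi(w)\,ds_w$ for $h\in H^2(b\Omega)$, $z\in\Omega$. Notation: $\sigma_{\bar n}(z,w)=\frac{\partial^n}{\partial\bar w^n}\sigma(z,w)$, $\sigma_{\bar 0}=\sigma$. *)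

theory Defs
  imports "HOL-Complex_Analysis.Complex_Analysis"
begin

fun Ck :: "nat \<Rightarrow> ('a::real_normed_vector \<Rightarrow> 'b::real_normed_vector) \<Rightarrow> bool" where
  "Ck 0 f = continuous_on UNIV f"
| "Ck (Suc n) f = ((\<forall>x. f differentiable (at x)) \<and>
                    (\<forall>v. Ck n (\<lambda>x. frechet_derivative f (at x) v)))"

definition smooth :: "('a::real_normed_vector \<Rightarrow> 'b::real_normed_vector) \<Rightarrow> bool" where
  "smooth f \<longleftrightarrow> (\<forall>n. Ck n f)"

definition smooth_simple_closed_curve :: "(real \<Rightarrow> complex) \<Rightarrow> bool" where
  "smooth_simple_closed_curve \<gamma> \<longleftrightarrow>
     smooth \<gamma> \<and> (\<forall>t. \<gamma> (t + 1) = \<gamma> t) \<and> inj_on \<gamma> {0..<1} \<and>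
     (\<forall>t. vector_derivative \<gamma> (at t) \<noteq> 0)"

definition smooth_bounded_domain :: "complex set \<Rightarrow> nat \<Rightarrow> (nat \<Rightarrow> real \<Rightarrow> complex) \<Rightarrow> bool" where
  "smooth_bounded_domain \<Omega> K \<Gamma> \<longleftrightarrow>
     open \<Omega> \<and> connected \<Omega> \<and> \<Omega> \<noteq> {} \<and> bounded \<Omega> \<and> K \<ge> 1 \<and>
     (\<forall>k<K. smooth_simple_closed_curve (\<Gamma> k)) \<and>
     (\<forall>k<K. \<forall>l<K. k \<noteq> l \<longrightarrow> \<Gamma> k ` {0..1} \<inter> \<Gamma> l ` {0..1} = {}) \<and>
     frontier \<Omega> = (\<Union>k<K. \<Gamma> k ` {0..1})"

definition bint :: "nat \<Rightarrow> (nat \<Rightarrow> real \<Rightarrow> complex) \<Rightarrow> (complex \<Rightarrow> complex) \<Rightarrow> complex" where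
  "bint K \<Gamma> F = (\<Sum>k<K. LINT t:{0..1}|lborel.
       F (\<Gamma> k t) * of_real (norm (vector_derivative (\<Gamma> k) (at t))))"

text \<open>Membership in L^2(b\<Omega>, ds) (equivalently L^2_phi, phi being bounded above and below).\<close>
definition bL2 :: "nat \<Rightarrow> (nat \<Rightarrow> real \<Rightarrow> complex) \<Rightarrow> (complex \<Rightarrow> complex) \<Rightarrow> bool" where
  "bL2 K \<Gamma> F \<longleftrightarrow> (\<forall>k<K. (\<lambda>t. F (\<Gamma> k t)) \<in> borel_measurable lborel \<and>
       set_integrable lborel {0..1} (\<lambda>t. (cmod (F (\<Gamma> k t)))\<^sup>2))"

definition smooth_hol :: "complex set \<Rightarrow> (complex \<Rightarrow> complex) \<Rightarrow> bool" where
  "smooth_hol \<Omega> g \<longleftrightarrow> g holomorphic_on \<Omega> \<and> (\<exists>G::complex \<Rightarrow> complex. smooth G \<and> (\<forall>z\<in>closure \<Omega>. G z = g z))"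

text \<open>H^2(b\<Omega>): a function H whose values on b\<Omega> are an L^2-limit of boundary values of
  functions holomorphic on \<Omega> and smooth up to the boundary, and whose values on \<Omega> are the
  (holomorphic) limits of those functions, i.e. the holomorphic extension of the H^2 element.\<close>
definition hardy :: "complex set \<Rightarrow> nat \<Rightarrow> (nat \<Rightarrow> real \<Rightarrow> complex) \<Rightarrow> (complex \<Rightarrow> complex) \<Rightarrow> bool" where
  "hardy \<Omega> K \<Gamma> H \<longleftrightarrow> H holomorphic_on \<Omega> \<and> bL2 K \<Gamma> H \<and>
     (\<exists>g::nat \<Rightarrow> complex \<Rightarrow> complex. (\<forall>n. smooth_hol \<Omega> (g n)) \<and>
        (\<lambda>n. bint K \<Gamma> (\<lambda>\<zeta>. of_real ((cmod (g n \<zeta> - H \<zeta>))\<^sup>2))) \<longlonglongrightarrow> 0 \<and>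
        (\<forall>z\<in>\<Omega>. (\<lambda>n. g n z) \<longlonglongrightarrow> H z))"

definition weighted_szego :: "complex set \<Rightarrow> nat \<Rightarrow> (nat \<Rightarrow> real \<Rightarrow> complex) \<Rightarrow> (complex \<Rightarrow> real)
     \<Rightarrow> (complex \<Rightarrow> complex \<Rightarrow> complex) \<Rightarrow> bool" where
  "weighted_szego \<Omega> K \<Gamma> \<phi> \<sigma> \<longleftrightarrow>
     (\<forall>w\<in>\<Omega>. hardy \<Omega> K \<Gamma> (\<lambda>z. \<sigma> z w) \<and>
        (\<forall>H. hardy \<Omega> K \<Gamma> H \<longrightarrow> H w = bint K \<Gamma> (\<lambda>\<zeta>. H \<zeta> * cnj (\<sigma> \<zeta> w) * of_real (\<phi> \<zeta>))))"

definition dbar :: "(complex \<Rightarrow> complex) \<Rightarrow> complex \<Rightarrow> complex" where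
  "dbar g w = (frechet_derivative g (at w) 1 + \<i> * frechet_derivative g (at w) \<i>) / 2"

definition sigma_bar :: "(complex \<Rightarrow> complex \<Rightarrow> complex) \<Rightarrow> nat \<Rightarrow> complex \<Rightarrow> complex \<Rightarrow> complex" where
  "sigma_bar \<sigma> n z w = (dbar ^^ n) (\<lambda>w'. \<sigma> z w') w"

definition proper_to_disc :: "complex set \<Rightarrow> (complex \<Rightarrow> complex) \<Rightarrow> bool" where
  "proper_to_disc \<Omega> f \<longleftrightarrow> f ` \<Omega> \<subseteq> ball 0 1 \<and>
     (\<forall>C. compact C \<and> C \<subseteq> ball 0 1 \<longrightarrow> compact {z\<in>\<Omega>. f z \<in> C})"

end

theory Submission
  imports Defs
begin

text \<open>
  Multiplication by \<open>f\<close> is an isometry of the Hardy space \<open>H\<^sup>2\<close>, because \<open>\<bar>f\<bar> = 1\<close> on the boundary. Hence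
  \<open>e\<^sub>w(H) = H(w) - f(w) \<langle>H, f \<sigma>(\<cdot>,w)\<rangle>\<close> vanishes on \<open>f H\<^sup>2\<close>, that is, on all \<open>H\<close> whose derivatives
  of order below \<open>M(i)\<close> vanish at every \<open>a\<^sub>i\<close>, so \<open>e\<^sub>w\<close> is a combination of these finitely many
  evaluation functionals. The reproducing property gives
  \<open>e\<^sub>w(\<sigma>(\<cdot>,z)) = \<sigma>(w,z) (1 - f(w) cnj (f(z)))\<close>, which is Hermitian in \<open>(w,z)\<close>; applying the same
  argument in the other variable gives the double sum.

  The analytic input is kept elementary. By the minimum principle for
  \<open>f(z) ((z - c) / \<rho>)\<^sup>n\<close>, where the disc of radius \<open>\<rho>\<close> about \<open>c\<close> touches the boundary from outside,
  \<open>1 - \<bar>f\<bar>\<close> is at most linear in the distance along a normal; with the Schwarz-Pick lemma \<open>f'\<close> is bounded along normals,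
  so \<open>f\<close> has unimodular limits there. Bounded holomorphic functions with such normal limits lie in
  \<open>H\<^sup>2\<close>: their Cauchy integrals over curves pushed slightly outside \<open>\<Omega>\<close> are limits of rational functions
  and converge boundedly to the boundary values.
\<close>

subsection \<open>Smooth functions and their rational examples\<close>

text \<open>The definition of \<open>hardy\<close> asks for approximants that extend smoothly to the
  whole plane, yet nothing is assumed about \<open>f\<close> near the boundary; even its values
  there are arbitrary. Instead of proving regularity of \<open>f\<close> up to the boundary, the
  proof multiplies within the class \<open>bdd_hol\<close>: bounded holomorphic functions whose
  boundary values are their limits along normals. The approximation theorem places this class inside
  \<open>hardy\<close>, and \<open>f\<close> is replaced by an extension \<open>F\<close> with
  corrected boundary values.

  The description of the domain prescribes neither the orientation of the curves nor the side on
  which \<Omega> lies. Both are extracted from the Jordan curve theorem, and the Cauchy formula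
  rests on showing that the curves, suitably oriented, have total winding number one in \<Omega> and
  zero outside its closure.

  The smooth approximants are finite sums of simple poles outside the closure, and only these poles
  have to be smoothed away.\<close>

lemma smooth_coinduct:
  assumes "S f"
    and "\<And>g. S g \<Longrightarrow> \<exists>D. (\<forall>x. (g has_derivative D x) (at x)) \<and> (\<forall>v. S (\<lambda>x. D x v))"
  shows "smooth f"
proof -
  \<comment> \<open>Induction on the order: membership in \<open>S\<close> gives a derivative, hence
    continuity, and every directional derivative stays in \<open>S\<close>. Smoothness thus only
    requires a family closed under directional derivatives.\<close>
  have "Ck n g" if "S g" for n g
    using that
  proof (induction n arbitrary: g)
    case 0
    from assms(2)[OF this] obtain D where D: "\<And>x. (g has_derivative D x) (at x)" by blast
    have "isCont g x" for x
      using D has_derivative_continuous by blast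
    then show ?case
      by (simp add: continuous_at_imp_continuous_on)
  next
    case (Suc n)
    from assms(2)[OF Suc.prems] obtain D where D: "\<And>x. (g has_derivative D x) (at x)"
      and S: "\<And>v. S (\<lambda>x. D x v)" by blast
    have "frechet_derivative g (at x) = D x" for x
      using frechet_derivative_at[OF D] by simp
    then show ?case
      using D S Suc.IH unfolding Ck.simps differentiable_def by auto
  qed
  then show ?thesis
    unfolding smooth_def using assms(1) by blast
qed

text \<open>The classical flat function is the case \<open>m = 0\<close>. The powers in the
  denominator are what repeated differentiation of \<open>exp (- 1 / x)\<close> produces, so
  derivatives stay within the span of the family.\<close>

definition flat_exp :: "nat \<Rightarrow> real \<Rightarrow> real" where
  "flat_exp m x = (if x > 0 then exp (- 1 / x) / x ^ m else 0)"

text \<open>A single term of the series of \<open>exp (1 / x)\<close> beats the power in the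
  denominator with two powers of \<open>x\<close> to spare. The quadratic bound makes the derivative
  at 0 exist and vanish.\<close>

lemma flat_exp_le_square: "\<bar>flat_exp m x\<bar> \<le> fact (m + 2) * x\<^sup>2"
proof (cases "x > 0")
  case True
  define y where "y = 1 / x"
  have y: "y > 0" using True by (simp add: y_def)
  have "(\<Sum>n\<in>{m+2}. y ^ n /\<^sub>R fact n) \<le> (\<Sum>n. y ^ n /\<^sub>R fact n)"
    using y by (intro sum_le_suminf summable_exp_generic) auto
  then have "y ^ (m + 2) / fact (m + 2) \<le> exp y"
    by (simp add: exp_def divide_inverse mult.commute)
  then have "y ^ (m + 2) * exp (- y) \<le> fact (m + 2)"
    by (simp add: exp_minus divide_le_eq pos_divide_le_eq inverse_eq_divide mult.commute del: fact_Suc)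
  then have "x\<^sup>2 * (y ^ (m + 2) * exp (- y)) \<le> x\<^sup>2 * fact (m + 2)"
    by (intro mult_left_mono) auto
  moreover have "x\<^sup>2 * (y ^ (m + 2) * exp (- y)) = flat_exp m x"
    using True by (simp add: flat_exp_def y_def power_add field_simps power2_eq_square)
  moreover have "flat_exp m x \<ge> 0"
    using True by (simp add: flat_exp_def)
  ultimately show ?thesis
    by (simp add: mult.commute)
qed (simp add: flat_exp_def)

lemma flat_exp_has_real_derivative:
  "(flat_exp m has_real_derivative (flat_exp (m + 2) x - real m * flat_exp (m + 1) x)) (at x)"
proof (cases x "0 :: real" rule: linorder_cases)
  case less
  have "((\<lambda>_. 0) has_real_derivative 0) (at x)" by simp
  then have "(flat_exp m has_real_derivative 0) (at x)"
    by (rule has_field_derivative_transform_within_open[of _ _ _ "{..<0}"])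
       (use less in \<open>auto simp: flat_exp_def\<close>)
  then show ?thesis using less by (simp add: flat_exp_def)
next
  case equal
  have "((\<lambda>h. (flat_exp m (0 + h) - flat_exp m 0) / h) \<longlongrightarrow> 0) (at 0)"
  proof (rule Lim_null_comparison)
    show "\<forall>\<^sub>F h in at 0. norm ((flat_exp m (0 + h) - flat_exp m 0) / h) \<le> fact (m + 2) * \<bar>h\<bar>"
    proof (rule eventually_at_topological[THEN iffD2], intro exI[of _ UNIV] conjI ballI impI)
      fix h :: real assume "h \<noteq> 0"
      then show "norm ((flat_exp m (0 + h) - flat_exp m 0) / h) \<le> fact (m + 2) * \<bar>h\<bar>"
        using flat_exp_le_square[of m h]
        by (simp add: flat_exp_def[of m 0] divide_le_eq power2_eq_square abs_mult_self_eq mult.assoc)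
    qed auto
    show "((\<lambda>h::real. fact (m + 2) * \<bar>h\<bar>) \<longlongrightarrow> 0) (at 0)"
      by (auto intro!: tendsto_eq_intros)
  qed
  then have "(flat_exp m has_real_derivative 0) (at 0)"
    by (simp add: DERIV_def)
  then show ?thesis using equal by (simp add: flat_exp_def)
next
  case greater
  have "x ^ (m + 1) = x * x * x ^ (m - 1)" if "m > 0"
    using that by (cases m) auto
  then have "((\<lambda>x. exp (- 1 / x) / x ^ m) has_real_derivative
      (flat_exp (m + 2) x - real m * flat_exp (m + 1) x)) (at x)"
    using greater
    by (cases "m = 0")
      (auto intro!: derivative_eq_intros simp: flat_exp_def field_simps power2_eq_square)
  then show ?thesis
    by (rule has_field_derivative_transform_within_open[of _ _ _ "{0<..}"])
       (use greater in \<open>auto simp: flat_exp_def\<close>)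
qed

text \<open>The denominator \<open>\<bar>z - b\<bar>\<^sup>2 + flat_exp 0 (d\<^sup>2 - \<bar>z - b\<bar>\<^sup>2)\<close> is smooth and never zero, and equals
  \<open>\<bar>z - b\<bar>\<^sup>2\<close> outside the disc of radius \<open>d\<close>.\<close>

definition mollified_inv :: "complex \<Rightarrow> real \<Rightarrow> complex \<Rightarrow> real" where
  "mollified_inv b d z = 1 / ((cmod (z - b))\<^sup>2 + flat_exp 0 (d\<^sup>2 - (cmod (z - b))\<^sup>2))"

lemma mollified_inv_denominator_pos:
  assumes "d > 0"
  shows "(cmod (z - b))\<^sup>2 + flat_exp 0 (d\<^sup>2 - (cmod (z - b))\<^sup>2) > 0"
  using assms by (cases "z = b") (auto simp: flat_exp_def intro!: add_pos_nonneg)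

text \<open>The family to which \<open>smooth_coinduct\<close> is applied. The rule
  \<open>lin\<close> concerns real-linear maps, so it covers conjugation and inner products with a
  fixed vector; \<open>flat\<close> admits every \<open>m\<close> because differentiation raises
  it.\<close>

inductive elem_smooth :: "(complex \<Rightarrow> complex) \<Rightarrow> bool" where
  const: "elem_smooth (\<lambda>_. c)"
| lin: "bounded_linear L \<Longrightarrow> elem_smooth L"
| flat: "elem_smooth (\<lambda>z. of_real (flat_exp m (d\<^sup>2 - (cmod (z - b))\<^sup>2)))"
| inv: "d > 0 \<Longrightarrow> elem_smooth (\<lambda>z. of_real (mollified_inv b d z))"
| add: "elem_smooth f \<Longrightarrow> elem_smooth g \<Longrightarrow> elem_smooth (\<lambda>z. f z + g z)"
| mult: "elem_smooth f \<Longrightarrow> elem_smooth g \<Longrightarrow> elem_smooth (\<lambda>z. f z * g z)"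

lemma elem_smooth_inner: "elem_smooth (\<lambda>z. of_real (2 * ((z - b) \<bullet> v)))"
proof -
  have "elem_smooth (\<lambda>z. of_real (2 * (z \<bullet> v)))"
    by (rule lin) (auto intro!: bounded_linear_intros bounded_linear_compose[OF bounded_linear_of_real]
        bounded_linear_const_mult bounded_linear_inner_left)
  from add[OF this const[of "of_real (- 2 * (b \<bullet> v))"]]
  show ?thesis
    by (simp add: inner_diff_left algebra_simps)
qed

lemma has_derivative_cmod_square:
  "((\<lambda>z. (cmod (z - b))\<^sup>2) has_derivative (\<lambda>v. 2 * ((z - b) \<bullet> v))) (at z)"
  unfolding power2_norm_eq_inner
  by (auto intro!: derivative_eq_intros simp: inner_commute)

lemma has_derivative_flat:
  "((\<lambda>z. flat_exp m (d\<^sup>2 - (cmod (z - b))\<^sup>2)) has_derivative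
     (\<lambda>v. (flat_exp (m + 2) (d\<^sup>2 - (cmod (z - b))\<^sup>2) -
        real m * flat_exp (m + 1) (d\<^sup>2 - (cmod (z - b))\<^sup>2)) * (- (2 * ((z - b) \<bullet> v))))) (at z)"
proof -
  have "((\<lambda>z. d\<^sup>2 - (cmod (z - b))\<^sup>2) has_derivative (\<lambda>v. - (2 * ((z - b) \<bullet> v)))) (at z)"
    using has_derivative_diff[OF has_derivative_const has_derivative_cmod_square] by fastforce
  from has_derivative_compose[OF this flat_exp_has_real_derivative[unfolded has_field_derivative_def]]
  show ?thesis .
qed

lemma elem_smooth_derivative:
  assumes "elem_smooth f"
  shows "\<exists>D. (\<forall>x. (f has_derivative D x) (at x)) \<and> (\<forall>v. elem_smooth (\<lambda>x. D x v))"
  using assms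
proof induction
  case (const c)
  show ?case by (rule exI[of _ "\<lambda>_ _. 0"]) (auto intro: elem_smooth.const)
next
  case (lin L)
  show ?case
    by (rule exI[of _ "\<lambda>_. L"])
       (auto intro: elem_smooth.const bounded_linear_imp_has_derivative lin)
next
  case (flat m d b)
  let ?E = "\<lambda>m z. flat_exp m (d\<^sup>2 - (cmod (z - b))\<^sup>2)"
  let ?D = "\<lambda>z v. of_real ((?E (m + 2) z - real m * ?E (m + 1) z) * (- (2 * ((z - b) \<bullet> v)))) :: complex"
  have "((\<lambda>z. of_real (?E m z)) has_derivative ?D z) (at z)" for z
    by (rule has_derivative_of_real[OF has_derivative_flat])
  moreover have "elem_smooth (\<lambda>z. ?D z v)" for v
  proof -
    have "elem_smooth (\<lambda>z. (of_real (?E (m + 2) z) + (- of_real m) * of_real (?E (m + 1) z)) *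
       ((-1) * of_real (2 * ((z - b) \<bullet> v))))"
      by (intro elem_smooth.intros elem_smooth_inner)
    then show ?thesis by simp
  qed
  ultimately show ?case by (intro exI[of _ ?D]) auto
next
  case (inv d b)
  let ?q = "\<lambda>z. mollified_inv b d z"
  let ?E = "\<lambda>m z. flat_exp m (d\<^sup>2 - (cmod (z - b))\<^sup>2)"
  let ?P = "\<lambda>z v. 2 * ((z - b) \<bullet> v) + (?E (0 + 2) z - real 0 * ?E (0 + 1) z) * (- (2 * ((z - b) \<bullet> v)))"
  let ?D = "\<lambda>z v. of_real (- (?q z * ?P z v * ?q z)) :: complex"
  have "((\<lambda>z. of_real (?q z)) has_derivative ?D z) (at z)" for z
  proof (rule has_derivative_of_real)
    have nz: "(cmod (z - b))\<^sup>2 + ?E 0 z \<noteq> 0"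
      using mollified_inv_denominator_pos[OF inv, of z b] by linarith
    have "((\<lambda>z. (cmod (z - b))\<^sup>2 + ?E 0 z) has_derivative ?P z) (at z)"
      by (rule has_derivative_add[OF has_derivative_cmod_square has_derivative_flat])
    from Deriv.has_derivative_inverse[OF nz this]
    show "(?q has_derivative (\<lambda>v. - (?q z * ?P z v * ?q z))) (at z)"
      by (simp add: mollified_inv_def inverse_eq_divide)
  qed
  moreover have "elem_smooth (\<lambda>z. ?D z v)" for v
  proof -
    have "elem_smooth (\<lambda>z. (-1) * (of_real (?q z) * (of_real (2 * ((z - b) \<bullet> v)) +
       of_real (?E 2 z) * ((-1) * of_real (2 * ((z - b) \<bullet> v)))) * of_real (?q z)))"
      by (intro elem_smooth.intros elem_smooth_inner inv)
    then show ?thesis by (simp add: numeral_2_eq_2)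
  qed
  ultimately show ?case by (intro exI[of _ ?D]) auto
next
  case (add f g)
  then obtain D D' where "\<And>x. (f has_derivative D x) (at x)" "\<And>v. elem_smooth (\<lambda>x. D x v)"
    "\<And>x. (g has_derivative D' x) (at x)" "\<And>v. elem_smooth (\<lambda>x. D' x v)" by blast
  then show ?case
    by (intro exI[of _ "\<lambda>x v. D x v + D' x v"]) (auto intro: has_derivative_add elem_smooth.add)
next
  case (mult f g)
  then obtain D D' where D: "\<And>x. (f has_derivative D x) (at x)" "\<And>v. elem_smooth (\<lambda>x. D x v)"
    "\<And>x. (g has_derivative D' x) (at x)" "\<And>v. elem_smooth (\<lambda>x. D' x v)" by blast
  show ?case
  proof (intro exI[of _ "\<lambda>x v. f x * D' x v + D x v * g x"] conjI allI)
    show "((\<lambda>z. f z * g z) has_derivative (\<lambda>v. f x * D' x v + D x v * g x)) (at x)" for x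
      using has_derivative_mult[OF D(1,3)] .
    show "elem_smooth (\<lambda>x. f x * D' x v + D x v * g x)" for v
      by (intro elem_smooth.add elem_smooth.mult mult.hyps D)
  qed
qed

lemma elem_smooth_imp_smooth: "elem_smooth f \<Longrightarrow> smooth f"
  by (erule smooth_coinduct) (rule elem_smooth_derivative)

lemma elem_smooth_sum: "(\<And>i. i \<in> I \<Longrightarrow> elem_smooth (f i)) \<Longrightarrow> elem_smooth (\<lambda>z. \<Sum>i\<in>I. f i z)"
  by (induction I rule: infinite_finite_induct) (auto intro: elem_smooth.const elem_smooth.add)

text \<open>\<open>1 / (z - b)\<close> equals \<open>cnj (z - b) / (cmod (z - b))\<^sup>2\<close>.
  Replacing the reciprocal square by \<open>mollified_inv\<close>, with a radius not exceeding the
  distance of the pole from the closure, changes nothing on the closure and removes the pole. These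
  sums supply the approximants for the Hardy space.\<close>

lemma smooth_hol_sum_poles:
  assumes "finite I" and b: "\<And>i. i \<in> I \<Longrightarrow> b i \<notin> closure \<Omega>"
  shows "smooth_hol \<Omega> (\<lambda>z. \<Sum>i\<in>I. c i / (z - b i))"
proof -
  have "\<exists>d>0. \<forall>z\<in>closure \<Omega>. d \<le> dist (b i) z" if "i \<in> I" for i
    using separate_point_closed[OF closed_closure b[OF that]] .
  then obtain d where d: "\<And>i. i \<in> I \<Longrightarrow> d i > 0" "\<And>i z. i \<in> I \<Longrightarrow> z \<in> closure \<Omega> \<Longrightarrow> d i \<le> dist (b i) z"
    by metis
  define G where "G z = (\<Sum>i\<in>I. (c i * (cnj (z - b i))) * of_real (mollified_inv (b i) (d i) z))" for z
  have eq: "G z = (\<Sum>i\<in>I. c i / (z - b i))" if z: "z \<in> closure \<Omega>" for z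
    unfolding G_def
  proof (rule sum.cong)
    fix i assume i: "i \<in> I"
    have "d i \<le> cmod (z - b i)" using d(2)[OF i z] by (simp add: dist_norm norm_minus_commute)
    then have "(d i)\<^sup>2 \<le> (cmod (z - b i))\<^sup>2" using d(1)[OF i] by (intro power_mono) auto
    then have "mollified_inv (b i) (d i) z = 1 / (cmod (z - b i))\<^sup>2"
      by (simp add: mollified_inv_def flat_exp_def)
    moreover have "z - b i \<noteq> 0" using b[OF i] z by auto
    moreover have "cnj u * of_real (1 / (cmod u)\<^sup>2) = 1 / u" if "u \<noteq> 0" for u
      using that complex_norm_square[of u] by (simp add: field_simps)
    ultimately show "c i * cnj (z - b i) * of_real (mollified_inv (b i) (d i) z) = c i / (z - b i)"
      by (simp add: mult.assoc del: complex_cnj_diff of_real_divide)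
  qed simp
  have sm: "elem_smooth (\<lambda>z. cnj (z - b i))" for i
  proof -
    have "elem_smooth (\<lambda>z. cnj z + (- cnj (b i)))"
      by (intro elem_smooth.add elem_smooth.lin elem_smooth.const bounded_linear_cnj)
    then show ?thesis by simp
  qed
  have "elem_smooth G"
    unfolding G_def
    by (intro elem_smooth_sum elem_smooth.mult elem_smooth.const elem_smooth.inv sm d)
  moreover have "(\<lambda>z. \<Sum>i\<in>I. c i / (z - b i)) holomorphic_on \<Omega>"
    using b closure_subset[of \<Omega>] by (intro holomorphic_intros) auto
  ultimately show ?thesis
    unfolding smooth_hol_def using eq elem_smooth_imp_smooth by blast
qed

lemma smooth_imp_Ck: "smooth f \<Longrightarrow> Ck n f"
  by (simp add: smooth_def)

lemma smooth_imp_continuous: "smooth f \<Longrightarrow> continuous_on UNIV f"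
  using smooth_imp_Ck[of f 0] by simp

lemma smooth_vector_derivative:
  fixes \<gamma> :: "real \<Rightarrow> 'a::real_normed_vector"
  assumes "smooth \<gamma>"
  shows "(\<gamma> has_vector_derivative vector_derivative \<gamma> (at t)) (at t)"
    and "smooth (\<lambda>t. vector_derivative \<gamma> (at t))"
proof -
  have d: "\<gamma> differentiable (at t)" for t
    using smooth_imp_Ck[OF assms, of 1] by simp
  then show *: "(\<gamma> has_vector_derivative vector_derivative \<gamma> (at t)) (at t)" for t
    using vector_derivative_works by blast
  have "vector_derivative \<gamma> (at t) = frechet_derivative \<gamma> (at t) 1" for t
    using frechet_derivative_at[OF *[unfolded has_vector_derivative_def]] by (metis scaleR_one)
  moreover have "Ck n (\<lambda>x. frechet_derivative \<gamma> (at x) 1)" for n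
    using smooth_imp_Ck[OF assms, of "Suc n"] by simp
  ultimately show "smooth (\<lambda>t. vector_derivative \<gamma> (at t))"
    unfolding smooth_def by presburger
qed

subsection \<open>Smooth simple closed curves\<close>

lemma periodic_of_int:
  fixes g :: "real \<Rightarrow> 'a"
  assumes "\<forall>t. g (t + 1) = g t"
  shows "g (t + of_int n) = g t"
proof (induction n rule: int_induct[where k = 0])
  case (step1 i)
  have "g (t + of_int i + 1) = g (t + of_int i)" using assms by blast
  then show ?case using step1 by (simp add: add.assoc)
next
  case (step2 i)
  have "g (t + of_int (i - 1) + 1) = g (t + of_int (i - 1))" using assms by blast
  then show ?case using step2 by simp
qed simp

lemma periodic_frac:
  fixes g :: "real \<Rightarrow> 'a"
  assumes "\<forall>t. g (t + 1) = g t"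
  shows "g (frac t) = g t"
  using periodic_of_int[OF assms, of t "- \<lfloor>t\<rfloor>"] by (simp add: frac_def)

lemma periodic_bounded:
  fixes g :: "real \<Rightarrow> 'a::real_normed_vector"
  assumes "\<forall>t. g (t + 1) = g t" "continuous_on UNIV g"
  shows "\<exists>B>0. \<forall>t. norm (g t) \<le> B"
proof -
  have "compact (g ` {0..1})"
    using assms(2) by (intro compact_continuous_image) (auto intro: continuous_on_subset)
  then obtain B where B: "B > 0" "\<And>x. x \<in> g ` {0..1} \<Longrightarrow> norm x \<le> B"
    using compact_imp_bounded[of "g ` {0..1}"] unfolding bounded_pos by metis
  have "norm (g t) \<le> B" for t
  proof -
    have "g (frac t) \<in> g ` {0..1}" using frac_ge_0[of t] frac_lt_1[of t] by (intro imageI) auto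
    then show ?thesis using B(2) periodic_frac[OF assms(1), of t] by fastforce
  qed
  then show ?thesis using B(1) by blast
qed

lemma periodic_bounded_below:
  fixes g :: "real \<Rightarrow> 'a::real_normed_vector"
  assumes "\<forall>t. g (t + 1) = g t" "continuous_on UNIV g" "\<forall>t. g t \<noteq> 0"
  shows "\<exists>m>0. \<forall>t. m \<le> norm (g t)"
proof -
  have "continuous_on {0..1} (\<lambda>t. norm (g t))"
    using assms(2) by (intro continuous_intros) (auto intro: continuous_on_subset)
  then obtain t0 where t0: "\<And>t. t \<in> {0..1} \<Longrightarrow> norm (g t0) \<le> norm (g t)"
    using continuous_attains_inf[of "{0..1::real}" "\<lambda>t. norm (g t)"] by fastforce
  have "norm (g t0) \<le> norm (g t)" for t
  proof -
    have "norm (g t0) \<le> norm (g (frac t))"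
      using frac_ge_0[of t] frac_lt_1[of t] by (intro t0) auto
    then show ?thesis using periodic_frac[OF assms(1), of t] by simp
  qed
  then show ?thesis using assms(3) by (intro exI[of _ "norm (g t0)"]) auto
qed

lemma periodic_vector_derivative:
  fixes g :: "real \<Rightarrow> 'a::real_normed_vector"
  assumes "\<forall>t. g (t + 1) = g t" "\<And>t. (g has_vector_derivative g' t) (at t)"
  shows "\<forall>t. g' (t + 1) = g' t"
proof
  fix t
  have "((\<lambda>x. x + 1) has_vector_derivative 1) (at t)"
    by (auto intro!: derivative_eq_intros)
  from vector_diff_chain_at[OF this assms(2)]
  have "(g \<circ> (\<lambda>x. x + 1) has_vector_derivative g' (t + 1)) (at t)" by simp
  moreover have "g \<circ> (\<lambda>x. x + 1) = g" using assms(1) by auto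
  ultimately show "g' (t + 1) = g' t"
    using vector_derivative_unique_at[OF _ assms(2)[of t], of "g' (t + 1)"] by simp
qed

lemma vector_derivative_bound:
  fixes f :: "real \<Rightarrow> 'a::real_normed_vector"
  assumes "\<And>x. x \<in> closed_segment t s \<Longrightarrow> (f has_vector_derivative f' x) (at x)"
    and "\<And>x. x \<in> closed_segment t s \<Longrightarrow> norm (f' x) \<le> B"
  shows "norm (f s - f t) \<le> B * \<bar>s - t\<bar>"
proof -
  have "norm (f s - f t) \<le> B * norm (s - t)"
  proof (rule differentiable_bound[where S = "closed_segment t s" and f' = "\<lambda>x h. h *\<^sub>R f' x"])
    show "(f has_derivative (\<lambda>h. h *\<^sub>R f' x)) (at x within closed_segment t s)"
      if "x \<in> closed_segment t s" for x
      using has_derivative_at_withinI[OF assms(1)[OF that, unfolded has_vector_derivative_def]] .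
    show "onorm (\<lambda>h. h *\<^sub>R f' x) \<le> B" if "x \<in> closed_segment t s" for x
      by (rule onorm_le) (use assms(2)[OF that] in \<open>simp add: mult.commute[of B] mult_left_mono\<close>)
  qed auto
  then show ?thesis by simp
qed

section \<open>Quantitative geometry of one closed curve\<close>

locale smooth_curve =
  fixes \<gamma> :: "real \<Rightarrow> complex"
  assumes curve: "smooth_simple_closed_curve \<gamma>"
begin

abbreviation "\<gamma>' \<equiv> \<lambda>t. vector_derivative \<gamma> (at t)"
abbreviation "\<gamma>'' \<equiv> \<lambda>t. vector_derivative \<gamma>' (at t)"

lemma smooth: "smooth \<gamma>" "smooth \<gamma>'" "smooth \<gamma>''"
  using curve unfolding smooth_simple_closed_curve_def by (auto intro!: smooth_vector_derivative(2))

lemma derivs: "(\<gamma> has_vector_derivative \<gamma>' t) (at t)" "(\<gamma>' has_vector_derivative \<gamma>'' t) (at t)"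
  by (rule smooth_vector_derivative(1)[OF smooth(1)], rule smooth_vector_derivative(1)[OF smooth(2)])

lemma periodic: "\<forall>t. \<gamma> (t + 1) = \<gamma> t" "\<forall>t. \<gamma>' (t + 1) = \<gamma>' t" "\<forall>t. \<gamma>'' (t + 1) = \<gamma>'' t"
proof -
  show 1: "\<forall>t. \<gamma> (t + 1) = \<gamma> t" using curve unfolding smooth_simple_closed_curve_def by blast
  show 2: "\<forall>t. \<gamma>' (t + 1) = \<gamma>' t" by (rule periodic_vector_derivative[OF 1 derivs(1)])
  show "\<forall>t. \<gamma>'' (t + 1) = \<gamma>'' t" by (rule periodic_vector_derivative[OF 2 derivs(2)])
qed

lemma nonzero: "\<gamma>' t \<noteq> 0"
  using curve unfolding smooth_simple_closed_curve_def by blast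

lemma cont: "continuous_on A \<gamma>" "continuous_on A \<gamma>'" "continuous_on A \<gamma>''"
  using smooth[THEN smooth_imp_continuous] by (auto intro: continuous_on_subset)

lemma eq_imp_shift:
  assumes "\<gamma> s = \<gamma> t"
  shows "s - t \<in> \<int>"
proof -
  have "\<gamma> (frac s) = \<gamma> (frac t)"
    using assms periodic_frac[OF periodic(1)] by simp
  then have "frac s = frac t"
    using curve frac_ge_0[of s] frac_lt_1[of s] frac_ge_0[of t] frac_lt_1[of t]
    unfolding smooth_simple_closed_curve_def inj_on_def by (meson atLeastLessThan_iff)
  then have "s - t = of_int (\<lfloor>s\<rfloor> - \<lfloor>t\<rfloor>)" by (simp add: frac_def)
  then show ?thesis by (metis Ints_of_int)
qed

text \<open>Parameter distance and chord length can only be compared after reducing modulo the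
  period. Rounding \<open>s - frac t\<close> picks the copy of \<open>s\<close> closest to
  \<open>frac t\<close>; the derivative is periodic too, so estimates transfer back.\<close>

lemma representatives:
  obtains s' t' where "\<gamma> s' = \<gamma> s" "\<gamma> t' = \<gamma> t" "\<gamma>' s' = \<gamma>' s" "\<gamma>' t' = \<gamma>' t"
    "t' \<in> {0..1}" "\<bar>s' - t'\<bar> \<le> 1/2"
proof (rule that[of "s + of_int (- round (s - frac t))" "frac t"])
  show "\<bar>s + of_int (- round (s - frac t)) - frac t\<bar> \<le> 1/2"
    using of_int_round_abs_le[of "s - frac t"] by (simp add: abs_minus_commute algebra_simps)
  show "frac t \<in> {0..1}" using frac_ge_0[of t] frac_lt_1[of t] by auto
qed (simp_all only: periodic_of_int[OF periodic(1)] periodic_of_int[OF periodic(2)]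
      periodic_frac[OF periodic(1)] periodic_frac[OF periodic(2)])

lemma derivative_bounds:
  obtains m B where "m > 0" "B > 0" "\<And>t. m \<le> cmod (\<gamma>' t)" "\<And>t. cmod (\<gamma>' t) \<le> B"
    "\<And>s t. cmod (\<gamma>' s - \<gamma>' t) \<le> B * \<bar>s - t\<bar>"
    "\<And>s t. cmod (\<gamma> s - \<gamma> t - (s - t) *\<^sub>R \<gamma>' t) \<le> B * (s - t)\<^sup>2"
proof -
  obtain m where m: "m > 0" "\<And>t. m \<le> cmod (\<gamma>' t)"
    using periodic_bounded_below[OF periodic(2) cont(2)] nonzero by blast
  obtain B1 where B1: "B1 > 0" "\<And>t. cmod (\<gamma>' t) \<le> B1"
    using periodic_bounded[OF periodic(2) cont(2)] by blast
  obtain B2 where B2: "B2 > 0" "\<And>t. cmod (\<gamma>'' t) \<le> B2"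
    using periodic_bounded[OF periodic(3) cont(3)] by blast
  have lip: "cmod (\<gamma>' s - \<gamma>' t) \<le> max B1 B2 * \<bar>s - t\<bar>" for s t
    by (rule vector_derivative_bound[of _ _ _ \<gamma>'']) (use derivs B2 in \<open>auto simp: le_max_iff_disj\<close>)
  have taylor: "cmod (\<gamma> s - \<gamma> t - (s - t) *\<^sub>R \<gamma>' t) \<le> max B1 B2 * (s - t)\<^sup>2" for s t
  proof -
    have "cmod ((\<gamma> s - s *\<^sub>R \<gamma>' t) - (\<gamma> t - t *\<^sub>R \<gamma>' t)) \<le> (max B1 B2 * \<bar>s - t\<bar>) * \<bar>s - t\<bar>"
    proof (rule vector_derivative_bound[of _ _ _ "\<lambda>x. \<gamma>' x - \<gamma>' t"])
      show "((\<lambda>x. \<gamma> x - x *\<^sub>R \<gamma>' t) has_vector_derivative \<gamma>' x - \<gamma>' t) (at x)" for x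
        by (auto intro!: derivative_eq_intros derivs)
      fix x assume "x \<in> closed_segment t s"
      then have "\<bar>x - t\<bar> \<le> \<bar>s - t\<bar>" by (auto simp: closed_segment_eq_real_ivl split: if_splits)
      then have "max B1 B2 * \<bar>x - t\<bar> \<le> max B1 B2 * \<bar>s - t\<bar>"
        using B1 by (intro mult_left_mono) auto
      then show "cmod (\<gamma>' x - \<gamma>' t) \<le> max B1 B2 * \<bar>s - t\<bar>" using lip[of x t] by linarith
    qed
    then show ?thesis by (simp add: algebra_simps power2_eq_square abs_mult_self_eq)
  qed
  show ?thesis
    by (rule that[of m "max B1 B2"]) (use m B1 B2 lip taylor in \<open>auto simp: le_max_iff_disj\<close>)
qed

text \<open>Close to the diagonal the linear Taylor term dominates; on the rest of the strip, which
  is compact, the chord is positive because equal values force an integer shift. The limit 1/2 on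
  the parameter distance keeps shifts by a full period out of the strip.\<close>

lemma chord_lower_bound:
  obtains c where "c > 0" "\<And>s t. t \<in> {0..1} \<Longrightarrow> \<bar>s - t\<bar> \<le> 1/2 \<Longrightarrow> c * \<bar>s - t\<bar> \<le> cmod (\<gamma> s - \<gamma> t)"
proof -
  obtain m B where mB: "m > 0" "B > 0" "\<And>t. m \<le> cmod (\<gamma>' t)"
    "\<And>s t. cmod (\<gamma> s - \<gamma> t - (s - t) *\<^sub>R \<gamma>' t) \<le> B * (s - t)\<^sup>2"
    using derivative_bounds by metis
  \<comment> \<open>For parameters this close the quadratic Taylor error is at most half of the
    linear term, which is at least \<open>m * \<bar>s - t\<bar>\<close>.\<close>
  define \<delta> where "\<delta> = m / (2 * B)"
  have \<delta>: "\<delta> > 0" using mB by (simp add: \<delta>_def)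
  have near: "m / 2 * \<bar>s - t\<bar> \<le> cmod (\<gamma> s - \<gamma> t)" if "\<bar>s - t\<bar> \<le> \<delta>" for s t
  proof -
    have "cmod ((s - t) *\<^sub>R \<gamma>' t) \<le> cmod (\<gamma> s - \<gamma> t) + cmod (\<gamma> s - \<gamma> t - (s - t) *\<^sub>R \<gamma>' t)"
      using norm_triangle_sub[of "(s - t) *\<^sub>R \<gamma>' t" "\<gamma> s - \<gamma> t"] by (simp add: norm_minus_commute)
    moreover have "m * \<bar>s - t\<bar> \<le> cmod ((s - t) *\<^sub>R \<gamma>' t)"
      using mult_right_mono[OF mB(3)[of t], of "\<bar>s - t\<bar>"] by (simp add: mult.commute)
    moreover have "B * (s - t)\<^sup>2 \<le> m / 2 * \<bar>s - t\<bar>"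
    proof -
      have "B * \<bar>s - t\<bar> \<le> m / 2" using that mB by (simp add: \<delta>_def field_simps)
      then have "(B * \<bar>s - t\<bar>) * \<bar>s - t\<bar> \<le> m / 2 * \<bar>s - t\<bar>" by (intro mult_right_mono) auto
      then show ?thesis by (simp add: power2_eq_square mult.assoc abs_mult_self_eq)
    qed
    ultimately show ?thesis using mB(4)[of s t] by linarith
  qed
  define A where "A = {(s, t). t \<in> {0..1::real} \<and> \<delta> \<le> \<bar>s - t\<bar> \<and> \<bar>s - t\<bar> \<le> 1/2}"
  have "\<exists>\<mu>>0. \<forall>(s, t)\<in>A. \<mu> \<le> cmod (\<gamma> s - \<gamma> t)"
  proof (cases "A = {}")
    case False
    have "closed A"
      unfolding A_def case_prod_beta' mem_Collect_eq atLeastAtMost_iff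
      by (intro closed_Collect_conj closed_Collect_le continuous_intros)
    moreover have "A \<subseteq> {-1..2} \<times> {0..1}"
    proof
      fix x assume "x \<in> A"
      then obtain s t where "x = (s, t)" "0 \<le> t" "t \<le> 1" "\<bar>s - t\<bar> \<le> 1/2" by (auto simp: A_def)
      then have "- 1 \<le> s \<and> s \<le> 2 \<and> x = (s, t) \<and> 0 \<le> t \<and> t \<le> 1" by arith
      then show "x \<in> {-1..2} \<times> {0..1}" by simp
    qed
    moreover have "bounded ({-1..2::real} \<times> {0..1::real})" by (intro bounded_Times) auto
    ultimately have "compact A"
      using bounded_subset[of "{-1..2::real} \<times> {0..1::real}" A] by (simp add: compact_eq_bounded_closed)
    moreover have "continuous_on A (\<lambda>(s, t). cmod (\<gamma> s - \<gamma> t))"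
      unfolding case_prod_beta'
      by (intro continuous_intros continuous_on_compose2[OF cont(1)[of UNIV]]) auto
    ultimately obtain x where x: "x \<in> A" "\<forall>y\<in>A. (\<lambda>(s, t). cmod (\<gamma> s - \<gamma> t)) x \<le> (\<lambda>(s, t). cmod (\<gamma> s - \<gamma> t)) y"
      using continuous_attains_inf False by metis
    obtain s t where st: "x = (s, t)" by fastforce
    have "\<gamma> s \<noteq> \<gamma> t"
    proof
      assume "\<gamma> s = \<gamma> t"
      then obtain n where n: "s - t = of_int n" using eq_imp_shift[of s t] by (auto elim: Ints_cases)
      have le: "\<delta> \<le> \<bar>s - t\<bar>" "\<bar>s - t\<bar> \<le> 1/2" using x st by (auto simp: A_def)
      then have "- 1 < n" "n < 1" using n by linarith+
      then have "n = 0" by simp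
      then show False using n le \<delta> by simp
    qed
    then show ?thesis using x st by (intro exI[of _ "cmod (\<gamma> s - \<gamma> t)"]) auto
  qed (auto intro: exI[of _ 1])
  then obtain \<mu> where \<mu>: "\<mu> > 0" "\<And>s t. (s, t) \<in> A \<Longrightarrow> \<mu> \<le> cmod (\<gamma> s - \<gamma> t)" by blast
  show ?thesis
  proof (rule that[of "min (m / 2) \<mu>"])
    show "min (m / 2) \<mu> > 0" using mB \<mu> by auto
    fix s t :: real assume st: "t \<in> {0..1}" "\<bar>s - t\<bar> \<le> 1/2"
    show "min (m / 2) \<mu> * \<bar>s - t\<bar> \<le> cmod (\<gamma> s - \<gamma> t)"
    proof (cases "\<bar>s - t\<bar> \<le> \<delta>")
      case True
      have "min (m / 2) \<mu> * \<bar>s - t\<bar> \<le> m / 2 * \<bar>s - t\<bar>" by (intro mult_right_mono) auto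
      then show ?thesis using near[OF True] by linarith
    next
      case False
      then have "\<mu> \<le> cmod (\<gamma> s - \<gamma> t)" using st by (intro \<mu>(2)) (auto simp: A_def)
      moreover have "min (m / 2) \<mu> * \<bar>s - t\<bar> \<le> \<mu> * 1"
        using st \<mu> by (intro mult_mono) auto
      ultimately show ?thesis by simp
    qed
  qed
qed

text \<open>The linear Taylor term is orthogonal to the normal \<open>\<i> * \<gamma>' t\<close>, so
  the normal component of a chord is quadratic in the parameter distance, hence in the chord.
  Geometrically, open discs of a fixed size touching the curve at any of its points contain no point
  of the curve. The second bound makes the normal Lipschitz in the point rather than in the
  parameter.\<close>

lemma tangent_disc:
  obtains C where "C > 0"
    "\<And>s t. \<bar>(\<gamma> s - \<gamma> t) \<bullet> (\<i> * \<gamma>' t)\<bar> \<le> C * (cmod (\<gamma> s - \<gamma> t))\<^sup>2"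
    "\<And>s t. cmod (\<gamma>' s - \<gamma>' t) \<le> C * cmod (\<gamma> s - \<gamma> t)"
proof -
  obtain m B where B: "B > 0" "\<And>t. cmod (\<gamma>' t) \<le> B"
    "\<And>s t. cmod (\<gamma>' s - \<gamma>' t) \<le> B * \<bar>s - t\<bar>"
    "\<And>s t. cmod (\<gamma> s - \<gamma> t - (s - t) *\<^sub>R \<gamma>' t) \<le> B * (s - t)\<^sup>2"
    using derivative_bounds by metis
  obtain c where c: "c > 0" "\<And>s t. t \<in> {0..1} \<Longrightarrow> \<bar>s - t\<bar> \<le> 1/2 \<Longrightarrow> c * \<bar>s - t\<bar> \<le> cmod (\<gamma> s - \<gamma> t)"
    using chord_lower_bound by metis
  have 1: "\<bar>(\<gamma> s - \<gamma> t) \<bullet> (\<i> * \<gamma>' t)\<bar> \<le> (B * B / c\<^sup>2) * (cmod (\<gamma> s - \<gamma> t))\<^sup>2" for s t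
  proof -
    obtain s' t' where eq: "\<gamma> s' = \<gamma> s" "\<gamma> t' = \<gamma> t" "\<gamma>' t' = \<gamma>' t" "t' \<in> {0..1}" "\<bar>s' - t'\<bar> \<le> 1/2"
      using representatives by metis
    have "\<gamma>' t' \<bullet> (\<i> * \<gamma>' t') = 0" by (simp add: inner_complex_def)
    then have "(\<gamma> s' - \<gamma> t') \<bullet> (\<i> * \<gamma>' t') = (\<gamma> s' - \<gamma> t' - (s' - t') *\<^sub>R \<gamma>' t') \<bullet> (\<i> * \<gamma>' t')"
      by (simp add: inner_diff_left)
    also have "\<bar>\<dots>\<bar> \<le> cmod (\<gamma> s' - \<gamma> t' - (s' - t') *\<^sub>R \<gamma>' t') * cmod (\<i> * \<gamma>' t')"
      by (rule Cauchy_Schwarz_ineq2)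
    also have "\<dots> \<le> (B * (s' - t')\<^sup>2) * B"
      using B by (intro mult_mono) (auto simp: norm_mult)
    also have "\<dots> = (B * B / c\<^sup>2) * (c * \<bar>s' - t'\<bar>)\<^sup>2"
      using c by (simp add: field_simps power2_eq_square)
    also have "\<dots> \<le> (B * B / c\<^sup>2) * (cmod (\<gamma> s' - \<gamma> t'))\<^sup>2"
      using c(1) B(1) c(2)[OF eq(4,5)] by (intro mult_left_mono power_mono) auto
    finally show ?thesis using eq by simp
  qed
  have 2: "cmod (\<gamma>' s - \<gamma>' t) \<le> (B / c) * cmod (\<gamma> s - \<gamma> t)" for s t
  proof -
    obtain s' t' where eq: "\<gamma> s' = \<gamma> s" "\<gamma> t' = \<gamma> t" "\<gamma>' s' = \<gamma>' s" "\<gamma>' t' = \<gamma>' t" "t' \<in> {0..1}" "\<bar>s' - t'\<bar> \<le> 1/2"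
      using representatives[of s t] .
    have "cmod (\<gamma>' s' - \<gamma>' t') \<le> B / c * (c * \<bar>s' - t'\<bar>)"
      using B(3)[of s' t'] c by simp
    also have "\<dots> \<le> (B / c) * cmod (\<gamma> s' - \<gamma> t')"
      using c(1) B(1) c(2)[OF eq(5,6)] by (intro mult_left_mono) auto
    finally show ?thesis using eq by simp
  qed
  define C where "C = max (B * B / c\<^sup>2) (B / c)"
  show ?thesis
  proof (rule that[of C])
    show "C > 0" using B c by (simp add: C_def less_max_iff_disj)
    fix s t
    have "(B * B / c\<^sup>2) * (cmod (\<gamma> s - \<gamma> t))\<^sup>2 \<le> C * (cmod (\<gamma> s - \<gamma> t))\<^sup>2"
      by (intro mult_right_mono) (auto simp: C_def)
    then show "\<bar>(\<gamma> s - \<gamma> t) \<bullet> (\<i> * \<gamma>' t)\<bar> \<le> C * (cmod (\<gamma> s - \<gamma> t))\<^sup>2" using 1[of s t] by linarith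
    have "(B / c) * cmod (\<gamma> s - \<gamma> t) \<le> C * cmod (\<gamma> s - \<gamma> t)"
      by (intro mult_right_mono) (auto simp: C_def)
    then show "cmod (\<gamma>' s - \<gamma>' t) \<le> C * cmod (\<gamma> s - \<gamma> t)" using 2[of s t] by linarith
  qed
qed

lemma image_UNIV: "\<gamma> ` {0..1} = range \<gamma>"
proof -
  have "\<gamma> t \<in> \<gamma> ` {0..1}" for t
    using periodic_frac[OF periodic(1), of t] frac_ge_0[of t] frac_lt_1[of t]
    by (intro image_eqI[of _ _ "frac t"]) auto
  then show ?thesis by auto
qed

lemma is_simple_path: "simple_path \<gamma>" "pathfinish \<gamma> = pathstart \<gamma>" "path \<gamma>"
proof -
  show 1: "path \<gamma>" by (simp add: path_def cont)
  show "pathfinish \<gamma> = pathstart \<gamma>"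
    using periodic(1)[rule_format, of 0] by (simp add: pathfinish_def pathstart_def)
  have "loop_free \<gamma>"
    unfolding loop_free_def
  proof (intro ballI impI)
    fix x y :: real assume xy: "x \<in> {0..1}" "y \<in> {0..1}" "\<gamma> x = \<gamma> y"
    then obtain n where n: "x - y = of_int n" using eq_imp_shift[of x y] by (auto elim: Ints_cases)
    show "x = y \<or> x = 0 \<and> y = 1 \<or> x = 1 \<and> y = 0"
    proof -
      have "- 1 \<le> real_of_int n" "real_of_int n \<le> 1" using xy n by auto
      then have "n = -1 \<or> n = 0 \<or> n = 1" by linarith
      then show ?thesis using n xy by auto
    qed
  qed
  then show "simple_path \<gamma>" using 1 by (simp add: simple_path_def)
qed

text \<open>At the nearest point the derivative of the squared distance vanishes, so
  \<open>p - \<gamma> t\<close> is orthogonal to the tangent. Its quotient by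
  \<open>\<gamma>' t\<close> is then purely imaginary, which yields the real factor.\<close>

lemma nearest_point_normal:
  assumes "p \<noteq> \<gamma> t" "\<And>s. dist p (\<gamma> t) \<le> dist p (\<gamma> s)"
  obtains \<rho> where "p = \<gamma> t + \<rho> *\<^sub>R (\<i> * \<gamma>' t)" "\<rho> \<noteq> 0" "\<bar>\<rho>\<bar> * cmod (\<gamma>' t) = dist p (\<gamma> t)"
proof -
  have "((\<lambda>s. (\<gamma> s - p) \<bullet> (\<gamma> s - p)) has_derivative (\<lambda>h. 2 * ((\<gamma> t - p) \<bullet> (h *\<^sub>R \<gamma>' t)))) (at t)"
    using derivs(1)[of t] unfolding has_vector_derivative_def
    by (auto intro!: derivative_eq_intros simp: inner_commute)
  then have "((\<lambda>s. (\<gamma> s - p) \<bullet> (\<gamma> s - p)) has_real_derivative 2 * ((\<gamma> t - p) \<bullet> \<gamma>' t)) (at t)"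
    unfolding has_field_derivative_def by (rule has_derivative_eq_rhs) auto
  then have "2 * ((\<gamma> t - p) \<bullet> \<gamma>' t) = 0"
  proof (rule DERIV_local_min[where d = 1])
    show "\<forall>y. \<bar>t - y\<bar> < 1 \<longrightarrow> (\<gamma> t - p) \<bullet> (\<gamma> t - p) \<le> (\<gamma> y - p) \<bullet> (\<gamma> y - p)"
    proof (intro allI impI)
      fix y
      have "norm (\<gamma> t - p) \<le> norm (\<gamma> y - p)"
        using assms(2)[of y] unfolding dist_norm by (metis norm_minus_commute)
      then show "(\<gamma> t - p) \<bullet> (\<gamma> t - p) \<le> (\<gamma> y - p) \<bullet> (\<gamma> y - p)"
        by (simp only: norm_le)
    qed
  qed simp
  then have orth: "Re (p - \<gamma> t) * Re (\<gamma>' t) + Im (p - \<gamma> t) * Im (\<gamma>' t) = 0"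
    by (simp add: inner_complex_def algebra_simps)
  define \<rho> where "\<rho> = Im ((p - \<gamma> t) / \<gamma>' t)"
  have "Re ((p - \<gamma> t) / \<gamma>' t) = 0"
    using orth by (simp add: Re_divide)
  then have "(p - \<gamma> t) / \<gamma>' t = \<i> * of_real \<rho>"
    by (simp add: \<rho>_def complex_eq_iff)
  then have eq: "p - \<gamma> t = \<rho> *\<^sub>R (\<i> * \<gamma>' t)"
    using nonzero[of t] by (simp add: field_simps scaleR_conv_of_real)
  show ?thesis
  proof (rule that[of \<rho>])
    show "p = \<gamma> t + \<rho> *\<^sub>R (\<i> * \<gamma>' t)" using eq by (simp add: algebra_simps)
    then show "\<rho> \<noteq> 0" using assms(1) by auto
    show "\<bar>\<rho>\<bar> * cmod (\<gamma>' t) = dist p (\<gamma> t)" by (simp add: dist_norm eq norm_mult)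
  qed
qed

end

subsection \<open>Tubular neighbourhoods of the boundary\<close>

text \<open>Expand the square: the cross term is at most \<open>2 * e * C * (cmod d)\<^sup>2\<close>
  and is absorbed by half of \<open>(cmod d)\<^sup>2\<close> because
  \<open>4 * C * e \<le> 1\<close>. This keeps points displaced along normals away from the
  curve.\<close>

lemma tangent_norm_lower_bound:
  fixes d n :: complex
  assumes "\<bar>d \<bullet> n\<bar> \<le> C * (cmod d)\<^sup>2" "0 \<le> e" "4 * C * e \<le> 1" "\<bar>u\<bar> = 1"
  shows "(cmod d)\<^sup>2 / 2 + (e * cmod n)\<^sup>2 \<le> (cmod (d + (u * e) *\<^sub>R n))\<^sup>2"
proof -
  have "(cmod (d + (u * e) *\<^sub>R n))\<^sup>2 = (cmod d)\<^sup>2 + 2 * ((u * e) * (d \<bullet> n)) + (u * e)\<^sup>2 * (cmod n)\<^sup>2"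
    unfolding power2_norm_eq_inner
    by (simp add: inner_add_left inner_add_right inner_commute power2_eq_square algebra_simps)
  moreover have "(u * e)\<^sup>2 * (cmod n)\<^sup>2 = e\<^sup>2 * (cmod n)\<^sup>2"
    using assms(4) power2_abs[of u] by (simp add: power_mult_distrib)
  moreover have "\<bar>(u * e) * (d \<bullet> n)\<bar> \<le> e * (C * (cmod d)\<^sup>2)"
    using assms(1,2,4) by (simp add: abs_mult mult_left_mono)
  moreover have "e * (C * (cmod d)\<^sup>2) \<le> (cmod d)\<^sup>2 / 4"
    using mult_right_mono[OF assms(3), of "(cmod d)\<^sup>2"] by (simp add: algebra_simps)
  moreover have "(e * cmod n)\<^sup>2 = e\<^sup>2 * (cmod n)\<^sup>2"
    by (simp add: power_mult_distrib)
  ultimately show ?thesis unfolding abs_le_iff by linarith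
qed

lemma connected_disjoint_frontier:
  assumes "connected S" "S \<inter> frontier T = {}" "S \<inter> T \<noteq> {}"
  shows "S \<subseteq> T"
  using connected_Int_frontier[of S T] assms by blast

section \<open>Uniform constants and collars of the boundary curves\<close>

locale smooth_domain =
  fixes \<Omega> :: "complex set" and K :: nat and \<Gamma> :: "nat \<Rightarrow> real \<Rightarrow> complex"
  assumes dom: "smooth_bounded_domain \<Omega> K \<Gamma>"
begin

abbreviation \<Gamma>' :: "nat \<Rightarrow> real \<Rightarrow> complex" where
  "\<Gamma>' k t \<equiv> vector_derivative (\<Gamma> k) (at t)"

lemma \<Omega>: "open \<Omega>" "connected \<Omega>" "\<Omega> \<noteq> {}" "bounded \<Omega>"
  and distinct_curves: "k < K \<Longrightarrow> l < K \<Longrightarrow> k \<noteq> l \<Longrightarrow> \<Gamma> k ` {0..1} \<inter> \<Gamma> l ` {0..1} = {}"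
  and frontier_image: "frontier \<Omega> = (\<Union>k<K. \<Gamma> k ` {0..1})"
  using dom unfolding smooth_bounded_domain_def by auto

lemma curve: "k < K \<Longrightarrow> smooth_curve (\<Gamma> k)"
  using dom unfolding smooth_bounded_domain_def smooth_curve_def by blast

lemma frontier_ranges: "frontier \<Omega> = (\<Union>k<K. range (\<Gamma> k))"
  unfolding frontier_image using smooth_curve.image_UNIV[OF curve] by auto

lemma \<Gamma>_in_frontier: "k < K \<Longrightarrow> \<Gamma> k t \<in> frontier \<Omega>"
  unfolding frontier_ranges by blast

lemma frontier_disjoint: "frontier \<Omega> \<inter> \<Omega> = {}"
  using \<Omega>(1) frontier_disjoint_eq by blast

lemma \<Gamma>_notin: "k < K \<Longrightarrow> \<Gamma> k t \<notin> \<Omega>"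
  using frontier_disjoint \<Gamma>_in_frontier by blast

lemma compact_range: "k < K \<Longrightarrow> compact (range (\<Gamma> k))"
  using compact_continuous_image[OF smooth_curve.cont(1)[OF curve, of k "{0..1}"]]
    smooth_curve.image_UNIV[OF curve, of k] by simp

lemma curves_apart:
  obtains \<delta> where "\<delta> > 0" "\<And>k l s t. k < K \<Longrightarrow> l < K \<Longrightarrow> k \<noteq> l \<Longrightarrow> \<delta> \<le> dist (\<Gamma> l s) (\<Gamma> k t)"
proof -
  have "\<exists>d>0. k \<noteq> l \<longrightarrow> (\<forall>s t. d \<le> dist (\<Gamma> l s) (\<Gamma> k t))" if "k < K" "l < K" for k l
  proof (cases "k = l")
    case False
    then have "range (\<Gamma> l) \<inter> range (\<Gamma> k) = {}"
      using distinct_curves[OF that False] smooth_curve.image_UNIV[OF curve] that by auto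
    from separate_compact_closed[OF compact_range compact_imp_closed[OF compact_range] this] that
    show ?thesis by blast
  qed (auto intro: exI[of _ 1])
  then obtain d where d: "\<And>k l. k < K \<Longrightarrow> l < K \<Longrightarrow> d k l > 0"
    "\<And>k l s t. k < K \<Longrightarrow> l < K \<Longrightarrow> k \<noteq> l \<Longrightarrow> d k l \<le> dist (\<Gamma> l s) (\<Gamma> k t)" by metis
  define \<delta> where "\<delta> = Min (insert 1 ((\<lambda>(k, l). d k l) ` ({..<K} \<times> {..<K})))"
  have "\<delta> > 0" unfolding \<delta>_def using d(1) by (subst Min_gr_iff) auto
  moreover have "\<delta> \<le> d k l" if "k < K" "l < K" for k l
    unfolding \<delta>_def using that by (intro Min_le) auto
  ultimately show ?thesis
    using that[of \<delta>] d(2) by (meson order_trans)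
qed

lemma curve_constants:
  obtains m B C where "m > 0" "B > 0" "C > 0"
    "\<And>k t. k < K \<Longrightarrow> m \<le> cmod (\<Gamma>' k t)" "\<And>k t. k < K \<Longrightarrow> cmod (\<Gamma>' k t) \<le> B"
    "\<And>k s t. k < K \<Longrightarrow> \<bar>(\<Gamma> k s - \<Gamma> k t) \<bullet> (\<i> * \<Gamma>' k t)\<bar> \<le> C * (cmod (\<Gamma> k s - \<Gamma> k t))\<^sup>2"
    "\<And>k s t. k < K \<Longrightarrow> cmod (\<Gamma>' k s - \<Gamma>' k t) \<le> C * cmod (\<Gamma> k s - \<Gamma> k t)"
proof -
  have "\<exists>m B C. m > 0 \<and> B > 0 \<and> C > 0 \<and> (\<forall>t. m \<le> cmod (\<Gamma>' k t)) \<and> (\<forall>t. cmod (\<Gamma>' k t) \<le> B) \<and>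
    (\<forall>s t. \<bar>(\<Gamma> k s - \<Gamma> k t) \<bullet> (\<i> * \<Gamma>' k t)\<bar> \<le> C * (cmod (\<Gamma> k s - \<Gamma> k t))\<^sup>2) \<and>
    (\<forall>s t. cmod (\<Gamma>' k s - \<Gamma>' k t) \<le> C * cmod (\<Gamma> k s - \<Gamma> k t))" if "k < K" for k
  proof -
    interpret smooth_curve "\<Gamma> k" using curve that .
    obtain m B where mB: "m > 0" "B > 0" "\<And>t. m \<le> cmod (\<Gamma>' k t)" "\<And>t. cmod (\<Gamma>' k t) \<le> B"
      "\<And>s t. cmod (\<Gamma>' k s - \<Gamma>' k t) \<le> B * \<bar>s - t\<bar>"
      "\<And>s t. cmod (\<Gamma> k s - \<Gamma> k t - (s - t) *\<^sub>R \<Gamma>' k t) \<le> B * (s - t)\<^sup>2"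
      by (rule derivative_bounds) (rule that)
    obtain C where C: "C > 0"
      "\<And>s t. \<bar>(\<Gamma> k s - \<Gamma> k t) \<bullet> (\<i> * \<Gamma>' k t)\<bar> \<le> C * (cmod (\<Gamma> k s - \<Gamma> k t))\<^sup>2"
      "\<And>s t. cmod (\<Gamma>' k s - \<Gamma>' k t) \<le> C * cmod (\<Gamma> k s - \<Gamma> k t)"
      by (rule tangent_disc) (rule that)
    show ?thesis
      by (rule exI[of _ m], rule exI[of _ B], rule exI[of _ C]) (use mB C in blast)
  qed
  then obtain m B C where *: "\<And>k. k < K \<Longrightarrow> m k > 0 \<and> B k > 0 \<and> C k > 0 \<and> (\<forall>t. m k \<le> cmod (\<Gamma>' k t)) \<and>
    (\<forall>t. cmod (\<Gamma>' k t) \<le> B k) \<and>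
    (\<forall>s t. \<bar>(\<Gamma> k s - \<Gamma> k t) \<bullet> (\<i> * \<Gamma>' k t)\<bar> \<le> C k * (cmod (\<Gamma> k s - \<Gamma> k t))\<^sup>2) \<and>
    (\<forall>s t. cmod (\<Gamma>' k s - \<Gamma>' k t) \<le> C k * cmod (\<Gamma> k s - \<Gamma> k t))" by metis
  define m0 where "m0 = Min (insert 1 (m ` {..<K}))"
  define B0 where "B0 = Max (insert 1 (B ` {..<K}))"
  define C0 where "C0 = Max (insert 1 (C ` {..<K}))"
  have m0: "m0 \<le> m k" and B0: "B k \<le> B0" and C0: "C k \<le> C0" if "k < K" for k
    unfolding m0_def B0_def C0_def using that by auto
  show ?thesis
  proof (rule that[of m0 B0 C0])
    show "m0 > 0" unfolding m0_def using * by (subst Min_gr_iff) auto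
    show "B0 > 0" unfolding B0_def by (subst Max_gr_iff) auto
    show "C0 > 0" unfolding C0_def by (subst Max_gr_iff) auto
    fix k assume k: "k < K"
    show "m0 \<le> cmod (\<Gamma>' k t)" for t
      using order_trans[OF m0[OF k]] *[OF k] by simp
    show "cmod (\<Gamma>' k t) \<le> B0" for t
      using order_trans[OF _ B0[OF k]] *[OF k] by simp
    fix s t
    have "C k * (cmod (\<Gamma> k s - \<Gamma> k t))\<^sup>2 \<le> C0 * (cmod (\<Gamma> k s - \<Gamma> k t))\<^sup>2"
      using C0[OF k] by (intro mult_right_mono) auto
    moreover have "\<bar>(\<Gamma> k s - \<Gamma> k t) \<bullet> (\<i> * \<Gamma>' k t)\<bar> \<le> C k * (cmod (\<Gamma> k s - \<Gamma> k t))\<^sup>2"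
      using *[OF k] by simp
    ultimately show "\<bar>(\<Gamma> k s - \<Gamma> k t) \<bullet> (\<i> * \<Gamma>' k t)\<bar> \<le> C0 * (cmod (\<Gamma> k s - \<Gamma> k t))\<^sup>2"
      by linarith
    have "C k * cmod (\<Gamma> k s - \<Gamma> k t) \<le> C0 * cmod (\<Gamma> k s - \<Gamma> k t)"
      using C0[OF k] by (intro mult_right_mono) auto
    moreover have "cmod (\<Gamma>' k s - \<Gamma>' k t) \<le> C k * cmod (\<Gamma> k s - \<Gamma> k t)"
      using *[OF k] by simp
    ultimately show "cmod (\<Gamma>' k s - \<Gamma>' k t) \<le> C0 * cmod (\<Gamma> k s - \<Gamma> k t)"
      by linarith
  qed
qed

text \<open>A one-sided collar: \<open>u\<close> is 1 or -1 and chooses the side. The normal is not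
  normalised, so \<rho> counts multiples of the speed.\<close>

definition tube :: "real \<Rightarrow> nat \<Rightarrow> real \<Rightarrow> complex set" where
  "tube r k u = (\<lambda>(t, \<rho>). \<Gamma> k t + \<rho> *\<^sub>R (u *\<^sub>R (\<i> * \<Gamma>' k t))) ` (UNIV \<times> {0<..r})"

lemma tubeI: "0 < \<rho> \<Longrightarrow> \<rho> \<le> r \<Longrightarrow> \<Gamma> k t + \<rho> *\<^sub>R (u *\<^sub>R (\<i> * \<Gamma>' k t)) \<in> tube r k u"
  unfolding tube_def by force

lemma connected_tube:
  assumes "k < K"
  shows "connected (tube r k u)"
proof -
  interpret smooth_curve "\<Gamma> k" using curve assms .
  have "connected ((UNIV :: real set) \<times> {0<..r})"
    by (intro convex_connected convex_Times) auto
  moreover have "continuous_on (UNIV \<times> {0<..r}) (\<lambda>(t, \<rho>). \<Gamma> k t + \<rho> *\<^sub>R (u *\<^sub>R (\<i> * \<Gamma>' k t)))"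
    unfolding case_prod_beta'
    by (intro continuous_intros continuous_on_compose2[OF cont(1)[of UNIV]]
        continuous_on_compose2[OF cont(2)[of UNIV]]) auto
  ultimately show ?thesis unfolding tube_def by (rule connected_continuous_image[rotated])
qed

text \<open>For two points of the same curve these are the tangent disc bounds. For different
  curves, the distance \<delta> between them turns the trivial bounds by \<open>B\<close> into
  bounds of the required form. Signs have to agree only on the same curve, so each curve may later
  choose its own inner side.\<close>

lemma normal_distance:
  obtains r m C where "r > 0" "m > 0"
    "\<And>k l s t e u. k < K \<Longrightarrow> l < K \<Longrightarrow> 0 \<le> e \<Longrightarrow> e \<le> r \<Longrightarrow> \<bar>u\<bar> = 1 \<Longrightarrow>
      (cmod (\<Gamma> l s - \<Gamma> k t))\<^sup>2 / 2 + (e * cmod (\<Gamma>' k t))\<^sup>2 \<le> (cmod (\<Gamma> l s - \<Gamma> k t + (u * e) *\<^sub>R (\<i> * \<Gamma>' k t)))\<^sup>2"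
    "\<And>k t. k < K \<Longrightarrow> m \<le> cmod (\<Gamma>' k t)"
    "\<And>k l s t u v. k < K \<Longrightarrow> l < K \<Longrightarrow> \<bar>u\<bar> = 1 \<Longrightarrow> \<bar>v\<bar> = 1 \<Longrightarrow> (k = l \<Longrightarrow> u = v) \<Longrightarrow>
      cmod (u *\<^sub>R (\<i> * \<Gamma>' l s) - v *\<^sub>R (\<i> * \<Gamma>' k t)) \<le> C * cmod (\<Gamma> l s - \<Gamma> k t)"
proof -
  obtain m B C where c: "m > 0" "B > 0" "C > 0"
    "\<And>k t. k < K \<Longrightarrow> m \<le> cmod (\<Gamma>' k t)" "\<And>k t. k < K \<Longrightarrow> cmod (\<Gamma>' k t) \<le> B"
    "\<And>k s t. k < K \<Longrightarrow> \<bar>(\<Gamma> k s - \<Gamma> k t) \<bullet> (\<i> * \<Gamma>' k t)\<bar> \<le> C * (cmod (\<Gamma> k s - \<Gamma> k t))\<^sup>2"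
    "\<And>k s t. k < K \<Longrightarrow> cmod (\<Gamma>' k s - \<Gamma>' k t) \<le> C * cmod (\<Gamma> k s - \<Gamma> k t)"
    by (rule curve_constants) (rule that)
  obtain \<delta> where \<delta>: "\<delta> > 0" "\<And>k l s t. k < K \<Longrightarrow> l < K \<Longrightarrow> k \<noteq> l \<Longrightarrow> \<delta> \<le> dist (\<Gamma> l s) (\<Gamma> k t)"
    by (rule curves_apart) (rule that)
  \<comment> \<open>The second entry makes \<open>2 * B\<close> at most
    \<open>C' * \<delta>\<close>; the factor 2 covers the difference of two normals.\<close>
  define C' where "C' = max C (2 * B / \<delta>)"
  have C': "C' > 0" using c by (simp add: C'_def less_max_iff_disj)
  have far: "2 * B \<le> C' * cmod (\<Gamma> l s - \<Gamma> k t)" if "k < K" "l < K" "k \<noteq> l" for k l s t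
  proof -
    have "2 * B = (2 * B / \<delta>) * \<delta>" using \<delta> by simp
    also have "\<dots> \<le> C' * cmod (\<Gamma> l s - \<Gamma> k t)"
      using \<delta> c(2) that C' by (intro mult_mono) (auto simp: C'_def dist_norm)
    finally show ?thesis .
  qed
  have inner: "\<bar>(\<Gamma> l s - \<Gamma> k t) \<bullet> (\<i> * \<Gamma>' k t)\<bar> \<le> C' * (cmod (\<Gamma> l s - \<Gamma> k t))\<^sup>2"
    if "k < K" "l < K" for k l s t
  proof (cases "k = l")
    case True
    have "C * (cmod (\<Gamma> k s - \<Gamma> k t))\<^sup>2 \<le> C' * (cmod (\<Gamma> k s - \<Gamma> k t))\<^sup>2"
      by (intro mult_right_mono) (auto simp: C'_def)
    then show ?thesis using c(6)[OF that(1), of s t] True by auto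
  next
    case False
    have "\<bar>(\<Gamma> l s - \<Gamma> k t) \<bullet> (\<i> * \<Gamma>' k t)\<bar> \<le> cmod (\<Gamma> l s - \<Gamma> k t) * cmod (\<i> * \<Gamma>' k t)"
      by (rule Cauchy_Schwarz_ineq2)
    also have "\<dots> \<le> cmod (\<Gamma> l s - \<Gamma> k t) * (2 * B)"
      using c(5)[OF that(1), of t] c(2) by (intro mult_left_mono) (auto simp: norm_mult)
    also have "\<dots> \<le> cmod (\<Gamma> l s - \<Gamma> k t) * (C' * cmod (\<Gamma> l s - \<Gamma> k t))"
      using far[OF that False] by (intro mult_left_mono) auto
    finally show ?thesis by (simp add: power2_eq_square mult_ac)
  qed
  show ?thesis
  proof (rule that[of "1 / (4 * C')" m C'])
    fix k l s t and e u :: real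
    assume kl: "k < K" "l < K" and e: "0 \<le> e" "e \<le> 1 / (4 * C')" and u: "\<bar>u\<bar> = 1"
    have "4 * C' * e \<le> 1" using e C' by (simp add: field_simps)
    then show "(cmod (\<Gamma> l s - \<Gamma> k t))\<^sup>2 / 2 + (e * cmod (\<Gamma>' k t))\<^sup>2
        \<le> (cmod (\<Gamma> l s - \<Gamma> k t + (u * e) *\<^sub>R (\<i> * \<Gamma>' k t)))\<^sup>2"
      using tangent_norm_lower_bound[OF inner[OF kl, of s t] e(1) _ u] by (simp add: norm_mult)
  next
    fix k l s t and u v :: real
    assume kl: "k < K" "l < K" and uv: "\<bar>u\<bar> = 1" "\<bar>v\<bar> = 1" "k = l \<Longrightarrow> u = v"
    show "cmod (u *\<^sub>R (\<i> * \<Gamma>' l s) - v *\<^sub>R (\<i> * \<Gamma>' k t)) \<le> C' * cmod (\<Gamma> l s - \<Gamma> k t)"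
    proof (cases "k = l")
      case True
      have "u *\<^sub>R (\<i> * \<Gamma>' l s) - v *\<^sub>R (\<i> * \<Gamma>' k t) = u *\<^sub>R (\<i> * (\<Gamma>' k s - \<Gamma>' k t))"
        using True uv(3) by (simp add: algebra_simps)
      then have "cmod (u *\<^sub>R (\<i> * \<Gamma>' l s) - v *\<^sub>R (\<i> * \<Gamma>' k t)) = cmod (\<Gamma>' k s - \<Gamma>' k t)"
        using uv(1) by (simp only: norm_scaleR norm_mult) simp
      also have "\<dots> \<le> C * cmod (\<Gamma> k s - \<Gamma> k t)" using c(7) kl by blast
      also have "\<dots> \<le> C' * cmod (\<Gamma> k s - \<Gamma> k t)" by (intro mult_right_mono) (auto simp: C'_def)
      finally show ?thesis using True by simp
    next
      case False
      have "cmod (u *\<^sub>R (\<i> * \<Gamma>' l s) - v *\<^sub>R (\<i> * \<Gamma>' k t)) \<le> cmod (u *\<^sub>R (\<i> * \<Gamma>' l s)) + cmod (v *\<^sub>R (\<i> * \<Gamma>' k t))"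
        by (rule norm_triangle_ineq4)
      also have "\<dots> \<le> 2 * B" using c(5)[OF kl(1), of t] c(5)[OF kl(2), of s] uv by (simp add: norm_mult)
      finally show ?thesis using far[OF kl False, of s t] by simp
    qed
  qed (use c(1,4) C' in simp_all)
qed

text \<open>The nearest point of the curve is the foot of a normal through \<open>p\<close>.
  Comparison with \<open>\<Gamma> k t0\<close> bounds the distance, and the lower speed bound
  \<open>m\<close> converts it into a bound for the multiple of the normal.\<close>

lemma tube_covers:
  assumes k: "k < K" and m: "m > 0" "\<And>t. m \<le> cmod (\<Gamma>' k t)"
    and p: "p \<notin> range (\<Gamma> k)" "dist p (\<Gamma> k t0) < r * m"
  shows "p \<in> tube r k 1 \<union> tube r k (-1)"
proof -
  interpret smooth_curve "\<Gamma> k" using curve k .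
  have ne: "range (\<Gamma> k) \<noteq> {}" by simp
  obtain q where q: "q \<in> range (\<Gamma> k)" "\<And>y. y \<in> range (\<Gamma> k) \<Longrightarrow> dist p q \<le> dist p y"
    by (rule distance_attains_inf[OF compact_imp_closed[OF compact_range[OF k]] ne]) (rule that)
  then obtain t where "q = \<Gamma> k t" by auto
  with q(2) have t: "\<And>s. dist p (\<Gamma> k t) \<le> dist p (\<Gamma> k s)" by simp
  have "p \<noteq> \<Gamma> k t" using p by blast
  from nearest_point_normal[OF this t] obtain \<rho> where
    \<rho>: "p = \<Gamma> k t + \<rho> *\<^sub>R (\<i> * \<Gamma>' k t)" "\<rho> \<noteq> 0" "\<bar>\<rho>\<bar> * cmod (\<Gamma>' k t) = dist p (\<Gamma> k t)" .
  have "\<bar>\<rho>\<bar> * m \<le> \<bar>\<rho>\<bar> * cmod (\<Gamma>' k t)" using m by (intro mult_left_mono) auto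
  then have "\<bar>\<rho>\<bar> * m < r * m" using \<rho>(3) t[of t0] p(2) by linarith
  then have "\<bar>\<rho>\<bar> \<le> r" using m(1) by simp
  then show ?thesis
    using \<rho>(1,2) tubeI[of \<rho> r k t 1] tubeI[of "-\<rho>" r k t "-1"] by (cases "\<rho> > 0") auto
qed

text \<open>If a point displaced along a normal lay on the boundary, the chord to it with the
  displacement undone would be zero, but the lower bound for its length contains the positive term
  \<open>(e * cmod (\<Gamma>' k t))\<^sup>2\<close>.\<close>

lemma tube_disjoint:
  assumes "k < K" "\<bar>u\<bar> = 1"
    "\<And>l s t e u. l < K \<Longrightarrow> 0 \<le> e \<Longrightarrow> e \<le> r \<Longrightarrow> \<bar>u\<bar> = 1 \<Longrightarrow>
      (cmod (\<Gamma> l s - \<Gamma> k t))\<^sup>2 / 2 + (e * cmod (\<Gamma>' k t))\<^sup>2 \<le> (cmod (\<Gamma> l s - \<Gamma> k t + (u * e) *\<^sub>R (\<i> * \<Gamma>' k t)))\<^sup>2"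
  shows "tube r k u \<inter> frontier \<Omega> = {}"
proof -
  have *: False if "l < K" "0 < e" "e \<le> r" "\<Gamma> l s = \<Gamma> k t + e *\<^sub>R (u *\<^sub>R (\<i> * \<Gamma>' k t))" for l s t e
  proof -
    have "\<Gamma> l s - \<Gamma> k t + (-u * e) *\<^sub>R (\<i> * \<Gamma>' k t) = 0" using that by (simp add: mult.commute)
    then have "(cmod (\<Gamma> l s - \<Gamma> k t))\<^sup>2 / 2 + (e * cmod (\<Gamma>' k t))\<^sup>2 \<le> 0"
      using assms(3)[of l e "-u" s t] that assms(2) by (simp only: norm_zero) simp
    moreover have "(e * cmod (\<Gamma>' k t))\<^sup>2 > 0"
      using that smooth_curve.nonzero[OF curve[OF assms(1)]] by simp
    ultimately show False using zero_le_power2[of "cmod (\<Gamma> l s - \<Gamma> k t)"] by linarith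
  qed
  show ?thesis
  proof (rule equals0I)
    fix p assume p: "p \<in> tube r k u \<inter> frontier \<Omega>"
    then obtain t e where "0 < e" "e \<le> r" "p = \<Gamma> k t + e *\<^sub>R (u *\<^sub>R (\<i> * \<Gamma>' k t))"
      unfolding tube_def by auto
    moreover obtain l s where "l < K" "p = \<Gamma> l s" using p unfolding frontier_ranges by auto
    ultimately show False using *[of l e s t] by metis
  qed
qed

text \<open>This determines the side of \<Omega> and the sign \<omega> that orients the curve. Each
  collar is connected and misses the boundary, so it lies in \<Omega> or misses it; the inside and
  the outside of the Jordan curve occupy one collar each. The winding numbers of the two collars
  differ by one in absolute value, and \<omega> is the sign that makes the drop on leaving \<Omega>
  equal to 1.\<close>

lemma tube_sides:
  assumes k: "k < K" and r: "r > 0" and m: "m > 0" "\<And>t. m \<le> cmod (\<Gamma>' k t)"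
    and disj: "\<And>u. \<bar>u\<bar> = 1 \<Longrightarrow> tube r k u \<inter> frontier \<Omega> = {}"
  shows "\<exists>u \<omega> \<alpha> \<beta>. \<bar>u\<bar> = 1 \<and> tube r k u \<subseteq> \<Omega> \<and> tube r k (-u) \<inter> \<Omega> = {} \<and>
    (\<forall>p\<in>tube r k u. winding_number (\<Gamma> k) p = \<alpha>) \<and> (\<forall>p\<in>tube r k (-u). winding_number (\<Gamma> k) p = \<beta>) \<and>
    \<omega> * (\<alpha> - \<beta>) = 1 \<and> (\<omega> = 1 \<or> \<omega> = -1)"
proof -
  interpret smooth_curve "\<Gamma> k" using curve k .
  have img: "path_image (\<Gamma> k) = range (\<Gamma> k)" using image_UNIV by (simp add: path_image_def)
  note J = Jordan_inside_outside[OF is_simple_path(1,2)]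
  \<comment> \<open>The two collars cover a neighbourhood of \<open>\<Gamma> k 0\<close> up to the
    curve itself, so a set off the curve that accumulates there meets one of them.\<close>
  have near: "\<exists>u. \<bar>u\<bar> = 1 \<and> S \<inter> tube r k u \<noteq> {}"
    if S: "\<Gamma> k 0 \<in> closure S" "S \<inter> range (\<Gamma> k) = {}" for S
  proof -
    obtain p where p: "p \<in> S" "dist p (\<Gamma> k 0) < r * m"
      using S(1)[unfolded closure_approachable, rule_format, OF mult_pos_pos[OF r m(1)]] by auto
    then have "p \<in> tube r k 1 \<union> tube r k (-1)"
      using S(2) by (intro tube_covers[OF k m]) auto
    then have "S \<inter> tube r k 1 \<noteq> {} \<or> S \<inter> tube r k (-1) \<noteq> {}" using p(1) by blast
    then show ?thesis by (elim disjE) (auto intro: exI[of _ 1] exI[of _ "-1"])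
  qed
  have disjk: "tube r k u \<inter> range (\<Gamma> k) = {}" if "\<bar>u\<bar> = 1" for u
    using disj[OF that] k unfolding frontier_ranges by blast
  have "\<Gamma> k 0 \<in> closure \<Omega>" using \<Gamma>_in_frontier[OF k] by (simp add: frontier_def)
  moreover have "\<Omega> \<inter> range (\<Gamma> k) = {}" using \<Gamma>_notin[OF k] by auto
  ultimately obtain u where u: "\<bar>u\<bar> = 1" "\<Omega> \<inter> tube r k u \<noteq> {}" using near by blast
  have sub: "tube r k u \<subseteq> \<Omega>"
    using connected_disjoint_frontier[OF connected_tube[OF k] disj[OF u(1)]] u(2) by blast
  have fr: "frontier (inside (path_image (\<Gamma> k))) = range (\<Gamma> k)"
    "frontier (outside (path_image (\<Gamma> k))) = range (\<Gamma> k)" using J img by auto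
  have cl: "\<Gamma> k 0 \<in> closure (inside (path_image (\<Gamma> k)))" "\<Gamma> k 0 \<in> closure (outside (path_image (\<Gamma> k)))"
    using fr unfolding frontier_def by blast+
  have dj: "inside (path_image (\<Gamma> k)) \<inter> range (\<Gamma> k) = {}" "outside (path_image (\<Gamma> k)) \<inter> range (\<Gamma> k) = {}"
    using J img by auto
  obtain a where a: "\<bar>a\<bar> = 1" "inside (path_image (\<Gamma> k)) \<inter> tube r k a \<noteq> {}"
    using near[OF cl(1) dj(1)] by blast
  obtain b where b: "\<bar>b\<bar> = 1" "outside (path_image (\<Gamma> k)) \<inter> tube r k b \<noteq> {}"
    using near[OF cl(2) dj(2)] by blast
  have ain: "tube r k a \<subseteq> inside (path_image (\<Gamma> k))"
    using disjk[OF a(1)] a(2) fr(1)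
    by (intro connected_disjoint_frontier[OF connected_tube[OF k]]) (simp_all add: Int_commute)
  have bout: "tube r k b \<subseteq> outside (path_image (\<Gamma> k))"
    using disjk[OF b(1)] b(2) fr(2)
    by (intro connected_disjoint_frontier[OF connected_tube[OF k]]) (simp_all add: Int_commute)
  have io: "inside (path_image (\<Gamma> k)) \<inter> outside (path_image (\<Gamma> k)) = {}" using J by blast
  have ne: "tube r k u \<noteq> {}" for u using tubeI[OF r order.refl, of k _ u] by blast
  have "a \<noteq> b" using ain bout io ne[of a] by blast
  then have ab: "b = - a" using a(1) b(1) by linarith
  \<comment> \<open>If \<Omega> contained both collars, it would have points inside and outside the
    Jordan curve; being connected, it would meet the curve, which lies in its own frontier.\<close>
  have other: "tube r k (-u) \<inter> \<Omega> = {}"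
  proof (rule ccontr)
    assume "\<not> ?thesis"
    then have "tube r k (-u) \<subseteq> \<Omega>"
      using connected_disjoint_frontier[OF connected_tube[OF k] disj[of "-u"]] u(1) by auto
    moreover have "u = a \<or> u = b" using u(1) a(1) ab by linarith
    ultimately have "tube r k a \<subseteq> \<Omega>" "tube r k b \<subseteq> \<Omega>" using sub ab by auto
    then have "\<Omega> \<inter> inside (path_image (\<Gamma> k)) \<noteq> {}" "\<Omega> - inside (path_image (\<Gamma> k)) \<noteq> {}"
      using ain bout ne[of a] ne[of b] io by blast+
    from connected_Int_frontier[OF \<Omega>(2) this] have "\<Omega> \<inter> range (\<Gamma> k) \<noteq> {}"
      by (simp only: fr(1) not_False_eq_True)
    then show False using \<Gamma>_notin[OF k] by auto
  qed
  obtain \<nu> where \<nu>: "\<nu> = 1 \<or> \<nu> = (-1::complex)" "\<And>z. z \<in> inside (path_image (\<Gamma> k)) \<Longrightarrow> winding_number (\<Gamma> k) z = \<nu>"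
    by (rule simple_closed_path_winding_number_inside[OF is_simple_path(1)]) (auto intro: that)
  have wa: "\<forall>p\<in>tube r k a. winding_number (\<Gamma> k) p = \<nu>" using \<nu>(2) ain by blast
  have wb: "\<forall>p\<in>tube r k b. winding_number (\<Gamma> k) p = 0"
    using winding_number_zero_in_outside[OF is_simple_path(3,2)] bout by blast
  have \<nu>2: "\<nu> * (\<nu> - 0) = 1" "(-\<nu>) * (0 - \<nu>) = 1" using \<nu>(1) by auto
  have "\<exists>\<omega> \<alpha> \<beta>. (\<forall>p\<in>tube r k u. winding_number (\<Gamma> k) p = \<alpha>) \<and>
      (\<forall>p\<in>tube r k (-u). winding_number (\<Gamma> k) p = \<beta>) \<and> \<omega> * (\<alpha> - \<beta>) = 1 \<and> (\<omega> = 1 \<or> \<omega> = -1)"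
  \<comment> \<open>If \<open>u = a\<close>, then \<Omega> lies on the inner side near the curve and
    \<omega> is the winding number \<nu> about inner points; otherwise it is the negative of
    \<nu>.\<close>
  proof (cases "u = a")
    case True
    then have "- u = b" using ab by simp
    then show ?thesis using True wa wb \<nu>(1) \<nu>2(1) by (intro exI[of _ \<nu>] exI[of _ 0] conjI) auto
  next
    case False
    then have "u = b" "- u = a" using ab u(1) a(1) by (simp_all add: abs_if split: if_splits)
    then show ?thesis using wa wb \<nu>(1) \<nu>2(2)
      by (intro exI[of _ "-\<nu>"] exI[of _ \<nu>] exI[of _ 0] conjI) auto
  qed
  then show ?thesis using u(1) sub other by blast
qed

end

subsection \<open>The Cauchy formula for bounded functions with normal limits\<close>

text \<open>The global Cauchy theorem concerns one closed path. Each loop is reached from the base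
  point along an auxiliary path and left along its reverse, and the two contributions cancel for
  every integrand holomorphic on \<open>S\<close>.\<close>

lemma loops_joined_at_base_point:
  fixes n :: nat
  assumes S: "open S" "connected S" "x0 \<in> S"
    and p: "\<And>k. k < n \<Longrightarrow> valid_path (p k)" "\<And>k. k < n \<Longrightarrow> pathfinish (p k) = pathstart (p k)"
      "\<And>k. k < n \<Longrightarrow> path_image (p k) \<subseteq> S"
  shows "\<exists>L. valid_path L \<and> pathstart L = x0 \<and> pathfinish L = x0 \<and> path_image L \<subseteq> S \<and>
    (\<forall>G. G holomorphic_on S \<longrightarrow> contour_integral L G = (\<Sum>k<n. contour_integral (p k) G))"
  using p
proof (induction n)
  case 0
  show ?case
  proof (intro exI[of _ "linepath x0 x0"] conjI allI impI)
    show "contour_integral (linepath x0 x0) G = (\<Sum>k<0. contour_integral (p k) G)" for G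
      using contour_integral_trivial[of x0 G] by simp
    show "path_image (linepath x0 x0) \<subseteq> S" using S(3) by (simp add: path_image_linepath)
  qed (rule valid_path_linepath pathstart_linepath pathfinish_linepath)+
next
  case (Suc n)
  then obtain L where L: "valid_path L" "pathstart L = x0" "pathfinish L = x0" "path_image L \<subseteq> S"
    "\<And>G. G holomorphic_on S \<Longrightarrow> contour_integral L G = (\<Sum>k<n. contour_integral (p k) G)"
    by auto
  have pn: "valid_path (p n)" "pathfinish (p n) = pathstart (p n)" "path_image (p n) \<subseteq> S"
    using Suc.prems by auto
  have "pathstart (p n) \<in> S" using pn(3) pathstart_in_path_image by blast
  then obtain e where e: "polynomial_function e" "path_image e \<subseteq> S" "pathstart e = x0" "pathfinish e = pathstart (p n)"
    using connected_open_polynomial_connected[OF S] by blast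
  have ve: "valid_path e" using e(1) by (rule valid_path_polynomial_function)
  have rv: "valid_path (reversepath e)" "path_image (reversepath e) \<subseteq> S"
    using ve e(2) by (simp_all add: path_image_reversepath)
  have ci: "G contour_integrable_on g" if "G holomorphic_on S" "valid_path g" "path_image g \<subseteq> S" for G g
    using contour_integrable_holomorphic_simple[OF that(1) S(1) that(2,3)] .
  define R where "R = p n +++ reversepath e"
  have R: "valid_path R" "path_image R \<subseteq> S" "pathstart R = pathfinish e" "pathfinish R = x0"
    unfolding R_def using pn ve e by (auto simp: path_image_join path_image_reversepath intro!: valid_path_join)
  have eR: "valid_path (e +++ R)" "path_image (e +++ R) \<subseteq> S"
    using R e ve by (auto simp: path_image_join intro!: valid_path_join)
  show ?case
  proof (intro exI[of _ "L +++ (e +++ R)"] conjI allI impI)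
    show "valid_path (L +++ (e +++ R))" using L eR e ve R by (intro valid_path_join) auto
    show "path_image (L +++ (e +++ R)) \<subseteq> S" by (rule subset_path_image_join[OF L(4) eR(2)])
    show "pathstart (L +++ (e +++ R)) = x0" "pathfinish (L +++ (e +++ R)) = x0" using L R by auto
    fix G assume G: "G holomorphic_on S"
    have "contour_integral (L +++ (e +++ R)) G = contour_integral L G + contour_integral (e +++ R) G"
      using ci[OF G L(1,4)] ci[OF G eR] L(1) eR(1) by (rule contour_integral_join)
    also have "contour_integral (e +++ R) G = contour_integral e G + contour_integral R G"
      using ci[OF G ve e(2)] ci[OF G R(1,2)] ve R(1) by (rule contour_integral_join)
    also have "contour_integral R G = contour_integral (p n) G + contour_integral (reversepath e) G"
      unfolding R_def using ci[OF G pn(1,3)] ci[OF G rv] pn(1) rv(1) by (rule contour_integral_join)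
    also have "contour_integral (reversepath e) G = - contour_integral e G"
      by (rule contour_integral_reversepath[OF ve])
    finally show "contour_integral (L +++ (e +++ R)) G = (\<Sum>k<Suc n. contour_integral (p k) G)"
      using L(5)[OF G] by simp
  qed
qed

text \<open>Loops with sign -1 are reversed and all loops are joined into a single path. For
  \<open>w\<close> outside \<open>S\<close> the Cauchy kernel is holomorphic on \<open>S\<close>, so
  the winding number of the joined path is the signed sum of the given ones.\<close>

lemma Cauchy_theorem_cycle:
  fixes n :: nat
  assumes S: "open S" "connected S" "S \<noteq> {}" and F: "F holomorphic_on S"
    and p: "\<And>k. k < n \<Longrightarrow> valid_path (p k)" "\<And>k. k < n \<Longrightarrow> pathfinish (p k) = pathstart (p k)"
      "\<And>k. k < n \<Longrightarrow> path_image (p k) \<subseteq> S"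
    and \<omega>: "\<And>k. k < n \<Longrightarrow> \<omega> k = 1 \<or> \<omega> k = (-1 :: complex)"
    and wn: "\<And>w. w \<notin> S \<Longrightarrow> (\<Sum>k<n. \<omega> k * winding_number (p k) w) = 0"
  shows "(\<Sum>k<n. \<omega> k * contour_integral (p k) F) = 0"
proof -
  define q where "q k = (if \<omega> k = 1 then p k else reversepath (p k))" for k
  have q: "valid_path (q k)" "pathfinish (q k) = pathstart (q k)" "path_image (q k) \<subseteq> S"
    "\<And>G. contour_integral (q k) G = \<omega> k * contour_integral (p k) G" if "k < n" for k
    using p[OF that] \<omega>[OF that] contour_integral_reversepath by (auto simp: q_def)
  obtain x0 where "x0 \<in> S" using S(3) by blast
  then obtain L where L: "valid_path L" "pathstart L = x0" "pathfinish L = x0" "path_image L \<subseteq> S"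
    "\<And>G. G holomorphic_on S \<Longrightarrow> contour_integral L G = (\<Sum>k<n. contour_integral (q k) G)"
    using loops_joined_at_base_point[OF S(1,2), of x0 n q] q by blast
  have "winding_number L w = 0" if w: "w \<notin> S" for w
  proof -
    have hol: "(\<lambda>z. 1 / (z - w)) holomorphic_on S" using w by (intro holomorphic_intros) auto
    have "winding_number L w = 1 / (2 * pi * \<i>) * (\<Sum>k<n. \<omega> k * contour_integral (p k) (\<lambda>z. 1 / (z - w)))"
      using winding_number_valid_path[OF L(1), of w] L(4,5) hol w q(4) by auto
    also have "\<dots> = (\<Sum>k<n. \<omega> k * winding_number (p k) w)"
      unfolding sum_distrib_left
    proof (rule sum.cong)
      fix k assume "k \<in> {..<n}"
      then have "valid_path (p k)" "w \<notin> path_image (p k)" using p w by auto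
      from winding_number_valid_path[OF this]
      show "1 / (2 * pi * \<i>) * (\<omega> k * contour_integral (p k) (\<lambda>z. 1 / (z - w))) = \<omega> k * winding_number (p k) w"
        by simp
    qed simp
    finally show ?thesis using wn[OF w] by simp
  qed
  then have "contour_integral L F = 0"
    using Cauchy_theorem_global[OF S(1) F L(1)] L(2-4) contour_integral_unique by metis
  then show ?thesis using L(5)[OF F] q(4) by simp
qed

text \<open>The sign \<open>sg k\<close> selects the side of the \<open>k\<close>-th curve on which \<open>\<Omega>\<close> lies; \<open>\<alpha> k\<close> and \<open>\<beta> k\<close> are the winding
  numbers of that curve about points close to it inside and outside \<open>\<Omega>\<close>. The orientation \<open>\<omega> k\<close> is chosen so
  that the total winding number drops by one on leaving \<open>\<Omega>\<close> across any of the curves.\<close>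

locale tubular = smooth_domain +
  fixes sg :: "nat \<Rightarrow> real" and \<omega> \<alpha> \<beta> :: "nat \<Rightarrow> complex" and r m C :: real
  assumes r: "r > 0" and m: "m > 0"
    and sg: "k < K \<Longrightarrow> \<bar>sg k\<bar> = 1"
    and normal_distance: "k < K \<Longrightarrow> l < K \<Longrightarrow> 0 \<le> e \<Longrightarrow> e \<le> r \<Longrightarrow> \<bar>u\<bar> = 1 \<Longrightarrow>
      (cmod (\<Gamma> l s - \<Gamma> k t))\<^sup>2 / 2 + (e * cmod (\<Gamma>' k t))\<^sup>2 \<le> (cmod (\<Gamma> l s - \<Gamma> k t + (u * e) *\<^sub>R (\<i> * \<Gamma>' k t)))\<^sup>2"
    and speed: "k < K \<Longrightarrow> m \<le> cmod (\<Gamma>' k t)"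
    and normal_lipschitz: "k < K \<Longrightarrow> l < K \<Longrightarrow>
      cmod (sg l *\<^sub>R (\<i> * \<Gamma>' l s) - sg k *\<^sub>R (\<i> * \<Gamma>' k t)) \<le> C * cmod (\<Gamma> l s - \<Gamma> k t)"
    and inner_tube: "k < K \<Longrightarrow> tube r k (sg k) \<subseteq> \<Omega>"
    and outer_tube: "k < K \<Longrightarrow> tube r k (- sg k) \<inter> \<Omega> = {}"
    and inner_winding: "k < K \<Longrightarrow> p \<in> tube r k (sg k) \<Longrightarrow> winding_number (\<Gamma> k) p = \<alpha> k"
    and outer_winding: "k < K \<Longrightarrow> p \<in> tube r k (- sg k) \<Longrightarrow> winding_number (\<Gamma> k) p = \<beta> k"
    and winding_jump: "k < K \<Longrightarrow> \<omega> k * (\<alpha> k - \<beta> k) = 1"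
    and orientation: "k < K \<Longrightarrow> \<omega> k = 1 \<or> \<omega> k = -1"

lemma (in smooth_domain) ex_tubular: "\<exists>sg \<omega> \<alpha> \<beta> r m C. tubular \<Omega> K \<Gamma> sg \<omega> \<alpha> \<beta> r m C"
proof (rule normal_distance, goal_cases)
  case c: (1 r m C)
  have disj: "tube r k u \<inter> frontier \<Omega> = {}" if "k < K" "\<bar>u\<bar> = 1" for k u
    by (rule tube_disjoint[OF that c(3)[OF that(1)]])
  have "\<forall>k. \<exists>u \<omega> \<alpha> \<beta>. k < K \<longrightarrow> (\<bar>u\<bar> = 1 \<and> tube r k u \<subseteq> \<Omega> \<and> tube r k (-u) \<inter> \<Omega> = {} \<and>
    (\<forall>p\<in>tube r k u. winding_number (\<Gamma> k) p = \<alpha>) \<and> (\<forall>p\<in>tube r k (-u). winding_number (\<Gamma> k) p = \<beta>) \<and>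
    \<omega> * (\<alpha> - \<beta>) = 1 \<and> (\<omega> = 1 \<or> \<omega> = -1))"
    using tube_sides[OF _ c(1,2) c(4) disj] by simp
  then obtain sg \<omega> \<alpha> \<beta> where T: "\<And>k. k < K \<Longrightarrow> \<bar>sg k\<bar> = 1 \<and> tube r k (sg k) \<subseteq> \<Omega> \<and> tube r k (-sg k) \<inter> \<Omega> = {} \<and>
    (\<forall>p\<in>tube r k (sg k). winding_number (\<Gamma> k) p = \<alpha> k) \<and> (\<forall>p\<in>tube r k (-sg k). winding_number (\<Gamma> k) p = \<beta> k) \<and>
    \<omega> k * (\<alpha> k - \<beta> k) = 1 \<and> (\<omega> k = 1 \<or> \<omega> k = -1)"
    unfolding choice_iff by auto
  have "tubular \<Omega> K \<Gamma> sg \<omega> \<alpha> \<beta> r m C"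
  proof (unfold_locales)
    show "cmod (sg l *\<^sub>R (\<i> * \<Gamma>' l s) - sg k *\<^sub>R (\<i> * \<Gamma>' k t)) \<le> C * cmod (\<Gamma> l s - \<Gamma> k t)"
      if "k < K" "l < K" for k l s t
      using T that by (intro c(5)) auto
  qed (use T in \<open>auto intro: c(1-4)\<close>)
  then show ?thesis by blast
qed

section \<open>The boundary as an oriented cycle: index, parallel curves, Cauchy formula\<close>

context tubular
begin

definition normal :: "nat \<Rightarrow> real \<Rightarrow> complex" where
  "normal k t = sg k *\<^sub>R (\<i> * \<Gamma>' k t)"

text \<open>A parallel curve: positive \<open>e\<close> moves into \<Omega>, negative
  \<open>e\<close> out of it.\<close>

definition shift :: "nat \<Rightarrow> real \<Rightarrow> real \<Rightarrow> complex" where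
  "shift k e t = \<Gamma> k t + e *\<^sub>R normal k t"

lemma shift_0 [simp]: "shift k 0 t = \<Gamma> k t"
  by (simp add: shift_def)

lemma shift_in: "k < K \<Longrightarrow> 0 < e \<Longrightarrow> e \<le> r \<Longrightarrow> shift k e t \<in> \<Omega>"
  using inner_tube tubeI unfolding shift_def normal_def by blast

lemma tube_disjoint_frontier: "k < K \<Longrightarrow> \<bar>u\<bar> = 1 \<Longrightarrow> tube r k u \<inter> frontier \<Omega> = {}"
  by (rule tube_disjoint) (auto intro!: normal_distance)

lemma shift_outer_tube:
  assumes "0 < e" "e \<le> r"
  shows "shift k (-e) t \<in> tube r k (- sg k)"
  using tubeI[OF assms, of k t "- sg k"] by (simp add: shift_def normal_def)

lemma shift_notin:
  assumes "k < K" "0 < e" "e \<le> r"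
  shows "shift k (-e) t \<notin> closure \<Omega>"
  using shift_outer_tube[OF assms(2,3)] outer_tube[OF assms(1)] tube_disjoint_frontier[of k "- sg k"] sg assms(1)
  by (auto simp: closure_Un_frontier)

lemma near_curve_cases:
  assumes "k < K" "p \<notin> range (\<Gamma> k)" "dist p (\<Gamma> k t) < r * m"
  shows "p \<in> tube r k (sg k) \<or> p \<in> tube r k (- sg k)"
proof -
  have "sg k = 1 \<or> sg k = -1" using sg[OF assms(1)] by linarith
  then show ?thesis
    using tube_covers[OF assms(1) m speed[OF assms(1)] assms(2,3)] by auto
qed

lemma path_image_\<Gamma>: "k < K \<Longrightarrow> path_image (\<Gamma> k) = range (\<Gamma> k)"
  using smooth_curve.image_UNIV[OF curve] by (simp add: path_image_def)

lemma winding_const: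
  assumes "k < K" "connected S" "S \<inter> range (\<Gamma> k) = {}" "w \<in> S" "z \<in> S"
  shows "winding_number (\<Gamma> k) w = winding_number (\<Gamma> k) z"
  using smooth_curve.is_simple_path(2,3)[OF curve[OF assms(1)]] assms
  by (intro winding_number_eq[of _ _ S]) (auto simp: path_image_\<Gamma>)

definition index :: "complex \<Rightarrow> complex" where
  "index w = (\<Sum>k<K. \<omega> k * winding_number (\<Gamma> k) w)"

text \<open>Away from the boundary both terms are locally constant. At a boundary point only one
  curve is near; one of its collars lies in \<Omega>, the other does not, and
  \<open>winding_jump\<close> makes the jump of the index equal to that of the indicator.\<close>

lemma index_defect_locally_const:
  "\<exists>e>0. \<exists>c. \<forall>w\<in>ball x e - frontier \<Omega>. index w - indicator \<Omega> w = c"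
proof (cases "x \<in> frontier \<Omega>")
  case False
  have "open (- frontier \<Omega>)" by (simp add: open_Compl)
  then obtain e where e: "e > 0" "ball x e \<subseteq> - frontier \<Omega>" using False open_contains_ball by blast
  have "index w - indicator \<Omega> w = index x - indicator \<Omega> x" if w: "w \<in> ball x e" for w
  proof -
    have x: "x \<in> ball x e" using e by simp
    have "winding_number (\<Gamma> k) w = winding_number (\<Gamma> k) x" if "k < K" for k
      using winding_const[OF that connected_ball _ w x] e(2) that unfolding frontier_ranges by blast
    moreover have "w \<in> \<Omega> \<longleftrightarrow> x \<in> \<Omega>"
      using connected_disjoint_frontier[OF connected_ball, of x e \<Omega>] e(2) w x by blast
    ultimately show ?thesis by (simp add: index_def indicator_def)
  qed
  then show ?thesis using e(1) by blast
next
  case True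
  then obtain k t where k: "k < K" "x = \<Gamma> k t" unfolding frontier_ranges by blast
  obtain \<delta> where \<delta>: "\<delta> > 0" "\<And>k l s t. k < K \<Longrightarrow> l < K \<Longrightarrow> k \<noteq> l \<Longrightarrow> \<delta> \<le> dist (\<Gamma> l s) (\<Gamma> k t)"
    by (rule curves_apart) (rule that)
  \<comment> \<open>\<open>r * m\<close> lets the two collars of curve \<open>k\<close> cover the
    ball up to the curve, and \<delta> keeps all other curves out of it.\<close>
  define e where "e = min (r * m) \<delta>"
  have e: "e > 0" using r m \<delta> by (simp add: e_def)
  define A where "A = (\<Sum>l\<in>{..<K} - {k}. \<omega> l * winding_number (\<Gamma> l) x)"
  have "index w - indicator \<Omega> w = A + \<omega> k * \<beta> k" if w: "w \<in> ball x e - frontier \<Omega>" for w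
  proof -
    have "winding_number (\<Gamma> l) w = winding_number (\<Gamma> l) x" if l: "l < K" "l \<noteq> k" for l
    proof (rule winding_const[OF l(1) connected_ball])
      show "ball x e \<inter> range (\<Gamma> l) = {}"
      proof (rule equals0I)
        fix v assume "v \<in> ball x e \<inter> range (\<Gamma> l)"
        then obtain s where "v = \<Gamma> l s" "dist (\<Gamma> k t) v < \<delta>" using k by (auto simp: e_def)
        then show False using \<delta>(2)[of k l s t] l k by (simp add: dist_commute)
      qed
    qed (use w e in auto)
    then have "(\<Sum>l\<in>{..<K} - {k}. \<omega> l * winding_number (\<Gamma> l) w) = A"
      unfolding A_def by (intro sum.cong) auto
    then have I: "index w = \<omega> k * winding_number (\<Gamma> k) w + A"
      unfolding index_def using k by (subst sum.remove[of _ k]) auto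
    have "w \<notin> range (\<Gamma> k)" using w k unfolding frontier_ranges by blast
    moreover have "dist w (\<Gamma> k t) < r * m" using w k by (simp add: e_def dist_commute)
    ultimately have "w \<in> tube r k (sg k) \<or> w \<in> tube r k (- sg k)"
      using near_curve_cases k(1) by blast
    then show ?thesis
    proof
      assume w: "w \<in> tube r k (sg k)"
      then have "w \<in> \<Omega>" using inner_tube k by blast
      moreover have "\<omega> k * \<alpha> k - 1 = \<omega> k * \<beta> k"
        using winding_jump[OF k(1)] by (simp add: algebra_simps)
      ultimately show ?thesis using I inner_winding[OF k(1) w] by (simp add: algebra_simps)
    next
      assume w: "w \<in> tube r k (- sg k)"
      then have "w \<notin> \<Omega>" using outer_tube k by blast
      then show ?thesis using I outer_winding[OF k(1) w] by simp
    qed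
  qed
  then show ?thesis using e by blast
qed

text \<open>The difference of both sides has no jump across the curves, hence is constant, and it vanishes
  far away.\<close>

lemma index_eq_indicator:
  assumes "w \<notin> frontier \<Omega>"
  shows "index w = indicator \<Omega> w"
proof -
  let ?J = "\<lambda>w. index w - indicator \<Omega> w"
  define U where "U = {x. \<exists>e>0. \<forall>w\<in>ball x e - frontier \<Omega>. ?J w = 0}"
  have sub: "ball y (e - dist x y) \<subseteq> ball x e" for x y :: complex and e
  proof
    fix v assume "v \<in> ball y (e - dist x y)"
    then show "v \<in> ball x e" using dist_triangle[of x v y] by simp
  qed
  have "open U"
  proof (rule openI)
    fix x assume "x \<in> U"
    then obtain e where e: "e > 0" "\<forall>w\<in>ball x e - frontier \<Omega>. ?J w = 0" unfolding U_def by blast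
    have "y \<in> U" if y: "y \<in> ball x e" for y
      unfolding U_def using e(2) sub[of y e x] y
      by (intro CollectI exI[of _ "e - dist x y"] conjI) auto
    then show "\<exists>e>0. ball x e \<subseteq> U" using e(1) by blast
  qed
  moreover have "open (- U)"
  proof (rule openI)
    fix x assume x: "x \<in> - U"
    obtain e c where e: "e > 0" "\<forall>w\<in>ball x e - frontier \<Omega>. ?J w = c"
      using index_defect_locally_const by blast
    have "c \<noteq> 0" using x e unfolding U_def by blast
    have "y \<notin> U" if y: "y \<in> ball x e" for y
    proof
      assume "y \<in> U"
      then obtain e' where e': "e' > 0" "\<forall>w\<in>ball y e' - frontier \<Omega>. ?J w = 0" unfolding U_def by blast
      define d where "d = min e' (e - dist x y)"
      have d: "d > 0" using e' y by (simp add: d_def)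
      \<comment> \<open>Comparing the two constants takes a point off the frontier. A ball inside
        the frontier would meet \<Omega>, since its centre lies in the closure, although \<Omega> is
        disjoint from its frontier.\<close>
      have "\<not> ball y d \<subseteq> frontier \<Omega>"
      proof
        assume *: "ball y d \<subseteq> frontier \<Omega>"
        have "y \<in> ball y d" using d by simp
        then have "y \<in> frontier \<Omega>" using * by blast
        then have "y \<in> closure \<Omega>" by (simp add: frontier_def)
        then obtain v where v: "v \<in> \<Omega>" "dist v y < d" using d closure_approachable by blast
        then have "v \<in> ball y d" by (simp add: dist_commute)
        then show False using * frontier_disjoint v(1) by blast
      qed
      then obtain v where v: "v \<in> ball y d" "v \<notin> frontier \<Omega>" by blast
      have "v \<in> ball y e'" "v \<in> ball x e" using v(1) sub[of y e x] by (auto simp: d_def)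
      then have "?J v = 0" "?J v = c" using e'(2) e(2) v(2) by blast+
      then show False using \<open>c \<noteq> 0\<close> by simp
    qed
    then show "\<exists>e>0. ball x e \<subseteq> - U" using e(1) by blast
  qed
  moreover have "U \<noteq> {}"
  proof -
    have "bounded (closure \<Omega>)" using \<Omega>(4) by (rule bounded_closure)
    then obtain R where R: "R > 0" "\<And>z. z \<in> closure \<Omega> \<Longrightarrow> cmod z \<le> R" using bounded_pos by metis
    have "?J w = 0" if w: "w \<in> ball (of_real (R + 1)) 1" for w
    proof -
      have "cmod (of_real (R + 1)) \<le> cmod w + dist (of_real (R + 1)) w"
        by (metis dist_norm norm_triangle_sub)
      then have w: "R < cmod w" using w R(1) by simp
      have "winding_number (\<Gamma> k) w = 0" if k: "k < K" for k
      proof (rule winding_number_zero_outside[where s = "cball 0 R"])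
        show "path_image (\<Gamma> k) \<subseteq> cball 0 R"
          using R(2) \<Gamma>_in_frontier[OF k] by (auto simp: path_image_\<Gamma>[OF k] frontier_def)
      qed (use smooth_curve.is_simple_path[OF curve[OF k]] w in auto)
      moreover have "w \<notin> \<Omega>" using R(2)[of w] w closure_subset by fastforce
      ultimately show ?thesis by (simp add: index_def)
    qed
    then have "of_real (R + 1) \<in> U" unfolding U_def by (intro CollectI exI[of _ 1]) auto
    then show ?thesis by blast
  qed
  ultimately have "U = UNIV" using clopen[of U] by (simp add: closed_def)
  then have "w \<in> U" by simp
  then obtain e where "e > 0" "\<forall>v\<in>ball w e - frontier \<Omega>. ?J v = 0" unfolding U_def by blast
  then show ?thesis using assms by (metis DiffI centre_in_ball eq_iff_diff_eq_0)
qed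

definition normal' :: "nat \<Rightarrow> real \<Rightarrow> complex" where
  "normal' k t = sg k *\<^sub>R (\<i> * vector_derivative (\<Gamma>' k) (at t))"

lemma normal_deriv: "k < K \<Longrightarrow> (normal k has_vector_derivative normal' k t) (at t)"
  unfolding normal_def[abs_def] normal'_def
  by (auto intro!: derivative_eq_intros smooth_curve.derivs(2)[OF curve])

lemma shift_deriv: "k < K \<Longrightarrow> (shift k e has_vector_derivative \<Gamma>' k t + e *\<^sub>R normal' k t) (at t)"
  unfolding shift_def[abs_def]
  by (auto intro!: derivative_eq_intros smooth_curve.derivs(1)[OF curve] normal_deriv)

lemma cont_curve:
  assumes "k < K"
  shows "continuous_on A (\<Gamma> k)" "continuous_on A (\<Gamma>' k)" "continuous_on A (normal k)" "continuous_on A (normal' k)"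
    "continuous_on A (shift k e)"
proof -
  interpret smooth_curve "\<Gamma> k" using curve assms .
  show 1: "continuous_on A (\<Gamma> k)" "continuous_on A (\<Gamma>' k)" by (rule cont)+
  show 2: "continuous_on A (normal k)" "continuous_on A (normal' k)"
    unfolding normal_def[abs_def] normal'_def[abs_def] by (intro continuous_intros cont)+
  show "continuous_on A (shift k e)"
    unfolding shift_def[abs_def] by (intro continuous_intros 1 2)
qed

lemma valid_shift:
  assumes "k < K"
  shows "valid_path (shift k e)" "pathfinish (shift k e) = pathstart (shift k e)" "path (shift k e)"
proof -
  interpret smooth_curve "\<Gamma> k" using curve assms .
  have "shift k e C1_differentiable_on {0..1}"
    unfolding C1_differentiable_on_def
    by (intro exI[of _ "\<lambda>t. \<Gamma>' k t + e *\<^sub>R normal' k t"] conjI ballI shift_deriv assms)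
       (intro continuous_intros cont_curve assms)
  then show 1: "valid_path (shift k e)"
    unfolding valid_path_def by (rule C1_differentiable_imp_piecewise)
  then show "path (shift k e)" by (rule valid_path_imp_path)
  show "pathfinish (shift k e) = pathstart (shift k e)"
    using periodic(1)[rule_format, of 0] periodic(2)[rule_format, of 0]
    by (simp add: pathfinish_def pathstart_def shift_def normal_def)
qed

lemma path_image_shift: "k < K \<Longrightarrow> 0 < e \<Longrightarrow> e \<le> r \<Longrightarrow> path_image (shift k e) \<subseteq> \<Omega>"
  using shift_in by (auto simp: path_image_def)

lemma winding_shift_homotopy:
  assumes k: "k < K" and avoid: "\<And>t x. 0 \<le> x \<Longrightarrow> x \<le> e \<Longrightarrow> shift k x t \<noteq> w" and e: "e \<ge> 0"
  shows "winding_number (shift k e) w = winding_number (\<Gamma> k) w"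
proof -
  have "homotopic_loops (- {w}) (\<Gamma> k) (shift k e)"
  proof (rule homotopic_loops_linear)
    fix t
    show "closed_segment (\<Gamma> k t) (shift k e t) \<subseteq> - {w}"
    proof
      fix y assume "y \<in> closed_segment (\<Gamma> k t) (shift k e t)"
      then obtain u where u: "0 \<le> u" "u \<le> 1" "y = (1 - u) *\<^sub>R \<Gamma> k t + u *\<^sub>R shift k e t"
        unfolding closed_segment_def by blast
      have "y = shift k (u * e) t" using u(3) by (simp add: shift_def algebra_simps)
      moreover have "u * e \<le> 1 * e" using u e by (intro mult_right_mono)
      ultimately show "y \<in> - {w}" using avoid[of "u * e" t] u(1) e by simp
    qed
  qed (use smooth_curve.is_simple_path[OF curve[OF k]] valid_shift[OF k] in auto)
  from winding_number_homotopic_loops[OF this] show ?thesis by simp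
qed

text \<open>Off the closure, the homotopy to the original curves applies. A boundary point is met by
  that homotopy; it is joined instead to an outer point along its normal, and this segment does not
  cross the shifted curves because they lie in \<Omega>.\<close>

lemma index_shift_outside:
  assumes e: "0 < e" "e \<le> r" and w: "w \<notin> \<Omega>"
  shows "(\<Sum>k<K. \<omega> k * winding_number (shift k e) w) = 0"
proof -
  have *: "(\<Sum>k<K. \<omega> k * winding_number (shift k e) v) = 0" if v: "v \<notin> closure \<Omega>" for v
  proof -
    have "winding_number (shift k e) v = winding_number (\<Gamma> k) v" if k: "k < K" for k
    proof (rule winding_shift_homotopy[OF k])
      fix t x :: real assume x: "0 \<le> x" "x \<le> e"
      have "shift k x t \<in> closure \<Omega>"
      proof (cases "x = 0")
        case True
        then show ?thesis using \<Gamma>_in_frontier[OF k] by (simp add: frontier_def)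
      next
        case False
        then show ?thesis using shift_in[OF k, of x t] x e closure_subset by force
      qed
      then show "shift k x t \<noteq> v" using v by blast
    qed (use e in simp)
    then have "(\<Sum>k<K. \<omega> k * winding_number (shift k e) v) = index v" unfolding index_def by simp
    then show ?thesis using index_eq_indicator[of v] v by (simp add: closure_Un_frontier)
  qed
  show ?thesis
  proof (cases "w \<in> closure \<Omega>")
    case True
    then obtain l t where l: "l < K" "w = \<Gamma> l t"
      using w unfolding closure_Un_frontier frontier_ranges by blast
    define S where "S = (\<lambda>x. shift l (- x) t) ` {0..r}"
    have S: "connected S" "w \<in> S" "shift l (- r) t \<in> S" "S \<inter> \<Omega> = {}"
    proof -
      have "continuous_on {0..r} (\<lambda>x. shift l (- x) t)" unfolding shift_def by (intro continuous_intros)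
      then show "connected S" unfolding S_def by (rule connected_continuous_image) simp
      show "w \<in> S" unfolding S_def using l r by (intro image_eqI[of _ _ 0]) auto
      show "shift l (- r) t \<in> S" unfolding S_def using r by (intro imageI) auto
      have "shift l (- x) t \<notin> \<Omega>" if "0 \<le> x" "x \<le> r" for x
      proof (cases "x = 0")
        case True
        then show ?thesis using \<Gamma>_notin l by simp
      next
        case False
        then have "shift l (- x) t \<notin> closure \<Omega>" using that l by (intro shift_notin) auto
        then show ?thesis using closure_subset by blast
      qed
      then show "S \<inter> \<Omega> = {}" unfolding S_def by auto
    qed
    have "winding_number (shift k e) w = winding_number (shift k e) (shift l (- r) t)" if k: "k < K" for k
      using valid_shift[OF k] S path_image_shift[OF k e]
      by (intro winding_number_eq[of _ _ S]) auto
    then show ?thesis using *[OF shift_notin[OF l(1) r order.refl, of t]] by simp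
  qed (use * in simp)
qed

lemma normal_bounded: "\<exists>B>0. \<forall>k<K. \<forall>t. cmod (normal k t) \<le> B"
proof -
  obtain m B C where "B > 0" "\<And>k t. k < K \<Longrightarrow> cmod (\<Gamma>' k t) \<le> B"
    using curve_constants by metis
  then show ?thesis using sg by (intro exI[of _ B]) (auto simp: normal_def norm_mult)
qed

lemma index_shift_inside:
  assumes w: "w \<in> \<Omega>"
  shows "\<exists>d>0. \<exists>e0>0. e0 \<le> r \<and> (\<forall>k<K. \<forall>e t. 0 \<le> e \<longrightarrow> e < e0 \<longrightarrow> d \<le> cmod (shift k e t - w)) \<and>
    (\<forall>e. 0 < e \<longrightarrow> e < e0 \<longrightarrow> (\<Sum>k<K. \<omega> k * winding_number (shift k e) w) = 1)"
proof -
  obtain d where d: "d > 0" "ball w d \<subseteq> \<Omega>" using w \<Omega>(1) open_contains_ball by blast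
  obtain B where B: "B > 0" "\<And>k t. k < K \<Longrightarrow> cmod (normal k t) \<le> B" using normal_bounded by blast
  define e0 where "e0 = min r (d / (2 * B))"
  have e0: "e0 > 0" "e0 \<le> r" using r d B by (auto simp: e0_def)
  have far: "d / 2 \<le> cmod (shift k e t - w)" if "k < K" "0 \<le> e" "e < e0" for k e t
  proof -
    have "d \<le> dist w (\<Gamma> k t)" using d(2) \<Gamma>_notin[OF that(1), of t] by (meson mem_ball not_le subsetD)
    moreover have "e * cmod (normal k t) \<le> (d / (2 * B)) * B"
      using that B d by (intro mult_mono) (auto simp: e0_def)
    moreover have "\<Gamma> k t - w = (shift k e t - w) - e *\<^sub>R normal k t" by (simp add: shift_def)
    then have "cmod (\<Gamma> k t - w) \<le> cmod (shift k e t - w) + cmod (e *\<^sub>R normal k t)"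
      by (metis norm_triangle_ineq4)
    ultimately show ?thesis using that B by (simp add: dist_norm norm_minus_commute)
  qed
  have "(\<Sum>k<K. \<omega> k * winding_number (shift k e) w) = 1" if e: "0 < e" "e < e0" for e
  proof -
    have "winding_number (shift k e) w = winding_number (\<Gamma> k) w" if k: "k < K" for k
    proof (rule winding_shift_homotopy[OF k])
      show "shift k x t \<noteq> w" if "0 \<le> x" "x \<le> e" for x t
        using far[OF k that(1), of t] that e d by auto
    qed (use e in simp)
    then have "(\<Sum>k<K. \<omega> k * winding_number (shift k e) w) = index w" unfolding index_def by simp
    then show ?thesis using index_eq_indicator[of w] w frontier_disjoint by auto
  qed
  then show ?thesis using d e0 far by (intro exI[of _ "d / 2"] exI[of _ e0] conjI) auto
qed

text \<open>The difference quotient \<open>G\<close> of \<open>h\<close> at \<open>w\<close> is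
  holomorphic on \<Omega>, so Cauchy's theorem for the shifted cycle annihilates it; the term with
  the constant \<open>h w\<close> yields the total winding number.\<close>

lemma Cauchy_formula_shift:
  assumes h: "h holomorphic_on \<Omega>" and w: "w \<in> \<Omega>" and e: "0 < e" "e \<le> r"
    and off: "\<And>k t. k < K \<Longrightarrow> shift k e t \<noteq> w"
    and wn: "(\<Sum>k<K. \<omega> k * winding_number (shift k e) w) = 1"
  shows "(\<Sum>k<K. \<omega> k * contour_integral (shift k e) (\<lambda>z. h z / (z - w))) = 2 * pi * \<i> * h w"
proof -
  define G where "G z = (if z = w then deriv h w else (h z - h w) / (z - w))" for z
  have "G holomorphic_on \<Omega>" unfolding G_def by (rule pole_lemma_open[OF h \<Omega>(1)])
  then have "(\<Sum>k<K. \<omega> k * contour_integral (shift k e) G) = 0"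
    using valid_shift path_image_shift[OF _ e] index_shift_outside[OF e] orientation \<Omega>
    by (intro Cauchy_theorem_cycle[where S = \<Omega>]) auto
  moreover have "contour_integral (shift k e) G = contour_integral (shift k e) (\<lambda>z. h z / (z - w))
      - h w * (2 * pi * \<i> * winding_number (shift k e) w)" if k: "k < K" for k
  proof -
    have w': "w \<notin> path_image (shift k e)" using off[OF k] by (auto simp: path_image_def)
    have P: "path_image (shift k e) \<subseteq> \<Omega> - {w}" using path_image_shift[OF k e] w' by blast
    have ci: "F contour_integrable_on shift k e" if "F holomorphic_on \<Omega> - {w}" for F
      using contour_integrable_holomorphic_simple[OF that _ valid_shift(1)[OF k] P] \<Omega>(1) by auto
    have h': "h holomorphic_on \<Omega> - {w}" using h by (rule holomorphic_on_subset) auto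
    have i1: "(\<lambda>z. h z / (z - w)) contour_integrable_on shift k e"
      by (rule ci) (intro holomorphic_intros h', auto)
    have i2: "(\<lambda>z. 1 / (z - w)) contour_integrable_on shift k e"
      by (rule ci) (intro holomorphic_intros, auto)
    have "contour_integral (shift k e) G = contour_integral (shift k e) (\<lambda>z. h z / (z - w) - h w * (1 / (z - w)))"
      using w' by (intro contour_integral_eq) (auto simp: G_def diff_divide_distrib)
    also have "\<dots> = contour_integral (shift k e) (\<lambda>z. h z / (z - w)) - h w * contour_integral (shift k e) (\<lambda>z. 1 / (z - w))"
      by (simp only: contour_integral_diff[OF i1 contour_integrable_lmul[OF i2]] contour_integral_lmul[OF i2])
    also have "contour_integral (shift k e) (\<lambda>z. 1 / (z - w)) = 2 * pi * \<i> * winding_number (shift k e) w"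
      using winding_number_valid_path[OF valid_shift(1)[OF k] w'] by simp
    finally show ?thesis .
  qed
  ultimately have "(\<Sum>k<K. \<omega> k * contour_integral (shift k e) (\<lambda>z. h z / (z - w)))
      = h w * (2 * pi * \<i>) * (\<Sum>k<K. \<omega> k * winding_number (shift k e) w)"
    by (simp add: algebra_simps sum_subtractf sum_distrib_left)
  then show ?thesis using wn by simp
qed

text \<open>The working class of the proof. Boundedness serves dominated convergence, and the values
  on the boundary are required to be the limits along normals, which is what can be established for
  a proper map. Continuity at the boundary is not asked for.\<close>

definition bdd_hol :: "(complex \<Rightarrow> complex) \<Rightarrow> bool" where
  "bdd_hol h \<longleftrightarrow> h holomorphic_on \<Omega> \<and> (\<exists>B. \<forall>z\<in>\<Omega>. cmod (h z) \<le> B) \<and>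
     (\<forall>k<K. \<forall>t. ((\<lambda>e. h (shift k e t)) \<longlongrightarrow> h (\<Gamma> k t)) (at_right 0))"

lemma bdd_hol_bound:
  assumes "bdd_hol h"
  obtains B where "B > 0" "\<And>z. z \<in> closure \<Omega> \<Longrightarrow> cmod (h z) \<le> B"
proof -
  obtain B where B: "\<And>z. z \<in> \<Omega> \<Longrightarrow> cmod (h z) \<le> B" using assms unfolding bdd_hol_def by blast
  have "cmod (h (\<Gamma> k t)) \<le> B" if k: "k < K" for k t
  proof (rule tendsto_upperbound[where F = "at_right 0"])
    show "((\<lambda>e. cmod (h (shift k e t))) \<longlongrightarrow> cmod (h (\<Gamma> k t))) (at_right 0)"
      using assms k unfolding bdd_hol_def by (intro tendsto_norm) blast
    show "\<forall>\<^sub>F e in at_right 0. cmod (h (shift k e t)) \<le> B"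
      using eventually_at_right_real[OF r] by eventually_elim (use B shift_in[OF k] in auto)
  qed auto
  then have "cmod (h z) \<le> \<bar>B\<bar> + 1" if z: "z \<in> closure \<Omega>" for z
  proof (cases "z \<in> \<Omega>")
    case True
    then show ?thesis using B[of z] by linarith
  next
    case False
    then obtain k t where "k < K" "z = \<Gamma> k t"
      using z unfolding closure_Un_frontier frontier_ranges by blast
    then show ?thesis using \<open>\<And>t k. k < K \<Longrightarrow> cmod (h (\<Gamma> k t)) \<le> B\<close>[of k t] by simp
  qed
  then show ?thesis by (intro that[of "\<bar>B\<bar> + 1"]) auto
qed

text \<open>The formula on the parallel curves passes to the limit: the integrands converge
  pointwise by the normal limits and are bounded because \<open>w\<close> keeps a positive distance
  from all curves involved.\<close>

lemma Cauchy_formula: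
  assumes h: "bdd_hol h" and w: "w \<in> \<Omega>"
  shows "\<And>k. k < K \<Longrightarrow> (\<lambda>t. h (\<Gamma> k t) * \<Gamma>' k t / (\<Gamma> k t - w)) integrable_on {0..1}"
    and "(\<Sum>k<K. \<omega> k * integral {0..1} (\<lambda>t. h (\<Gamma> k t) * \<Gamma>' k t / (\<Gamma> k t - w))) = 2 * pi * \<i> * h w"
proof -
  obtain d e0 where d: "d > 0" and e0: "e0 > 0" "e0 \<le> r"
    and far: "\<And>k e t. k < K \<Longrightarrow> 0 \<le> e \<Longrightarrow> e < e0 \<Longrightarrow> d \<le> cmod (shift k e t - w)"
    and wn: "\<And>e. 0 < e \<Longrightarrow> e < e0 \<Longrightarrow> (\<Sum>k<K. \<omega> k * winding_number (shift k e) w) = 1"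
    using index_shift_inside[OF w] by blast
  obtain B where B: "B > 0" "\<And>z. z \<in> closure \<Omega> \<Longrightarrow> cmod (h z) \<le> B" by (rule bdd_hol_bound[OF h]) (rule that)
  define e where "e n = e0 / 2 * inverse (real (Suc n))" for n
  have e: "0 < e n" "e n < e0" for n
  proof -
    have "inverse (real (Suc n)) \<le> 1" by (simp add: field_simps)
    then have "e n \<le> e0 / 2 * 1" unfolding e_def using e0(1) by (intro mult_left_mono) auto
    then show "0 < e n" "e n < e0" using e0(1) by (auto simp: e_def)
  qed
  have e_lim: "e \<longlonglongrightarrow> 0"
    unfolding e_def using tendsto_mult_left[OF LIMSEQ_inverse_real_of_nat, of "e0 / 2"] by simp
  have hol: "h holomorphic_on \<Omega>" using h by (simp add: bdd_hol_def)
  define f where "f k n t = h (shift k (e n) t) / (shift k (e n) t - w) * (\<Gamma>' k t + e n *\<^sub>R normal' k t)" for k n t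
  have fi: "f k n integrable_on {0..1}"
    and ci: "contour_integral (shift k (e n)) (\<lambda>z. h z / (z - w)) = integral {0..1} (f k n)" if k: "k < K" for k n
  proof -
    have "continuous_on {0..1} (\<lambda>t. h (shift k (e n) t))"
    proof (rule continuous_on_compose2[OF holomorphic_on_imp_continuous_on[OF hol] cont_curve(5)[OF k]])
      show "shift k (e n) ` {0..1} \<subseteq> \<Omega>" using shift_in[OF k] e[of n] e0(2) by force
    qed
    moreover have "shift k (e n) t - w \<noteq> 0" for t using far[OF k, of "e n" t] e[of n] d by auto
    ultimately show "f k n integrable_on {0..1}"
      unfolding f_def by (intro integrable_continuous_real continuous_intros cont_curve k) auto
    show "contour_integral (shift k (e n)) (\<lambda>z. h z / (z - w)) = integral {0..1} (f k n)"
      unfolding contour_integral_integral f_def vector_derivative_at[OF shift_deriv[OF k]] ..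
  qed
  have lim: "(\<lambda>t. h (\<Gamma> k t) * \<Gamma>' k t / (\<Gamma> k t - w)) integrable_on {0..1} \<and>
     (\<lambda>n. integral {0..1} (f k n)) \<longlonglongrightarrow> integral {0..1} (\<lambda>t. h (\<Gamma> k t) * \<Gamma>' k t / (\<Gamma> k t - w))"
    if k: "k < K" for k
  proof -
    have "compact (normal' k ` {0..1})" "compact (\<Gamma>' k ` {0..1})"
      using cont_curve[OF k] by (auto intro!: compact_continuous_image)
    then have "bounded (normal' k ` {0..1})" "bounded (\<Gamma>' k ` {0..1})"
      by (simp_all add: compact_imp_bounded)
    then obtain B1 B2 where B1: "\<And>t. t \<in> {0..1} \<Longrightarrow> cmod (normal' k t) \<le> B1"
      and B2: "\<And>t. t \<in> {0..1} \<Longrightarrow> cmod (\<Gamma>' k t) \<le> B2"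
      unfolding bounded_iff by fast
    have bound: "norm (f k n t) \<le> B / d * (B2 + e0 * B1)" if t: "t \<in> {0..1}" for n t
    proof -
      have "cmod (h (shift k (e n) t)) \<le> B"
        using shift_in[OF k, of "e n" t] e[of n] e0 closure_subset by (intro B(2)) force
      then have "cmod (h (shift k (e n) t) / (shift k (e n) t - w)) \<le> B / d"
        using far[OF k, of "e n" t] e[of n] d B(1) by (simp add: norm_divide frac_le)
      moreover have "cmod (\<Gamma>' k t + e n *\<^sub>R normal' k t) \<le> B2 + e0 * B1"
      proof (rule order_trans[OF norm_triangle_ineq add_mono[OF B2[OF t]]])
        show "cmod (e n *\<^sub>R normal' k t) \<le> e0 * B1"
          using B1[OF t] e[of n] e0 by (auto intro!: mult_mono)
      qed
      ultimately show ?thesis unfolding f_def norm_mult using B d by (intro mult_mono) auto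
    qed
    have conv: "(\<lambda>n. f k n t) \<longlonglongrightarrow> h (\<Gamma> k t) * \<Gamma>' k t / (\<Gamma> k t - w)" for t
    proof -
      have "filterlim e (at_right 0) sequentially"
        using e_lim e(1) by (auto simp: filterlim_at less_imp_neq[symmetric] intro!: eventuallyI)
      moreover have "((\<lambda>x. h (shift k x t)) \<longlongrightarrow> h (\<Gamma> k t)) (at_right 0)"
        using h k unfolding bdd_hol_def by blast
      ultimately have "(\<lambda>n. h (shift k (e n) t)) \<longlonglongrightarrow> h (\<Gamma> k t)"
        by (rule filterlim_compose[rotated])
      moreover have "\<Gamma> k t - w \<noteq> 0" using far[OF k, of 0 t] d e0 by auto
      moreover have "(\<lambda>n. shift k (e n) t) \<longlonglongrightarrow> \<Gamma> k t"
        using tendsto_add[OF tendsto_const tendsto_scaleR[OF e_lim tendsto_const], of "\<Gamma> k t" "normal k t"]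
        by (simp add: shift_def)
      ultimately have "(\<lambda>n. f k n t) \<longlonglongrightarrow> h (\<Gamma> k t) / (\<Gamma> k t - w) * (\<Gamma>' k t + 0 *\<^sub>R normal' k t)"
        unfolding f_def by (intro tendsto_intros e_lim)
      then show ?thesis by simp
    qed
    show ?thesis
      using dominated_convergence[of "f k" "{0..1}" "\<lambda>_. B / d * (B2 + e0 * B1)", OF fi[OF k] _ bound conv]
      by auto
  qed
  then show "(\<lambda>t. h (\<Gamma> k t) * \<Gamma>' k t / (\<Gamma> k t - w)) integrable_on {0..1}" if "k < K" for k using that by blast
  have "(\<lambda>n. \<Sum>k<K. \<omega> k * integral {0..1} (f k n)) \<longlonglongrightarrow>
      (\<Sum>k<K. \<omega> k * integral {0..1} (\<lambda>t. h (\<Gamma> k t) * \<Gamma>' k t / (\<Gamma> k t - w)))"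
    using lim by (intro tendsto_intros) auto
  moreover have "(\<Sum>k<K. \<omega> k * integral {0..1} (f k n)) = 2 * pi * \<i> * h w" for n
  proof -
    have "shift k (e n) t \<noteq> w" if "k < K" for k t using far[OF that, of "e n" t] e[of n] d by auto
    from Cauchy_formula_shift[OF hol w e(1)[of n] _ this wn[OF e]] e[of n] e0 ci
    show ?thesis by simp
  qed
  ultimately show "(\<Sum>k<K. \<omega> k * integral {0..1} (\<lambda>t. h (\<Gamma> k t) * \<Gamma>' k t / (\<Gamma> k t - w))) = 2 * pi * \<i> * h w"
    by (simp add: LIMSEQ_const_iff)
qed

end

subsection \<open>Approximation by rational functions\<close>

lemma set_integrable_bounded:
  fixes u :: "real \<Rightarrow> complex"
  assumes "u \<in> borel_measurable borel" "\<And>t. t \<in> {0..1} \<Longrightarrow> cmod (u t) \<le> B"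
  shows "set_integrable lborel {0..1} u"
  unfolding set_integrable_def
proof (rule Bochner_Integration.integrable_bound[where f = "\<lambda>t. indicator {0..1} t *\<^sub>R B"])
  show "integrable lborel (\<lambda>t::real. indicator {0..1} t *\<^sub>R B)"
    by (intro integrable_scaleR_left integrable_real_indicator) auto
  show "(\<lambda>t. indicat_real {0..1} t *\<^sub>R u t) \<in> borel_measurable lborel"
    using assms(1) by measurable
  show "AE t in lborel. norm (indicat_real {0..1} t *\<^sub>R u t) \<le> norm (indicat_real {0..1} t *\<^sub>R B)"
    using assms(2) by (intro always_eventually allI) (auto simp: indicator_def intro: order_trans[OF _ abs_ge_self])
qed

lemma integrable_bounded:
  fixes u :: "real \<Rightarrow> complex"
  assumes "u \<in> borel_measurable borel" "\<And>t. t \<in> {0..1} \<Longrightarrow> cmod (u t) \<le> B"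
  shows "u integrable_on {0..1}"
  using set_borel_integral_eq_integral(1)[OF set_integrable_bounded[OF assms]] .

text \<open>The density \<open>\<mu>\<close> is only measurable, so the poles are weighted by its mass on each subinterval
  rather than by its values.\<close>

lemma Cauchy_transform_approx_by_poles:
  fixes \<mu> b :: "real \<Rightarrow> complex"
  assumes \<mu>: "\<mu> \<in> borel_measurable borel" "\<And>t. t \<in> {0..1} \<Longrightarrow> cmod (\<mu> t) \<le> M"
    and b: "continuous_on UNIV b" and \<delta>: "\<delta> > 0" "\<And>t z. t \<in> {0..1} \<Longrightarrow> z \<in> S \<Longrightarrow> \<delta> \<le> cmod (b t - z)"
    and \<eta>: "\<eta> > 0"
  shows "\<exists>(n::nat) c s. (\<forall>j<n. s j \<in> {0..1}) \<and>
    (\<forall>z\<in>S. cmod (integral {0..1} (\<lambda>t. \<mu> t / (b t - z)) - (\<Sum>j<n. c j / (b (s j) - z))) \<le> \<eta>)"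
proof -
  define M' where "M' = \<bar>M\<bar> + 1"
  have M': "M' > 0" "\<And>t. t \<in> {0..1} \<Longrightarrow> cmod (\<mu> t) \<le> M'" using \<mu>(2) by (force simp: M'_def)+
  have "uniformly_continuous_on {0..1} b"
    using b by (intro compact_uniformly_continuous) (auto intro: continuous_on_subset)
  \<comment> \<open>Two kernels differ by at most the distance of their poles divided by
    \<open>\<delta>\<^sup>2\<close>; with this modulus of continuity the difference, multiplied by
    the bound \<open>M'\<close> of the density, is at most \<eta>.\<close>
  moreover have "\<eta> * \<delta>\<^sup>2 / M' > 0" using \<eta> \<delta> M' by simp
  ultimately obtain d where d: "d > 0"
    "\<And>x y. x \<in> {0..1} \<Longrightarrow> y \<in> {0..1} \<Longrightarrow> dist y x < d \<Longrightarrow> dist (b y) (b x) < \<eta> * \<delta>\<^sup>2 / M'"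
    unfolding uniformly_continuous_on_def by metis
  obtain n :: nat where n: "n > 0" "inverse (real n) < d"
    using reals_Archimedean[OF d(1)] by (metis inverse_positive_iff_positive of_nat_0_less_iff zero_less_Suc)
  define s where "s j = real j / real n" for j
  have s: "s j \<in> {0..1}" if "j \<le> n" for j using that n by (auto simp: s_def)
  have s_Suc: "s (Suc j) = s j + 1 / n" for j by (simp add: s_def add_divide_distrib)
  define c where "c j = integral {s j..s (Suc j)} \<mu>" for j
  have "cmod (integral {0..1} (\<lambda>t. \<mu> t / (b t - z)) - (\<Sum>j<n. c j / (b (s j) - z))) \<le> \<eta>" if z: "z \<in> S" for z
  proof -
    have bm: "b \<in> borel_measurable borel" using b by (rule borel_measurable_continuous_onI)
    have ne: "b t - z \<noteq> 0" if "t \<in> {0..1}" for t using \<delta>(1) \<delta>(2)[OF that z] by auto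
    have I: "(\<lambda>t. \<mu> t / (b t - z)) integrable_on {0..1}"
    proof (rule integrable_bounded[where B = "M' / \<delta>"])
      show "(\<lambda>t. \<mu> t / (b t - z)) \<in> borel_measurable borel" using \<mu>(1) bm by measurable
      show "cmod (\<mu> t / (b t - z)) \<le> M' / \<delta>" if "t \<in> {0..1}" for t
        using M'(1) M'(2)[OF that] \<delta>(1) \<delta>(2)[OF that z] by (simp add: norm_divide frac_le)
    qed
    have I\<mu>: "\<mu> integrable_on {0..1}" by (rule integrable_bounded[OF \<mu>])
    have "cmod (integral {0..s k} (\<lambda>t. \<mu> t / (b t - z)) - (\<Sum>j<k. c j / (b (s j) - z))) \<le> k * (\<eta> / n)" if "k \<le> n" for k
      using that
    proof (induction k)
      case 0
      then show ?case by (simp add: s_def)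
    next
      case (Suc k)
      have sk: "s k \<in> {0..1}" "s (Suc k) \<in> {0..1}" using s Suc.prems by auto
      have le: "0 \<le> s k" "s k \<le> s (Suc k)" using sk by (auto simp: s_Suc)
      have sub: "{s k..s (Suc k)} \<subseteq> {0..1}" "{0..s (Suc k)} \<subseteq> {0..1}" using sk by auto
      have comb: "integral {0..s k} (\<lambda>t. \<mu> t / (b t - z)) + integral {s k..s (Suc k)} (\<lambda>t. \<mu> t / (b t - z))
          = integral {0..s (Suc k)} (\<lambda>t. \<mu> t / (b t - z))"
        using le integrable_on_subinterval[OF I sub(2)] by (rule Henstock_Kurzweil_Integration.integral_combine)
      let ?E = "\<lambda>t. \<mu> t / (b t - z) - \<mu> t * (1 / (b (s k) - z))"
      have i1: "(\<lambda>t. \<mu> t / (b t - z)) integrable_on {s k..s (Suc k)}" "\<mu> integrable_on {s k..s (Suc k)}"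
        using integrable_on_subinterval[OF I sub(1)] integrable_on_subinterval[OF I\<mu> sub(1)] by auto
      have i2: "(\<lambda>t. \<mu> t * (1 / (b (s k) - z))) integrable_on {s k..s (Suc k)}"
        using i1(2) by (rule integrable_on_mult_left)
      have "(?E has_integral (integral {s k..s (Suc k)} (\<lambda>t. \<mu> t / (b t - z)) - c k * (1 / (b (s k) - z)))) {s k..s (Suc k)}"
        using has_integral_diff[OF integrable_integral[OF i1(1)] integrable_integral[OF i2]]
        unfolding c_def by (simp only: integral_mult_left)
      then have "cmod (integral {s k..s (Suc k)} (\<lambda>t. \<mu> t / (b t - z)) - c k * (1 / (b (s k) - z))) \<le> \<eta> * measure lborel {s k..s (Suc k)}"
      proof (rule has_integral_bound_real[where S = "{}", rotated 2])
        fix t assume "t \<in> {s k..s (Suc k)} - {}"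
        then have t: "t \<in> {0..1}" "dist t (s k) < d"
          using sub n by (auto simp: s_Suc dist_real_def inverse_eq_divide)
        have "?E t = \<mu> t * ((b (s k) - b t) / ((b t - z) * (b (s k) - z)))"
          using ne[OF t(1)] ne[OF sk(1)] by (simp add: field_simps)
        then have "cmod (?E t) = cmod (\<mu> t) * (dist (b t) (b (s k)) / (cmod (b t - z) * cmod (b (s k) - z)))"
          by (simp add: norm_mult norm_divide dist_norm norm_minus_commute)
        also have "\<dots> \<le> M' * ((\<eta> * \<delta>\<^sup>2 / M') / (\<delta> * \<delta>))"
          using M' t \<delta>(1) \<delta>(2)[OF t(1) z] \<delta>(2)[OF sk(1) z] d(2)[OF sk(1) t] \<eta>
          by (intro mult_mono frac_le) auto
        also have "\<dots> = \<eta>" using M' \<delta>(1) by (simp add: power2_eq_square)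
        finally show "cmod (?E t) \<le> \<eta>" .
      qed (use \<eta> in auto)
      also have "\<eta> * measure lborel {s k..s (Suc k)} = \<eta> / n" using le by (simp add: s_Suc)
      finally have step: "cmod (integral {s k..s (Suc k)} (\<lambda>t. \<mu> t / (b t - z)) - c k / (b (s k) - z)) \<le> \<eta> / n" by simp
      have "integral {0..s (Suc k)} (\<lambda>t. \<mu> t / (b t - z)) - (\<Sum>j<Suc k. c j / (b (s j) - z))
        = (integral {0..s k} (\<lambda>t. \<mu> t / (b t - z)) - (\<Sum>j<k. c j / (b (s j) - z)))
          + (integral {s k..s (Suc k)} (\<lambda>t. \<mu> t / (b t - z)) - c k / (b (s k) - z))"
        by (simp add: comb[symmetric])
      also have "cmod \<dots> \<le> k * (\<eta> / n) + \<eta> / n"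
        using Suc.IH Suc.prems step by (intro order_trans[OF norm_triangle_ineq] add_mono) auto
      finally show ?case by (simp add: algebra_simps add_divide_distrib)
    qed
    from this[of n] show ?thesis using n by (simp add: s_def)
  qed
  then show ?thesis using s by (intro exI[of _ n] exI[of _ c] exI[of _ s]) auto
qed

section \<open>Cauchy integrals with poles pushed outside\<close>

context tubular
begin

definition step :: "nat \<Rightarrow> real" where "step n = r / real (Suc n)"

lemma step: "0 < step n" "step n \<le> r" "step \<longlonglongrightarrow> 0" "filterlim step (at_right 0) sequentially"
proof -
  show 1: "0 < step n" "step n \<le> r" for n
    using r mult_left_mono[of 1 "real (Suc n)" r] by (auto simp: step_def divide_le_eq)
  show 2: "step \<longlonglongrightarrow> 0"
    using tendsto_mult_left[OF LIMSEQ_inverse_real_of_nat, of r] by (simp add: step_def[abs_def] divide_inverse)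
  show "filterlim step (at_right 0) sequentially"
    using 1(1) 2 by (auto simp: filterlim_at less_imp_neq[symmetric] intro!: eventuallyI)
qed

lemma bdd_hol_shift_limit:
  assumes "bdd_hol h" "k < K"
  shows "(\<lambda>n. h (shift k (step n) t)) \<longlonglongrightarrow> h (\<Gamma> k t)"
  using assms unfolding bdd_hol_def by (intro filterlim_compose[OF _ step(4)]) blast

lemma bdd_hol_measurable:
  assumes h: "bdd_hol h" and k: "k < K"
  shows "(\<lambda>t. h (\<Gamma> k t)) \<in> borel_measurable borel"
proof (rule borel_measurable_LIMSEQ_metric)
  show "(\<lambda>t. h (shift k (step n) t)) \<in> borel_measurable borel" for n
  proof (intro borel_measurable_continuous_onI continuous_on_compose2[OF _ cont_curve(5)[OF k]])
    show "continuous_on \<Omega> h" using h by (simp add: bdd_hol_def holomorphic_on_imp_continuous_on)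
    show "shift k (step n) ` UNIV \<subseteq> \<Omega>" using shift_in[OF k step(1,2)] by auto
  qed
qed (rule bdd_hol_shift_limit[OF h k])

lemma curve_measurable:
  assumes "k < K"
  shows "\<Gamma> k \<in> borel_measurable borel" "\<Gamma>' k \<in> borel_measurable borel" "shift k e \<in> borel_measurable borel"
  using cont_curve[OF assms] by (auto intro: borel_measurable_continuous_onI)

lemma speed_bounded: "\<exists>B>0. \<forall>k<K. \<forall>t. cmod (\<Gamma>' k t) \<le> B"
proof (rule curve_constants, goal_cases)
  case (1 m B C)
  then show ?case by blast
qed

text \<open>Density and differential stay on the original curves, only the pole of the kernel is
  moved outside. The poles then keep a positive distance from the closure of \<Omega>, and no
  extension of \<open>h\<close> beyond the boundary is involved.\<close>

definition outer_Cauchy :: "(complex \<Rightarrow> complex) \<Rightarrow> real \<Rightarrow> complex \<Rightarrow> complex" where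
  "outer_Cauchy h e z = (\<Sum>k<K. \<omega> k * integral {0..1} (\<lambda>t. h (\<Gamma> k t) * \<Gamma>' k t / (shift k (- e) t - z))) / (2 * pi * \<i>)"

lemma shift_distance:
  assumes "k < K" "l < K" "0 \<le> e" "e \<le> r"
  shows "(cmod (\<Gamma> l s - \<Gamma> k t))\<^sup>2 / 2 + (e * cmod (\<Gamma>' k t))\<^sup>2 \<le> (cmod (\<Gamma> l s - shift k (- e) t))\<^sup>2"
    and "(cmod (\<Gamma> l s - \<Gamma> k t))\<^sup>2 / 2 + (e * cmod (\<Gamma>' k t))\<^sup>2 \<le> (cmod (\<Gamma> l s - shift k e t))\<^sup>2"
proof -
  have "\<bar>- sg k\<bar> = 1" using sg[OF assms(1)] by simp
  from normal_distance[OF assms this, of s t] normal_distance[OF assms sg[OF assms(1)], of s t]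
  show "(cmod (\<Gamma> l s - \<Gamma> k t))\<^sup>2 / 2 + (e * cmod (\<Gamma>' k t))\<^sup>2 \<le> (cmod (\<Gamma> l s - shift k (- e) t))\<^sup>2"
    "(cmod (\<Gamma> l s - \<Gamma> k t))\<^sup>2 / 2 + (e * cmod (\<Gamma>' k t))\<^sup>2 \<le> (cmod (\<Gamma> l s - shift k e t))\<^sup>2"
    by (simp_all add: shift_def normal_def algebra_simps)
qed

text \<open>Pushing the curve outwards has nearly the same effect on the Cauchy kernel as pushing the evaluation
  point inwards, where Cauchy's formula applies; this replaces the Plemelj jump relation.\<close>

lemma kernel_difference:
  fixes s t :: real
  assumes "k < K" "l < K" "0 < e" "e \<le> r"
  defines "D \<equiv> cmod (1 / (shift k (- e) t - \<Gamma> l s) - 1 / (\<Gamma> k t - shift l e s))"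
    and "d \<equiv> cmod (\<Gamma> l s - \<Gamma> k t)"
  shows "D * (d\<^sup>2 / 2 + (e * m)\<^sup>2) \<le> e * (\<bar>C\<bar> * d)" "D \<le> \<bar>C\<bar> / m" "D * d \<le> 2 * e * \<bar>C\<bar>"
proof -
  define X where "X = shift k (- e) t - \<Gamma> l s"
  define Y where "Y = \<Gamma> k t - shift l e s"
  define Q where "Q = d\<^sup>2 / 2 + (e * m)\<^sup>2"
  have Q0: "Q > 0" using assms m by (simp add: Q_def add_nonneg_pos)
  have em: "(e * m)\<^sup>2 \<le> (e * cmod (\<Gamma>' i x))\<^sup>2" if "i < K" for i x
    using speed[OF that, of x] assms(3) m by (intro power_mono mult_left_mono) auto
  have X: "Q \<le> (cmod X)\<^sup>2"
    using shift_distance(1)[OF assms(1,2) less_imp_le[OF assms(3)] assms(4), of s t] em[OF assms(1), of t]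
    by (simp add: X_def Q_def d_def norm_minus_commute)
  have Y: "Q \<le> (cmod Y)\<^sup>2"
    using shift_distance(2)[OF assms(2,1) less_imp_le[OF assms(3)] assms(4), of t s] em[OF assms(2), of s]
    by (simp add: Y_def Q_def d_def norm_minus_commute)
  have "X \<noteq> 0" "Y \<noteq> 0" using X Y Q0 by auto
  then have D: "D * (cmod X * cmod Y) = cmod (Y - X)"
    unfolding D_def X_def[symmetric] Y_def[symmetric]
    by (simp add: divide_simps norm_mult norm_divide flip: norm_mult)
  have "Q * Q \<le> (cmod X)\<^sup>2 * (cmod Y)\<^sup>2" using X Y Q0 by (intro mult_mono) auto
  then have "Q\<^sup>2 \<le> (cmod X * cmod Y)\<^sup>2" by (simp add: power2_eq_square mult_ac)
  then have Q: "Q \<le> cmod X * cmod Y" by (rule power2_le_imp_le) simp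
  have D0: "D \<ge> 0" by (simp add: D_def)
  \<comment> \<open>Both displacements have the same size \<open>e\<close>, so the difference of the
    denominators contains only the difference of two normals, which is Lipschitz in the distance
    \<open>d\<close> of the points.\<close>
  have "Y - X = e *\<^sub>R (normal k t - normal l s)" by (simp add: X_def Y_def shift_def algebra_simps)
  moreover have "cmod (normal k t - normal l s) \<le> \<bar>C\<bar> * d"
  proof -
    have "cmod (normal k t - normal l s) \<le> C * cmod (\<Gamma> k t - \<Gamma> l s)"
      unfolding normal_def by (rule normal_lipschitz[OF assms(2,1)])
    also have "\<dots> \<le> \<bar>C\<bar> * cmod (\<Gamma> k t - \<Gamma> l s)" by (intro mult_right_mono) auto
    finally show ?thesis by (simp add: d_def norm_minus_commute)
  qed
  ultimately have YX: "cmod (Y - X) \<le> e * (\<bar>C\<bar> * d)" using assms(3) by simp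
  have "D * Q \<le> D * (cmod X * cmod Y)" using Q D0 by (rule mult_left_mono)
  then show 1: "D * (d\<^sup>2 / 2 + (e * m)\<^sup>2) \<le> e * (\<bar>C\<bar> * d)" using D YX by (simp add: Q_def)
  have dd: "d \<ge> 0" by (simp add: d_def)
  have "0 \<le> (d - e * m)\<^sup>2" by simp
  \<comment> \<open>This balances the numerator, of size \<open>e * d\<close>, against the lower
    bound for the denominators, and leaves an estimate free of both \<open>e\<close> and
    \<open>d\<close>.\<close>
  then have sq: "d * (e * m) \<le> d\<^sup>2 / 2 + (e * m)\<^sup>2"
    using zero_le_power2[of "e * m"] unfolding power2_diff by linarith
  show "D \<le> \<bar>C\<bar> / m"
  proof (cases "d = 0")
    case True
    then have "D * (e * m)\<^sup>2 \<le> 0" using 1 by simp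
    then have "D \<le> 0" using assms(3) m by (simp add: mult_le_0_iff)
    then show ?thesis using m by (smt (verit) divide_nonneg_pos)
  next
    case False
    have "D * (d * (e * m)) \<le> D * (d\<^sup>2 / 2 + (e * m)\<^sup>2)" using sq D0 by (rule mult_left_mono)
    then have "(D * m) * (d * e) \<le> \<bar>C\<bar> * (d * e)" using 1 by (simp add: mult_ac)
    then have "D * m \<le> \<bar>C\<bar>" using False dd assms(3) by (simp add: mult_le_cancel_right)
    then show ?thesis using m by (simp add: pos_le_divide_eq)
  qed
  show "D * d \<le> 2 * e * \<bar>C\<bar>"
  proof (cases "d = 0")
    case False
    have "D * (d\<^sup>2 / 2) \<le> D * (d\<^sup>2 / 2 + (e * m)\<^sup>2)" using D0 by (intro mult_left_mono) auto
    then have "D * (d\<^sup>2 / 2) \<le> e * (\<bar>C\<bar> * d)" using 1 by linarith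
    then have "(D * d) * d \<le> (2 * e * \<bar>C\<bar>) * d" by (simp add: power2_eq_square mult_ac)
    then show ?thesis using False dd by (simp add: mult_le_cancel_right)
  qed (use assms(3) in simp)
qed

text \<open>On the boundary the outer integral equals \<open>h\<close> at a point shifted inwards,
  by Cauchy's formula, plus integrals of kernel differences. These are uniformly bounded and their
  integrands tend to zero at every parameter, so dominated convergence applies.\<close>

lemma outer_Cauchy_boundary:
  assumes h: "bdd_hol h"
  obtains M where "\<And>n l s. l < K \<Longrightarrow> cmod (outer_Cauchy h (step n) (\<Gamma> l s)) \<le> M"
    and "\<And>l s. l < K \<Longrightarrow> (\<lambda>n. outer_Cauchy h (step n) (\<Gamma> l s)) \<longlonglongrightarrow> h (\<Gamma> l s)"
proof -
  obtain B where B: "B > 0" "\<And>z. z \<in> closure \<Omega> \<Longrightarrow> cmod (h z) \<le> B" by (rule bdd_hol_bound[OF h]) (rule that)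
  have Bf: "cmod (h (\<Gamma> k t)) \<le> B" if "k < K" for k t
    using \<Gamma>_in_frontier[OF that] by (intro B(2)) (auto simp: frontier_def)
  obtain V where V: "V > 0" "\<And>k t. k < K \<Longrightarrow> cmod (\<Gamma>' k t) \<le> V" using speed_bounded by blast
  define E where "E l s k n t = h (\<Gamma> k t) * \<Gamma>' k t *
      (1 / (shift k (- step n) t - \<Gamma> l s) - 1 / (\<Gamma> k t - shift l (step n) s))" for l s k n t
  have Eb: "cmod (E l s k n t) \<le> B * V * (\<bar>C\<bar> / m)" if "k < K" "l < K" for l s k n t
    unfolding E_def norm_mult
    using kernel_difference(2)[OF that step(1)[of n] step(2)[of n], where s = s and t = t] Bf[OF that(1), of t] V(2)[OF that(1), of t] B(1) V(1)
    by (intro mult_mono) auto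
  have Em: "E l s k n \<in> borel_measurable borel" if "k < K" for l s k n
    unfolding E_def[abs_def] using bdd_hol_measurable[OF h that] curve_measurable[OF that] by measurable
  have Ei: "E l s k n integrable_on {0..1}" if "k < K" "l < K" for l s k n
    by (rule integrable_bounded[OF Em[OF that(1)] Eb[OF that]])
  have diff: "outer_Cauchy h (step n) (\<Gamma> l s) = h (shift l (step n) s)
      + (\<Sum>k<K. \<omega> k * integral {0..1} (E l s k n)) / (2 * pi * \<i>)" if l: "l < K" for n l s
  proof -
    have w: "shift l (step n) s \<in> \<Omega>" using shift_in[OF l step(1,2)] .
    have "integral {0..1} (\<lambda>t. h (\<Gamma> k t) * \<Gamma>' k t / (shift k (- step n) t - \<Gamma> l s)) =
        integral {0..1} (\<lambda>t. h (\<Gamma> k t) * \<Gamma>' k t / (\<Gamma> k t - shift l (step n) s)) + integral {0..1} (E l s k n)"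
      if k: "k < K" for k
      using integral_add[OF Cauchy_formula(1)[OF h w k] Ei[OF k l, of s n]]
      by (simp add: E_def[abs_def] algebra_simps)
    then have "(\<Sum>k<K. \<omega> k * integral {0..1} (\<lambda>t. h (\<Gamma> k t) * \<Gamma>' k t / (shift k (- step n) t - \<Gamma> l s)))
      = (\<Sum>k<K. \<omega> k * integral {0..1} (\<lambda>t. h (\<Gamma> k t) * \<Gamma>' k t / (\<Gamma> k t - shift l (step n) s)))
        + (\<Sum>k<K. \<omega> k * integral {0..1} (E l s k n))"
      by (simp add: distrib_left sum.distrib)
    also have "\<dots> = 2 * pi * \<i> * h (shift l (step n) s) + (\<Sum>k<K. \<omega> k * integral {0..1} (E l s k n))"
      by (simp only: Cauchy_formula(2)[OF h w])
    finally show ?thesis unfolding outer_Cauchy_def by (simp add: add_divide_distrib)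
  qed
  have Elim: "(\<lambda>n. integral {0..1} (E l s k n)) \<longlonglongrightarrow> 0" if kl: "k < K" "l < K" for l s k
  proof -
    have "(\<lambda>n. E l s k n t) \<longlonglongrightarrow> 0" for t
    proof (cases "\<Gamma> l s = \<Gamma> k t")
      case True
      \<comment> \<open>At coinciding points the two kernels are equal, since the right-hand side of
        the first kernel estimate is zero there.\<close>
      have "E l s k n t = 0" for n
      proof -
        have "cmod (1 / (shift k (- step n) t - \<Gamma> l s) - 1 / (\<Gamma> k t - shift l (step n) s)) * (step n * m)\<^sup>2 \<le> 0"
          using kernel_difference(1)[OF kl step(1)[of n] step(2)[of n], where s = s and t = t] True by simp
        then show ?thesis using step(1)[of n] m by (simp add: mult_le_0_iff E_def)
      qed
      then show ?thesis by simp
    next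
      case False
      define d where "d = cmod (\<Gamma> l s - \<Gamma> k t)"
      have d: "d > 0" using False by (simp add: d_def)
      show ?thesis
      proof (rule Lim_null_comparison[OF eventuallyI])
        fix n
        have "cmod (1 / (shift k (- step n) t - \<Gamma> l s) - 1 / (\<Gamma> k t - shift l (step n) s)) \<le> 2 * step n * \<bar>C\<bar> / d"
          using kernel_difference(3)[OF kl step(1)[of n] step(2)[of n], where s = s and t = t] d by (simp add: d_def pos_le_divide_eq)
        then show "norm (E l s k n t) \<le> B * V * (2 * step n * \<bar>C\<bar> / d)"
          unfolding E_def norm_mult using Bf[OF kl(1), of t] V(2)[OF kl(1), of t] B(1) V(1)
          by (intro mult_mono) auto
      next
        have "(\<lambda>n. B * V * (2 * step n * \<bar>C\<bar> / d)) \<longlonglongrightarrow> B * V * (2 * 0 * \<bar>C\<bar> / d)"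
          using d by (intro tendsto_intros step(3)) auto
        then show "(\<lambda>n. B * V * (2 * step n * \<bar>C\<bar> / d)) \<longlonglongrightarrow> 0" by simp
      qed
    qed
    from dominated_convergence(2)[of "E l s k" "{0..1}" "\<lambda>_. B * V * (\<bar>C\<bar> / m)" "\<lambda>_. 0",
        OF Ei[OF kl] integrable_const_ivl Eb[OF kl] this]
    show ?thesis by simp
  qed
  show ?thesis
  proof (rule that)
    fix l s assume l: "l < K"
    have "(\<lambda>n. h (shift l (step n) s) + (\<Sum>k<K. \<omega> k * integral {0..1} (E l s k n)) / (2 * pi * \<i>))
        \<longlonglongrightarrow> h (\<Gamma> l s) + (\<Sum>k<K. \<omega> k * 0) / (2 * pi * \<i>)"
      using Elim l by (intro tendsto_intros bdd_hol_shift_limit[OF h]) auto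
    then show "(\<lambda>n. outer_Cauchy h (step n) (\<Gamma> l s)) \<longlonglongrightarrow> h (\<Gamma> l s)" by (simp add: diff[OF l])
    fix n
    have "cmod (integral {0..1} (E l s k n)) \<le> B * V * (\<bar>C\<bar> / m)" if k: "k < K" for k
      using has_integral_bound_real[of "B * V * (\<bar>C\<bar> / m)" "{}", OF _ _ integrable_integral[OF Ei[OF k l]]]
        Eb[OF k l] B V m by simp
    then have "cmod (\<Sum>k<K. \<omega> k * integral {0..1} (E l s k n)) \<le> (\<Sum>k<K. B * V * (\<bar>C\<bar> / m))"
      using orientation by (intro sum_norm_le) (force simp: norm_mult)
    then have "cmod ((\<Sum>k<K. \<omega> k * integral {0..1} (E l s k n)) / (2 * pi * \<i>)) \<le> K * (B * V * (\<bar>C\<bar> / m)) / (2 * pi)"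
      by (simp only: norm_divide norm_mult sum_constant card_lessThan)
         (simp add: divide_right_mono del: times_divide_eq_right)
    moreover have "cmod (h (shift l (step n) s)) \<le> B"
      using shift_in[OF l step(1,2)] closure_subset by (intro B(2)) blast
    ultimately show "cmod (outer_Cauchy h (step n) (\<Gamma> l s)) \<le> B + K * (B * V * (\<bar>C\<bar> / m)) / (2 * pi)"
      unfolding diff[OF l] by (intro order_trans[OF norm_triangle_ineq] add_mono)
  qed
qed

lemma outer_Cauchy_interior:
  assumes h: "bdd_hol h" and z: "z \<in> \<Omega>"
  shows "(\<lambda>n. outer_Cauchy h (step n) z) \<longlonglongrightarrow> h z"
proof -
  obtain B where B: "B > 0" "\<And>z. z \<in> closure \<Omega> \<Longrightarrow> cmod (h z) \<le> B" by (rule bdd_hol_bound[OF h]) (rule that)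
  have Bf: "cmod (h (\<Gamma> k t)) \<le> B" if "k < K" for k t
    using \<Gamma>_in_frontier[OF that] by (intro B(2)) (auto simp: frontier_def)
  obtain V where V: "V > 0" "\<And>k t. k < K \<Longrightarrow> cmod (\<Gamma>' k t) \<le> V" using speed_bounded by blast
  obtain d where d: "d > 0" "ball z d \<subseteq> \<Omega>" using z \<Omega>(1) open_contains_ball by blast
  have far: "d \<le> cmod (shift k (- step n) t - z)" if "k < K" for k n t
  proof -
    have "shift k (- step n) t \<notin> \<Omega>" using shift_notin[OF that step(1,2)] closure_subset by blast
    then have "\<not> dist z (shift k (- step n) t) < d" using d(2) by auto
    then show ?thesis by (simp add: dist_norm norm_minus_commute)
  qed
  have "(\<lambda>n. integral {0..1} (\<lambda>t. h (\<Gamma> k t) * \<Gamma>' k t / (shift k (- step n) t - z))) \<longlonglongrightarrow>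
      integral {0..1} (\<lambda>t. h (\<Gamma> k t) * \<Gamma>' k t / (\<Gamma> k t - z))" if k: "k < K" for k
  proof (rule dominated_convergence(2)[where h = "\<lambda>_. B * V / d"])
    show b: "norm (h (\<Gamma> k t) * \<Gamma>' k t / (shift k (- step n) t - z)) \<le> B * V / d" for n t
      unfolding norm_mult norm_divide
      using Bf[OF k, of t] V(2)[OF k, of t] far[OF k, of n t] B(1) V(1) d(1) by (intro frac_le mult_mono) auto
    show "(\<lambda>t. h (\<Gamma> k t) * \<Gamma>' k t / (shift k (- step n) t - z)) integrable_on {0..1}" for n
    proof (rule integrable_bounded[OF _ b])
      show "(\<lambda>t. h (\<Gamma> k t) * \<Gamma>' k t / (shift k (- step n) t - z)) \<in> borel_measurable borel"
        using bdd_hol_measurable[OF h k] curve_measurable[OF k] by measurable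
    qed
    fix t
    have "(\<lambda>n. shift k (- step n) t) \<longlonglongrightarrow> \<Gamma> k t"
      using tendsto_add[OF tendsto_const tendsto_scaleR[OF tendsto_minus[OF step(3)] tendsto_const], of "\<Gamma> k t" "normal k t"]
      by (simp add: shift_def)
    moreover have "\<Gamma> k t - z \<noteq> 0" using \<Gamma>_notin[OF k, of t] z by auto
    ultimately show "(\<lambda>n. h (\<Gamma> k t) * \<Gamma>' k t / (shift k (- step n) t - z)) \<longlonglongrightarrow> h (\<Gamma> k t) * \<Gamma>' k t / (\<Gamma> k t - z)"
      by (intro tendsto_intros)
  qed auto
  then have "(\<lambda>n. outer_Cauchy h (step n) z) \<longlonglongrightarrow>
      (\<Sum>k<K. \<omega> k * integral {0..1} (\<lambda>t. h (\<Gamma> k t) * \<Gamma>' k t / (\<Gamma> k t - z))) / (2 * pi * \<i>)"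
    unfolding outer_Cauchy_def by (intro tendsto_intros) auto
  then show ?thesis by (simp add: Cauchy_formula(2)[OF h z])
qed

text \<open>Each of the \<open>K\<close> curves gets an error of \<open>\<eta> / K\<close>; the
  approximants are sums of simple poles outside the closure, hence smooth up to it.\<close>

lemma outer_Cauchy_approx:
  assumes h: "bdd_hol h" and \<eta>: "\<eta> > 0"
  shows "\<exists>g. smooth_hol \<Omega> g \<and> (\<forall>z\<in>closure \<Omega>. cmod (outer_Cauchy h (step n) z - g z) \<le> \<eta>)"
proof -
  obtain B where B: "B > 0" "\<And>z. z \<in> closure \<Omega> \<Longrightarrow> cmod (h z) \<le> B" by (rule bdd_hol_bound[OF h]) (rule that)
  have Bf: "cmod (h (\<Gamma> k t)) \<le> B" if "k < K" for k t
    using \<Gamma>_in_frontier[OF that] by (intro B(2)) (auto simp: frontier_def)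
  obtain V where V: "V > 0" "\<And>k t. k < K \<Longrightarrow> cmod (\<Gamma>' k t) \<le> V" using speed_bounded by blast
  have Kpos: "K > 0" using dom unfolding smooth_bounded_domain_def by simp
  have "\<exists>N c s. (\<forall>j<N. s j \<in> {0..1}) \<and> (\<forall>z\<in>closure \<Omega>. cmod (integral {0..1} (\<lambda>t. h (\<Gamma> k t) * \<Gamma>' k t / (shift k (- step n) t - z))
      - (\<Sum>j<(N::nat). c j / (shift k (- step n) (s j) - z))) \<le> \<eta> / K)" if k: "k < K" for k
  proof -
    have "compact (shift k (- step n) ` {0..1})" by (intro compact_continuous_image cont_curve k compact_Icc)
    moreover have "shift k (- step n) ` {0..1} \<inter> closure \<Omega> = {}" using shift_notin[OF k step(1,2)] by blast
    ultimately obtain \<delta> where \<delta>: "\<delta> > 0" "\<forall>x\<in>shift k (- step n) ` {0..1}. \<forall>y\<in>closure \<Omega>. \<delta> \<le> dist x y"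
      using separate_compact_closed[OF _ closed_closure] by blast
    show ?thesis
    proof (rule Cauchy_transform_approx_by_poles[where M = "B * V" and \<delta> = \<delta>])
      show "(\<lambda>t. h (\<Gamma> k t) * \<Gamma>' k t) \<in> borel_measurable borel"
        using bdd_hol_measurable[OF h k] curve_measurable[OF k] by measurable
      show "cmod (h (\<Gamma> k t) * \<Gamma>' k t) \<le> B * V" for t
        unfolding norm_mult using Bf[OF k, of t] V(2)[OF k, of t] B(1) by (intro mult_mono) auto
    qed (use \<delta> \<eta> Kpos cont_curve[OF k] in \<open>auto simp: dist_norm\<close>)
  qed
  then have "\<forall>k. \<exists>N c s. k < K \<longrightarrow> (\<forall>z\<in>closure \<Omega>. cmod (integral {0..1} (\<lambda>t. h (\<Gamma> k t) * \<Gamma>' k t / (shift k (- step n) t - z))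
      - (\<Sum>j<(N::nat). c j / (shift k (- step n) (s j) - z))) \<le> \<eta> / K)" by blast
  then obtain N c s where P: "\<And>k z. k < K \<Longrightarrow> z \<in> closure \<Omega> \<Longrightarrow> cmod (integral {0..1} (\<lambda>t. h (\<Gamma> k t) * \<Gamma>' k t / (shift k (- step n) t - z))
      - (\<Sum>j<(N k::nat). c k j / (shift k (- step n) (s k j) - z))) \<le> \<eta> / K"
    unfolding choice_iff by blast
  \<comment> \<open>The minus sign turns the denominators \<open>b - z\<close> of the Cauchy kernel
    into \<open>z - b\<close>.\<close>
  define g where "g z = (\<Sum>(k, j)\<in>Sigma {..<K} (\<lambda>k. {..<N k}). (- \<omega> k * c k j / (2 * pi * \<i>)) / (z - shift k (- step n) (s k j)))" for z
  have sg: "smooth_hol \<Omega> g"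
    unfolding g_def case_prod_beta'
    using shift_notin[OF _ step(1,2)] by (intro smooth_hol_sum_poles finite_SigmaI) auto
  have g_eq: "g z = (\<Sum>k<K. \<omega> k * (\<Sum>j<N k. c k j / (shift k (- step n) (s k j) - z))) / (2 * pi * \<i>)" for z
  proof -
    have "g z = (\<Sum>k<K. \<Sum>j<N k. (- \<omega> k * c k j / (2 * pi * \<i>)) / (z - shift k (- step n) (s k j)))"
      unfolding g_def by (rule sum.Sigma[symmetric]) auto
    also have "\<dots> = (\<Sum>k<K. \<Sum>j<N k. \<omega> k * (c k j / (shift k (- step n) (s k j) - z)) / (2 * pi * \<i>))"
      by (intro sum.cong refl) (simp add: divide_simps, simp add: algebra_simps)
    finally show ?thesis by (simp add: sum_distrib_left sum_divide_distrib)
  qed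
  have "cmod (outer_Cauchy h (step n) z - g z) \<le> \<eta>" if z: "z \<in> closure \<Omega>" for z
  proof -
    have "outer_Cauchy h (step n) z - g z = (\<Sum>k<K. \<omega> k * (integral {0..1} (\<lambda>t. h (\<Gamma> k t) * \<Gamma>' k t / (shift k (- step n) t - z))
      - (\<Sum>j<N k. c k j / (shift k (- step n) (s k j) - z)))) / (2 * pi * \<i>)"
      unfolding outer_Cauchy_def g_eq by (simp only: diff_divide_distrib[symmetric] right_diff_distrib sum_subtractf)
    also have "cmod \<dots> \<le> (\<Sum>k<K. \<eta> / K) / (2 * pi)"
    proof -
      have "cmod (\<Sum>k<K. \<omega> k * (integral {0..1} (\<lambda>t. h (\<Gamma> k t) * \<Gamma>' k t / (shift k (- step n) t - z))
      - (\<Sum>j<N k. c k j / (shift k (- step n) (s k j) - z)))) \<le> (\<Sum>k<K. \<eta> / K)"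
        using P z orientation by (intro sum_norm_le) (force simp: norm_mult)
      then show ?thesis by (simp add: norm_divide norm_mult divide_right_mono)
    qed
    also have "\<dots> \<le> \<eta> / 1" using Kpos \<eta> pi_gt3 by (simp only: sum_constant) (intro frac_le, auto)
    finally show ?thesis by simp
  qed
  then show ?thesis using sg by blast
qed

text \<open>Pointwise convergence on the closure with a common bound on the boundary is the form
  that dominated convergence turns into convergence in square mean.\<close>

lemma bdd_hol_approx:
  assumes h: "bdd_hol h"
  obtains g M where "\<And>n. smooth_hol \<Omega> (g n)" "\<And>n k t. k < K \<Longrightarrow> cmod (g n (\<Gamma> k t)) \<le> M"
    "\<And>z. z \<in> closure \<Omega> \<Longrightarrow> (\<lambda>n. g n z) \<longlonglongrightarrow> h z"
proof -
  have "\<forall>n. \<exists>g. smooth_hol \<Omega> g \<and> (\<forall>z\<in>closure \<Omega>. cmod (outer_Cauchy h (step n) z - g z) \<le> inverse (real (Suc n)))"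
    by (intro allI outer_Cauchy_approx[OF h]) simp
  then obtain g where g: "\<And>n. smooth_hol \<Omega> (g n)"
    "\<And>n z. z \<in> closure \<Omega> \<Longrightarrow> cmod (outer_Cauchy h (step n) z - g n z) \<le> inverse (real (Suc n))" by metis
  show ?thesis
  proof (rule outer_Cauchy_boundary[OF h], goal_cases)
    case (1 M)
    show ?thesis
    proof (rule that[of g "M + 1"])
      show "smooth_hol \<Omega> (g n)" for n by (rule g)
      fix n k t assume k: "k < K"
      have "\<Gamma> k t \<in> closure \<Omega>" using \<Gamma>_in_frontier[OF k] by (simp add: frontier_def)
      then have "cmod (outer_Cauchy h (step n) (\<Gamma> k t) - g n (\<Gamma> k t)) \<le> inverse (real (Suc n))" by (rule g)
      moreover have "inverse (real (Suc n)) \<le> 1" by (simp add: field_simps)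
      moreover have "cmod (g n (\<Gamma> k t)) \<le> cmod (outer_Cauchy h (step n) (\<Gamma> k t)) + cmod (outer_Cauchy h (step n) (\<Gamma> k t) - g n (\<Gamma> k t))"
        by (metis norm_minus_commute norm_triangle_sub)
      ultimately show "cmod (g n (\<Gamma> k t)) \<le> M + 1" using 1(1)[OF k, of n t] by linarith
    next
      fix z assume z: "z \<in> closure \<Omega>"
      have "(\<lambda>n. outer_Cauchy h (step n) z) \<longlonglongrightarrow> h z"
      proof (cases "z \<in> \<Omega>")
        case True
        then show ?thesis by (rule outer_Cauchy_interior[OF h])
      next
        case False
        then obtain l s where "l < K" "z = \<Gamma> l s" using z unfolding closure_Un_frontier frontier_ranges by blast
        then show ?thesis using 1(2) by blast
      qed
      moreover have "(\<lambda>n. outer_Cauchy h (step n) z - g n z) \<longlonglongrightarrow> 0"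
        by (rule Lim_null_comparison[OF eventuallyI LIMSEQ_inverse_real_of_nat]) (use g(2)[OF z] in simp)
      ultimately have "(\<lambda>n. outer_Cauchy h (step n) z - (outer_Cauchy h (step n) z - g n z)) \<longlonglongrightarrow> h z - 0"
        by (rule tendsto_diff)
      then show "(\<lambda>n. g n z) \<longlonglongrightarrow> h z" by simp
    qed
  qed
qed

end

subsection \<open>The Hardy space\<close>

lemma smooth_lincomb:
  fixes f g :: "complex \<Rightarrow> complex"
  assumes "smooth f" "smooth g"
  shows "smooth (\<lambda>x. a * f x + b * g x)"
proof (rule smooth_coinduct)
  show "\<exists>u v. smooth u \<and> smooth v \<and> (\<lambda>x. a * f x + b * g x) = (\<lambda>x. a * u x + b * v x)"
    using assms by blast
  fix h :: "complex \<Rightarrow> complex" assume "\<exists>u v. smooth u \<and> smooth v \<and> h = (\<lambda>x. a * u x + b * v x)"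
  then obtain u v where uv: "smooth u" "smooth v" "h = (\<lambda>x. a * u x + b * v x)" by blast
  have D: "(p has_derivative frechet_derivative p (at x)) (at x)" "smooth (\<lambda>x. frechet_derivative p (at x) w)"
    if "smooth p" for p :: "complex \<Rightarrow> complex" and x w
  proof -
    show "smooth (\<lambda>x. frechet_derivative p (at x) w)"
      unfolding smooth_def using smooth_imp_Ck[OF that, of "Suc _"] by simp
    show "(p has_derivative frechet_derivative p (at x)) (at x)"
      using smooth_imp_Ck[OF that, of "Suc 0"] frechet_derivative_works by auto
  qed
  show "\<exists>D. (\<forall>x. (h has_derivative D x) (at x)) \<and>
      (\<forall>w. \<exists>u v. smooth u \<and> smooth v \<and> (\<lambda>x. D x w) = (\<lambda>x. a * u x + b * v x))"
  proof (intro exI conjI allI)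
    show "(h has_derivative (\<lambda>w. a * frechet_derivative u (at x) w + b * frechet_derivative v (at x) w)) (at x)" for x
      unfolding uv(3)
      by (rule has_derivative_add[OF has_derivative_mult_right[OF D(1)[OF uv(1)]] has_derivative_mult_right[OF D(1)[OF uv(2)]]])
    show "(\<lambda>x. a * frechet_derivative u (at x) w + b * frechet_derivative v (at x) w) =
       (\<lambda>x. a * frechet_derivative u (at x) w + b * frechet_derivative v (at x) w)" for w ..
    show "smooth (\<lambda>x. frechet_derivative u (at x) w)" "smooth (\<lambda>x. frechet_derivative v (at x) w)" for w
      using D(2)[OF uv(1)] D(2)[OF uv(2)] by simp_all
  qed
qed

lemma smooth_hol_lincomb:
  assumes "smooth_hol \<Omega> f" "smooth_hol \<Omega> g"
  shows "smooth_hol \<Omega> (\<lambda>z. a * f z + b * g z)"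
proof -
  obtain F G where "smooth F" "smooth G" "\<forall>z\<in>closure \<Omega>. F z = f z" "\<forall>z\<in>closure \<Omega>. G z = g z"
    using assms unfolding smooth_hol_def by blast
  then have "smooth (\<lambda>z. a * F z + b * G z)" "\<forall>z\<in>closure \<Omega>. a * F z + b * G z = a * f z + b * g z"
    using smooth_lincomb by auto
  moreover have "(\<lambda>z. a * f z + b * g z) holomorphic_on \<Omega>"
    using assms unfolding smooth_hol_def by (intro holomorphic_intros) auto
  ultimately show ?thesis
    unfolding smooth_hol_def by (intro conjI exI[of _ "\<lambda>z. a * F z + b * G z"])
qed

text \<open>With its free parameter \<eta>, this takes the place of the Cauchy-Schwarz inequality
  when integrals are estimated by square norms.\<close>

lemma real_le_add_square_div:
  fixes x \<eta> :: real
  assumes "\<eta> > 0" "x \<ge> 0"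
  shows "x \<le> \<eta> + x\<^sup>2 / \<eta>"
proof (cases "x \<le> \<eta>")
  case True
  then show ?thesis using assms by (simp add: add_increasing2)
next
  case False
  then have "x * \<eta> \<le> x\<^sup>2" using assms by (simp add: power2_eq_square mult_left_mono)
  then have "x \<le> x\<^sup>2 / \<eta>" using assms by (simp add: pos_le_divide_eq)
  then show ?thesis using assms by linarith
qed

lemma LIMSEQ_squeeze_0:
  fixes a b :: "nat \<Rightarrow> real"
  assumes "\<And>n. a n \<le> b n" "b \<longlonglongrightarrow> 0" "\<And>n. 0 \<le> a n"
  shows "a \<longlonglongrightarrow> 0"
  by (rule tendsto_sandwich[OF _ _ tendsto_const assms(2)]) (use assms in \<open>auto intro: always_eventually\<close>)

lemma cmod_add_square_le: "(cmod (a + b))\<^sup>2 \<le> 2 * (cmod a)\<^sup>2 + 2 * (cmod b)\<^sup>2"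
proof -
  have "(cmod (a + b))\<^sup>2 \<le> (cmod a + cmod b)\<^sup>2" by (intro power_mono norm_triangle_ineq) simp
  also have "\<dots> \<le> 2 * (cmod a)\<^sup>2 + 2 * (cmod b)\<^sup>2"
    using zero_le_power2[of "cmod a - cmod b"] unfolding power2_diff power2_sum by linarith
  finally show ?thesis .
qed

section \<open>Square norms on the boundary and point evaluations\<close>

context tubular
begin

lemma frontier_eq_\<Gamma>: "(\<forall>z\<in>frontier \<Omega>. P z) \<longleftrightarrow> (\<forall>k<K. \<forall>t. P (\<Gamma> k t))"
  unfolding frontier_ranges by blast

lemma bL2_alt:
  "bL2 K \<Gamma> F \<longleftrightarrow> (\<forall>k<K. (\<lambda>t. F (\<Gamma> k t)) \<in> borel_measurable borel \<and>
     set_integrable lborel {0..1} (\<lambda>t. (cmod (F (\<Gamma> k t)))\<^sup>2))"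
  unfolding bL2_def by simp

lemma set_integrable_real_bound:
  fixes f g :: "real \<Rightarrow> 'a::{banach, second_countable_topology}"
  assumes "set_integrable lborel A F" "g \<in> borel_measurable borel" "A \<in> sets borel"
    "\<And>t. t \<in> A \<Longrightarrow> norm (g t) \<le> (F t :: real)"
  shows "set_integrable lborel A g"
  unfolding set_integrable_def
proof (rule Bochner_Integration.integrable_bound[OF assms(1)[unfolded set_integrable_def]])
  show "(\<lambda>x. indicat_real A x *\<^sub>R g x) \<in> borel_measurable lborel" using assms(2,3) by measurable
  show "AE x in lborel. norm (indicat_real A x *\<^sub>R g x) \<le> norm (indicat_real A x *\<^sub>R F x)"
    using assms(4) by (intro always_eventually allI) (auto simp: indicator_def intro: order_trans[OF _ abs_ge_self])
qed

lemma bL2_cong: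
  assumes "bL2 K \<Gamma> F" "\<And>z. z \<in> frontier \<Omega> \<Longrightarrow> F z = G z"
  shows "bL2 K \<Gamma> G"
  using assms \<Gamma>_in_frontier unfolding bL2_def by auto

lemma bL2_add:
  assumes "bL2 K \<Gamma> F" "bL2 K \<Gamma> G"
  shows "bL2 K \<Gamma> (\<lambda>z. F z + G z)"
  unfolding bL2_alt
proof (intro allI impI conjI)
  fix k assume k: "k < K"
  have FG: "(\<lambda>t. F (\<Gamma> k t)) \<in> borel_measurable borel" "(\<lambda>t. G (\<Gamma> k t)) \<in> borel_measurable borel"
    "set_integrable lborel {0..1} (\<lambda>t. (cmod (F (\<Gamma> k t)))\<^sup>2)" "set_integrable lborel {0..1} (\<lambda>t. (cmod (G (\<Gamma> k t)))\<^sup>2)"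
    using assms k unfolding bL2_alt by auto
  show 1: "(\<lambda>t. F (\<Gamma> k t) + G (\<Gamma> k t)) \<in> borel_measurable borel" using FG by measurable
  show "set_integrable lborel {0..1} (\<lambda>t. (cmod (F (\<Gamma> k t) + G (\<Gamma> k t)))\<^sup>2)"
  proof (rule set_integrable_real_bound)
    show "set_integrable lborel {0..1} (\<lambda>t. 2 * (cmod (F (\<Gamma> k t)))\<^sup>2 + 2 * (cmod (G (\<Gamma> k t)))\<^sup>2)"
      using FG(3,4) by (intro set_integral_add set_integrable_mult_right)
    show "(\<lambda>t. (cmod (F (\<Gamma> k t) + G (\<Gamma> k t)))\<^sup>2) \<in> borel_measurable borel" using FG by measurable
  qed (use cmod_add_square_le in auto)
qed

lemma bL2_mult:
  assumes "bL2 K \<Gamma> F" "\<And>k. k < K \<Longrightarrow> (\<lambda>t. u (\<Gamma> k t)) \<in> borel_measurable borel"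
    "\<And>k t. k < K \<Longrightarrow> cmod (u (\<Gamma> k t)) \<le> B"
  shows "bL2 K \<Gamma> (\<lambda>z. u z * F z)"
  unfolding bL2_alt
proof (intro allI impI conjI)
  fix k assume k: "k < K"
  have F: "(\<lambda>t. F (\<Gamma> k t)) \<in> borel_measurable borel"
    "set_integrable lborel {0..1} (\<lambda>t. (cmod (F (\<Gamma> k t)))\<^sup>2)"
    using assms k unfolding bL2_alt by auto
  note u = assms(2)[OF k] assms(3)[OF k]
  show "(\<lambda>t. u (\<Gamma> k t) * F (\<Gamma> k t)) \<in> borel_measurable borel" using F u by measurable
  show "set_integrable lborel {0..1} (\<lambda>t. (cmod (u (\<Gamma> k t) * F (\<Gamma> k t)))\<^sup>2)"
  proof (rule set_integrable_real_bound)
    show "set_integrable lborel {0..1} (\<lambda>t. B\<^sup>2 * (cmod (F (\<Gamma> k t)))\<^sup>2)"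
      using F(2) by (intro set_integrable_mult_right)
    show "(\<lambda>t. (cmod (u (\<Gamma> k t) * F (\<Gamma> k t)))\<^sup>2) \<in> borel_measurable borel" using F u by measurable
    show "norm ((cmod (u (\<Gamma> k t) * F (\<Gamma> k t)))\<^sup>2) \<le> B\<^sup>2 * (cmod (F (\<Gamma> k t)))\<^sup>2" for t
      using u(2)[of t] by (simp add: norm_mult power_mult_distrib mult_right_mono power_mono)
  qed simp
qed

lemma bL2_cmult: "bL2 K \<Gamma> F \<Longrightarrow> bL2 K \<Gamma> (\<lambda>z. c * F z)"
  by (rule bL2_mult[where B = "cmod c"]) auto

lemma bL2_diff: "bL2 K \<Gamma> F \<Longrightarrow> bL2 K \<Gamma> G \<Longrightarrow> bL2 K \<Gamma> (\<lambda>z. F z - G z)"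
  using bL2_add[of F "\<lambda>z. -1 * G z"] bL2_cmult[of G "-1"] by simp

lemma bdd_hol_bL2:
  assumes "bdd_hol h"
  shows "bL2 K \<Gamma> h"
proof -
  obtain B where B: "\<And>z. z \<in> closure \<Omega> \<Longrightarrow> cmod (h z) \<le> B" by (rule bdd_hol_bound[OF assms]) (rule that)
  have one: "bL2 K \<Gamma> (\<lambda>_. 1)" unfolding bL2_alt by (simp add: set_integrable_def)
  show ?thesis
    using bL2_mult[OF one bdd_hol_measurable[OF assms], where B = B] B \<Gamma>_in_frontier
    by (simp add: frontier_def)
qed

text \<open>The square of the L2 norm with respect to arc length. Working with squares avoids roots,
  at the price of a factor 2 in the triangle inequality.\<close>

definition sqn :: "(complex \<Rightarrow> complex) \<Rightarrow> real" where
  "sqn U = (\<Sum>k<K. LINT t:{0..1}|lborel. (cmod (U (\<Gamma> k t)))\<^sup>2 * cmod (\<Gamma>' k t))"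

lemma sqn_integrable:
  assumes "bL2 K \<Gamma> U" "k < K"
  shows "set_integrable lborel {0..1} (\<lambda>t. (cmod (U (\<Gamma> k t)))\<^sup>2 * cmod (\<Gamma>' k t))"
proof -
  obtain V where V: "V > 0" "\<And>t. cmod (\<Gamma>' k t) \<le> V" using speed_bounded assms(2) by blast
  have U: "(\<lambda>t. U (\<Gamma> k t)) \<in> borel_measurable borel" "set_integrable lborel {0..1} (\<lambda>t. (cmod (U (\<Gamma> k t)))\<^sup>2)"
    using assms unfolding bL2_alt by auto
  show ?thesis
  proof (rule set_integrable_real_bound)
    show "set_integrable lborel {0..1} (\<lambda>t. V * (cmod (U (\<Gamma> k t)))\<^sup>2)"
      using U(2) by (intro set_integrable_mult_right)
    show "(\<lambda>t. (cmod (U (\<Gamma> k t)))\<^sup>2 * cmod (\<Gamma>' k t)) \<in> borel_measurable borel"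
      using U(1) curve_measurable[OF assms(2)] by measurable
    show "norm ((cmod (U (\<Gamma> k t)))\<^sup>2 * cmod (\<Gamma>' k t)) \<le> V * (cmod (U (\<Gamma> k t)))\<^sup>2" for t
      using V(2)[of t] by (simp add: mult.commute mult_right_mono)
  qed simp
qed

lemma sqn_nonneg: "sqn U \<ge> 0"
  unfolding sqn_def set_lebesgue_integral_def by (intro sum_nonneg Bochner_Integration.integral_nonneg) auto

lemma sqn_mono:
  assumes "bL2 K \<Gamma> F" "bL2 K \<Gamma> G" "bL2 K \<Gamma> U"
    "\<And>z. z \<in> frontier \<Omega> \<Longrightarrow> (cmod (U z))\<^sup>2 \<le> a * (cmod (F z))\<^sup>2 + b * (cmod (G z))\<^sup>2"
  shows "sqn U \<le> a * sqn F + b * sqn G"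
proof -
  let ?i = "\<lambda>F k t. (cmod (F (\<Gamma> k t)))\<^sup>2 * cmod (\<Gamma>' k t)"
  have "(LINT t:{0..1}|lborel. ?i U k t) \<le> a * (LINT t:{0..1}|lborel. ?i F k t) + b * (LINT t:{0..1}|lborel. ?i G k t)"
    if k: "k < K" for k
  proof -
    note i = sqn_integrable[OF assms(1) k] sqn_integrable[OF assms(2) k]
    have i': "set_integrable lborel {0..1} (\<lambda>t. a * ?i F k t)" "set_integrable lborel {0..1} (\<lambda>t. b * ?i G k t)"
      using i by (auto intro: set_integrable_mult_right)
    have "(LINT t:{0..1}|lborel. ?i U k t) \<le> (LINT t:{0..1}|lborel. a * ?i F k t + b * ?i G k t)"
    proof (rule set_integral_mono[OF sqn_integrable[OF assms(3) k] set_integral_add(1)[OF i']])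
      fix t
      have "?i U k t \<le> (a * (cmod (F (\<Gamma> k t)))\<^sup>2 + b * (cmod (G (\<Gamma> k t)))\<^sup>2) * cmod (\<Gamma>' k t)"
        using assms(4)[OF \<Gamma>_in_frontier[OF k]] by (intro mult_right_mono) auto
      then show "?i U k t \<le> a * ?i F k t + b * ?i G k t" by (simp add: algebra_simps)
    qed
    then show ?thesis by (simp only: set_integral_add(2)[OF i'] set_integral_mult_right)
  qed
  then have "sqn U \<le> (\<Sum>k<K. a * (LINT t:{0..1}|lborel. ?i F k t) + b * (LINT t:{0..1}|lborel. ?i G k t))"
    unfolding sqn_def by (intro sum_mono) auto
  then show ?thesis by (simp add: sqn_def sum.distrib sum_distrib_left)
qed

lemma sqn_add_le:
  assumes "bL2 K \<Gamma> F" "bL2 K \<Gamma> G"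
  shows "sqn (\<lambda>z. F z + G z) \<le> 2 * sqn F + 2 * sqn G"
  by (rule sqn_mono[OF assms bL2_add[OF assms] cmod_add_square_le])

lemma sqn_cong:
  assumes "\<And>z. z \<in> frontier \<Omega> \<Longrightarrow> cmod (F z) = cmod (G z)"
  shows "sqn F = sqn G"
  unfolding sqn_def using assms \<Gamma>_in_frontier by simp

lemma sqn_triangle:
  assumes "bL2 K \<Gamma> F" "bL2 K \<Gamma> G" "bL2 K \<Gamma> H"
  shows "sqn (\<lambda>z. F z - G z) \<le> 2 * sqn (\<lambda>z. F z - H z) + 2 * sqn (\<lambda>z. G z - H z)"
proof -
  have "sqn (\<lambda>z. F z - G z) = sqn (\<lambda>z. (F z - H z) + (H z - G z))" by (rule sqn_cong) simp
  also have "\<dots> \<le> 2 * sqn (\<lambda>z. F z - H z) + 2 * sqn (\<lambda>z. H z - G z)"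
    using assms by (intro sqn_add_le bL2_diff)
  also have "sqn (\<lambda>z. H z - G z) = sqn (\<lambda>z. G z - H z)" by (rule sqn_cong) (rule norm_minus_commute)
  finally show ?thesis .
qed

lemma bint_square: "bint K \<Gamma> (\<lambda>\<zeta>. of_real ((cmod (U \<zeta>))\<^sup>2)) = of_real (sqn U)"
  unfolding bint_def sqn_def of_real_sum
  by (intro sum.cong refl) (simp only: of_real_mult[symmetric] set_integral_complex_of_real)

lemma hardy_alt:
  "hardy \<Omega> K \<Gamma> H \<longleftrightarrow> H holomorphic_on \<Omega> \<and> bL2 K \<Gamma> H \<and>
     (\<exists>g. (\<forall>n. smooth_hol \<Omega> (g n)) \<and> (\<lambda>n. sqn (\<lambda>z. g n z - H z)) \<longlonglongrightarrow> 0 \<and> (\<forall>z\<in>\<Omega>. (\<lambda>n. g n z) \<longlonglongrightarrow> H z))"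
proof -
  have "(\<lambda>n. complex_of_real (a n)) \<longlonglongrightarrow> 0 \<longleftrightarrow> a \<longlonglongrightarrow> 0" for a
    using tendsto_of_real_iff[of a 0 sequentially, where 'a = complex] by simp
  then show ?thesis
    unfolding hardy_def bint_square[of "\<lambda>z. _ z - _ z"] by simp
qed

lemma smooth_hol_bdd_hol:
  assumes "smooth_hol \<Omega> g"
  shows "bdd_hol g"
proof -
  obtain G where G: "smooth G" "\<And>z. z \<in> closure \<Omega> \<Longrightarrow> G z = g z" and hol: "g holomorphic_on \<Omega>"
    using assms unfolding smooth_hol_def by blast
  have cont: "continuous_on UNIV G" using smooth_imp_continuous[OF G(1)] .
  have "compact (G ` closure \<Omega>)"
    using \<Omega>(4) by (intro compact_continuous_image continuous_on_subset[OF cont]) (auto simp: compact_closure)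
  then have "bounded (G ` closure \<Omega>)" by (rule compact_imp_bounded)
  then obtain B where B: "\<And>z. z \<in> closure \<Omega> \<Longrightarrow> cmod (G z) \<le> B"
    by (auto simp: bounded_iff)
  show ?thesis
    unfolding bdd_hol_def
  proof (intro conjI exI[of _ B] ballI allI impI hol)
    show "cmod (g z) \<le> B" if "z \<in> \<Omega>" for z using B[of z] G(2)[of z] closure_subset that by fastforce
    fix k t assume k: "k < K"
    have "((\<lambda>e. shift k e t) \<longlongrightarrow> shift k 0 t) (at_right 0)"
      unfolding shift_def by (intro tendsto_intros)
    moreover have "isCont G (\<Gamma> k t)" using cont by (simp add: continuous_on_eq_continuous_at)
    ultimately have "((\<lambda>e. G (shift k e t)) \<longlongrightarrow> G (\<Gamma> k t)) (at_right 0)"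
      by (simp add: isCont_tendsto_compose[of _ G])
    moreover have "G (\<Gamma> k t) = g (\<Gamma> k t)" using \<Gamma>_in_frontier[OF k] by (intro G(2)) (simp add: frontier_def)
    moreover have "\<forall>\<^sub>F e in at_right 0. G (shift k e t) = g (shift k e t)"
      using eventually_at_right_real[OF r]
      by eventually_elim (use shift_in[OF k] in \<open>auto intro!: G(2) subsetD[OF closure_subset]\<close>)
    ultimately show "((\<lambda>e. g (shift k e t)) \<longlongrightarrow> g (\<Gamma> k t)) (at_right 0)"
      by (simp add: tendsto_cong)
  qed
qed

lemma bdd_hol_const: "bdd_hol (\<lambda>_. c)"
  unfolding bdd_hol_def by auto

lemma bdd_hol_mult:
  assumes "bdd_hol f" "bdd_hol g"
  shows "bdd_hol (\<lambda>z. f z * g z)"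
proof -
  obtain B where B: "B > 0" "\<And>z. z \<in> closure \<Omega> \<Longrightarrow> cmod (f z) \<le> B" by (rule bdd_hol_bound[OF assms(1)]) (rule that)
  obtain B' where B': "B' > 0" "\<And>z. z \<in> closure \<Omega> \<Longrightarrow> cmod (g z) \<le> B'" by (rule bdd_hol_bound[OF assms(2)]) (rule that)
  have "cmod (f z * g z) \<le> B * B'" if "z \<in> \<Omega>" for z
    using that closure_subset B B' by (auto simp: norm_mult intro!: mult_mono)
  then show ?thesis
    using assms unfolding bdd_hol_def by (auto intro!: holomorphic_intros tendsto_intros)
qed

text \<open>Near \<open>a\<close> the quotient is holomorphic on a neighbourhood of a compact disc,
  farther away the denominator is bounded below, and normal limits are inherited since no boundary
  point equals \<open>a\<close>. It is applied to approximants when a zero is divided out.\<close>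

lemma bdd_hol_difference_quotient:
  assumes g: "bdd_hol g" and a: "a \<in> \<Omega>"
  shows "bdd_hol (\<lambda>z. if z = a then deriv g a else (g z - g a) / (z - a))" (is "bdd_hol ?q")
proof -
  obtain B where B: "B > 0" "\<And>z. z \<in> closure \<Omega> \<Longrightarrow> cmod (g z) \<le> B" by (rule bdd_hol_bound[OF g]) (rule that)
  have hol: "?q holomorphic_on \<Omega>" using g \<Omega>(1) by (intro pole_lemma_open) (simp_all add: bdd_hol_def)
  obtain d where d: "d > 0" "cball a d \<subseteq> \<Omega>" using a \<Omega>(1) open_contains_cball by blast
  have "compact (?q ` cball a d)"
    by (intro compact_continuous_image holomorphic_on_imp_continuous_on holomorphic_on_subset[OF hol] d) auto
  then have "bounded (?q ` cball a d)" by (rule compact_imp_bounded)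
  then obtain B' where B': "\<And>z. z \<in> cball a d \<Longrightarrow> cmod (?q z) \<le> B'"
    by (fastforce simp: bounded_iff)
  have "cmod (?q z) \<le> max B' (2 * B / d)" if z: "z \<in> \<Omega>" for z
  proof (cases "z \<in> cball a d")
    case False
    then have "d < cmod (z - a)" by (simp add: dist_norm norm_minus_commute)
    moreover have "cmod (g z - g a) \<le> 2 * B"
      using norm_triangle_ineq4[of "g z" "g a"] B(2)[of z] B(2)[of a] z a closure_subset[of \<Omega>] by fastforce
    ultimately have "cmod ((g z - g a) / (z - a)) \<le> 2 * B / d"
      unfolding norm_divide using d B by (intro frac_le) auto
    moreover have "z \<noteq> a" using False d by auto
    ultimately show ?thesis by (simp add: le_max_iff_disj)
  qed (use B' in \<open>simp add: le_max_iff_disj\<close>)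
  moreover have "((\<lambda>e. ?q (shift k e t)) \<longlongrightarrow> ?q (\<Gamma> k t)) (at_right 0)" if k: "k < K" for k t
  proof -
    have ne: "\<Gamma> k t \<noteq> a" using \<Gamma>_notin[OF k] a by blast
    have s: "((\<lambda>e. shift k e t) \<longlongrightarrow> \<Gamma> k t) (at_right 0)"
      unfolding shift_def by (auto intro!: tendsto_eq_intros)
    have "\<forall>\<^sub>F e in at_right 0. shift k e t \<noteq> a" using tendsto_imp_eventually_ne[OF s ne] .
    then have "\<forall>\<^sub>F e in at_right 0. (g (shift k e t) - g a) / (shift k e t - a) = ?q (shift k e t)"
      by eventually_elim simp
    moreover have "((\<lambda>e. (g (shift k e t) - g a) / (shift k e t - a)) \<longlongrightarrow> (g (\<Gamma> k t) - g a) / (\<Gamma> k t - a)) (at_right 0)"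
      using g k s ne unfolding bdd_hol_def by (intro tendsto_intros) auto
    ultimately show ?thesis using ne by (simp add: tendsto_cong)
  qed
  ultimately show ?thesis using hol unfolding bdd_hol_def by blast
qed

text \<open>The Cauchy formula with kernel at most \<open>1 / d\<close>, combined with
  \<open>x \<le> \<eta> + x\<^sup>2 / \<eta>\<close> under the integral. The constant is the
  boundary length plus 1, the summand serving positivity and the coefficient of
  \<open>sqn g\<close>.\<close>

lemma pointwise_bound:
  obtains c where "c > 0" "\<And>g w d \<eta>. bdd_hol g \<Longrightarrow> d > 0 \<Longrightarrow> ball w d \<subseteq> \<Omega> \<Longrightarrow> \<eta> > 0 \<Longrightarrow>
    cmod (g w) \<le> c / d * (\<eta> + sqn g / \<eta>)"
proof -
  define len where "len = sqn (\<lambda>_. 1)"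
  have len: "len \<ge> 0" unfolding len_def by (rule sqn_nonneg)
  show ?thesis
  proof (rule that[of "len + 1"])
    show "len + 1 > 0" using len by simp
    fix g w and d \<eta> :: real
    assume g: "bdd_hol g" and d: "d > 0" "ball w d \<subseteq> \<Omega>" and \<eta>: "\<eta> > 0"
    have w: "w \<in> \<Omega>" using d by auto
    have b: "bL2 K \<Gamma> g" "bL2 K \<Gamma> (\<lambda>_. 1)" using bdd_hol_bL2 g bdd_hol_const by auto
    let ?i = "\<lambda>g k t. (cmod (g (\<Gamma> k t)))\<^sup>2 * cmod (\<Gamma>' k t)"
    have far: "d \<le> cmod (\<Gamma> k t - w)" if "k < K" for k t
      using \<Gamma>_notin[OF that, of t] d(2) by (auto simp: subset_eq dist_norm norm_minus_commute not_less[symmetric])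
    have "cmod (integral {0..1} (\<lambda>t. g (\<Gamma> k t) * \<Gamma>' k t / (\<Gamma> k t - w)))
        \<le> (\<eta> / d) * (LINT t:{0..1}|lborel. ?i (\<lambda>_. 1) k t) + (1 / (\<eta> * d)) * (LINT t:{0..1}|lborel. ?i g k t)" if k: "k < K" for k
    proof -
      have i: "set_integrable lborel {0..1} (\<lambda>t. (\<eta> / d) * ?i (\<lambda>_. 1) k t)" "set_integrable lborel {0..1} (\<lambda>t. (1 / (\<eta> * d)) * ?i g k t)"
        using sqn_integrable[OF b(1) k] sqn_integrable[OF b(2) k] by (auto intro: set_integrable_mult_right)
      note s = set_integral_add(1)[OF i]
      have "cmod (integral {0..1} (\<lambda>t. g (\<Gamma> k t) * \<Gamma>' k t / (\<Gamma> k t - w)))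
         \<le> integral {0..1} (\<lambda>t. (\<eta> / d) * ?i (\<lambda>_. 1) k t + (1 / (\<eta> * d)) * ?i g k t)"
      proof (rule integral_norm_bound_integral[OF Cauchy_formula(1)[OF g w k] set_borel_integral_eq_integral(1)[OF s]])
        fix t
        have "cmod (g (\<Gamma> k t) * \<Gamma>' k t / (\<Gamma> k t - w)) \<le> cmod (g (\<Gamma> k t)) * cmod (\<Gamma>' k t) / d"
          unfolding norm_mult norm_divide using far[OF k, of t] d(1) by (intro frac_le mult_nonneg_nonneg) auto
        also have "\<dots> \<le> (\<eta> + (cmod (g (\<Gamma> k t)))\<^sup>2 / \<eta>) * cmod (\<Gamma>' k t) / d"
          using real_le_add_square_div[OF \<eta>, of "cmod (g (\<Gamma> k t))"] d(1) by (intro divide_right_mono mult_right_mono) auto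
        also have "\<dots> = (\<eta> / d) * ?i (\<lambda>_. 1) k t + (1 / (\<eta> * d)) * ?i g k t"
          using \<eta> d(1) by (simp add: field_simps)
        finally show "cmod (g (\<Gamma> k t) * \<Gamma>' k t / (\<Gamma> k t - w)) \<le> (\<eta> / d) * ?i (\<lambda>_. 1) k t + (1 / (\<eta> * d)) * ?i g k t" .
      qed
      also have "\<dots> = (LINT t:{0..1}|lborel. (\<eta> / d) * ?i (\<lambda>_. 1) k t + (1 / (\<eta> * d)) * ?i g k t)"
        by (rule set_borel_integral_eq_integral(2)[OF s, symmetric])
      finally show ?thesis by (simp only: set_integral_add(2)[OF i] set_integral_mult_right)
    qed
    then have "cmod (\<Sum>k<K. \<omega> k * integral {0..1} (\<lambda>t. g (\<Gamma> k t) * \<Gamma>' k t / (\<Gamma> k t - w)))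
      \<le> (\<Sum>k<K. (\<eta> / d) * (LINT t:{0..1}|lborel. ?i (\<lambda>_. 1) k t) + (1 / (\<eta> * d)) * (LINT t:{0..1}|lborel. ?i g k t))"
      using orientation by (intro sum_norm_le) (force simp: norm_mult)
    also have "\<dots> = (\<eta> / d) * len + (1 / (\<eta> * d)) * sqn g"
      by (simp only: sum.distrib sum_distrib_left[symmetric] len_def sqn_def)
    finally have "2 * pi * cmod (g w) \<le> (\<eta> / d) * len + (1 / (\<eta> * d)) * sqn g"
      unfolding Cauchy_formula(2)[OF g w] by (simp add: norm_mult)
    also have "\<dots> \<le> (\<eta> / d) * (len + 1) + (1 / (\<eta> * d)) * (sqn g * (len + 1))"
      using \<eta> d(1) len sqn_nonneg[of g] by (intro add_mono mult_left_mono) (auto simp: mult_le_cancel_left1)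
    also have "\<dots> = (len + 1) / d * (\<eta> + sqn g / \<eta>)" using \<eta> d(1) by (simp add: field_simps)
    finally have "2 * pi * cmod (g w) \<le> (len + 1) / d * (\<eta> + sqn g / \<eta>)" .
    moreover have "1 * cmod (g w) \<le> 2 * pi * cmod (g w)" using pi_gt3 by (intro mult_right_mono) auto
    ultimately show "cmod (g w) \<le> (len + 1) / d * (\<eta> + sqn g / \<eta>)" by linarith
  qed
qed

lemma hardy_cong:
  assumes "hardy \<Omega> K \<Gamma> H" "\<And>z. z \<in> closure \<Omega> \<Longrightarrow> H z = H' z"
  shows "hardy \<Omega> K \<Gamma> H'"
proof -
  have eq: "\<And>z. z \<in> \<Omega> \<Longrightarrow> H z = H' z" "\<And>z. z \<in> frontier \<Omega> \<Longrightarrow> H z = H' z"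
    using assms(2) closure_subset by (auto simp: frontier_def)
  obtain g where g: "H holomorphic_on \<Omega>" "bL2 K \<Gamma> H" "\<And>n. smooth_hol \<Omega> (g n)"
    "(\<lambda>n. sqn (\<lambda>z. g n z - H z)) \<longlonglongrightarrow> 0" "\<And>z. z \<in> \<Omega> \<Longrightarrow> (\<lambda>n. g n z) \<longlonglongrightarrow> H z"
    using assms(1) unfolding hardy_alt by blast
  have "H' holomorphic_on \<Omega>" using g(1) eq(1) holomorphic_transform by blast
  moreover have "sqn (\<lambda>z. g n z - H z) = sqn (\<lambda>z. g n z - H' z)" for n
    by (rule sqn_cong) (simp add: eq(2))
  ultimately show ?thesis
    unfolding hardy_alt using g bL2_cong[OF g(2) eq(2)] eq(1) by auto
qed

lemma sqn_dominated:
  assumes u: "\<And>n. bL2 K \<Gamma> (u n)" "\<And>n k t. k < K \<Longrightarrow> cmod (u n (\<Gamma> k t)) \<le> M"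
    and lim: "\<And>k t. k < K \<Longrightarrow> (\<lambda>n. u n (\<Gamma> k t)) \<longlonglongrightarrow> 0"
  shows "(\<lambda>n. sqn (u n)) \<longlonglongrightarrow> 0"
proof -
  obtain V where V: "V > 0" "\<And>k t. k < K \<Longrightarrow> cmod (\<Gamma>' k t) \<le> V" using speed_bounded by blast
  let ?i = "\<lambda>n k t. (cmod (u n (\<Gamma> k t)))\<^sup>2 * cmod (\<Gamma>' k t)"
  have "(\<lambda>n. LINT t:{0..1}|lborel. ?i n k t) \<longlonglongrightarrow> 0" if k: "k < K" for k
  proof -
    have bound: "norm (?i n k t) \<le> M\<^sup>2 * V" for n t
      using u(2)[OF k, of n t] V(2)[OF k, of t] V(1)
      by (simp add: abs_mult mult_mono power_mono)
    have conv: "(\<lambda>n. ?i n k t) \<longlonglongrightarrow> 0" for t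
      using tendsto_mult_right[OF tendsto_power[OF tendsto_norm[OF lim[OF k, of t]], of 2], of "cmod (\<Gamma>' k t)"] by simp
    have "(\<lambda>n. integral {0..1} (?i n k)) \<longlonglongrightarrow> integral {0..1} (\<lambda>_::real. 0::real)"
      by (rule dominated_convergence(2)[OF set_borel_integral_eq_integral(1)[OF sqn_integrable[OF u(1) k]]
            integrable_const_ivl[of "M\<^sup>2 * V"] bound conv])
    then show ?thesis
      by (simp only: set_borel_integral_eq_integral(2)[OF sqn_integrable[OF u(1) k]] integral_0)
  qed
  then have "(\<lambda>n. sqn (u n)) \<longlonglongrightarrow> (\<Sum>k<K. 0)"
    unfolding sqn_def by (intro tendsto_sum) auto
  then show ?thesis by simp
qed

text \<open>The approximants of \<open>bdd_hol_approx\<close> are bounded and converge pointwise on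
  the boundary, hence in square mean. Functions with mere normal limits thereby enter the Hardy
  space, whose definition asks for smooth approximation.\<close>

lemma bdd_hol_hardy:
  assumes h: "bdd_hol h"
  shows "hardy \<Omega> K \<Gamma> h"
proof (rule bdd_hol_approx[OF h], goal_cases)
  case (1 g M)
  obtain B where B: "B > 0" "\<And>z. z \<in> closure \<Omega> \<Longrightarrow> cmod (h z) \<le> B" by (rule bdd_hol_bound[OF h]) (rule that)
  have cl: "\<Gamma> k t \<in> closure \<Omega>" if "k < K" for k t using \<Gamma>_in_frontier[OF that] by (simp add: frontier_def)
  have "(\<lambda>n. sqn (\<lambda>z. g n z - h z)) \<longlonglongrightarrow> 0"
  proof (rule sqn_dominated)
    show "bL2 K \<Gamma> (\<lambda>z. g n z - h z)" for n
      by (rule bL2_diff[OF bdd_hol_bL2[OF smooth_hol_bdd_hol[OF 1(1)]] bdd_hol_bL2[OF h]])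
    show "cmod (g n (\<Gamma> k t) - h (\<Gamma> k t)) \<le> M + B" if "k < K" for n k t
      using 1(2)[OF that] B(2)[OF cl[OF that]] by (intro order_trans[OF norm_triangle_ineq4] add_mono)
    show "(\<lambda>n. g n (\<Gamma> k t) - h (\<Gamma> k t)) \<longlonglongrightarrow> 0" if "k < K" for k t
      using tendsto_diff[OF 1(3)[OF cl[OF that, of t]] tendsto_const[of "h (\<Gamma> k t)"]] by simp
  qed
  then show ?thesis
    unfolding hardy_alt using h 1(1) 1(3)[OF subsetD[OF closure_subset]] bdd_hol_bL2[OF h]
    by (auto simp: bdd_hol_def intro!: exI[of _ g])
qed

lemma hardy_lincomb:
  assumes "hardy \<Omega> K \<Gamma> F" "hardy \<Omega> K \<Gamma> G"
  shows "hardy \<Omega> K \<Gamma> (\<lambda>z. a * F z + b * G z)"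
proof -
  obtain f where f: "F holomorphic_on \<Omega>" "bL2 K \<Gamma> F" "\<And>n. smooth_hol \<Omega> (f n)"
    "(\<lambda>n. sqn (\<lambda>z. f n z - F z)) \<longlonglongrightarrow> 0" "\<And>z. z \<in> \<Omega> \<Longrightarrow> (\<lambda>n. f n z) \<longlonglongrightarrow> F z"
    using assms(1) unfolding hardy_alt by blast
  obtain g where g: "G holomorphic_on \<Omega>" "bL2 K \<Gamma> G" "\<And>n. smooth_hol \<Omega> (g n)"
    "(\<lambda>n. sqn (\<lambda>z. g n z - G z)) \<longlonglongrightarrow> 0" "\<And>z. z \<in> \<Omega> \<Longrightarrow> (\<lambda>n. g n z) \<longlonglongrightarrow> G z"
    using assms(2) unfolding hardy_alt by blast
  have b: "bL2 K \<Gamma> (\<lambda>z. a * F z + b * G z)" using f(2) g(2) by (intro bL2_add bL2_cmult)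
  have bf: "bL2 K \<Gamma> (f n)" "bL2 K \<Gamma> (g n)" for n using f(3) g(3) by (auto intro: bdd_hol_bL2 smooth_hol_bdd_hol)
  have le: "sqn (\<lambda>z. (a * f n z + b * g n z) - (a * F z + b * G z)) \<le> 2 * (cmod a)\<^sup>2 * sqn (\<lambda>z. f n z - F z) + 2 * (cmod b)\<^sup>2 * sqn (\<lambda>z. g n z - G z)" for n
  proof (rule sqn_mono[OF bL2_diff[OF bf(1) f(2)] bL2_diff[OF bf(2) g(2)]
        bL2_diff[OF bL2_add[OF bL2_cmult[OF bf(1)] bL2_cmult[OF bf(2)]] b]])
    fix z
    have "(a * f n z + b * g n z) - (a * F z + b * G z) = a * (f n z - F z) + b * (g n z - G z)" by (simp add: algebra_simps)
    then show "(cmod ((a * f n z + b * g n z) - (a * F z + b * G z)))\<^sup>2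
        \<le> 2 * (cmod a)\<^sup>2 * (cmod (f n z - F z))\<^sup>2 + 2 * (cmod b)\<^sup>2 * (cmod (g n z - G z))\<^sup>2"
      using cmod_add_square_le[of "a * (f n z - F z)" "b * (g n z - G z)"] by (simp add: norm_mult power_mult_distrib mult_ac)
  qed
  have lim: "(\<lambda>n. 2 * (cmod a)\<^sup>2 * sqn (\<lambda>z. f n z - F z) + 2 * (cmod b)\<^sup>2 * sqn (\<lambda>z. g n z - G z)) \<longlonglongrightarrow>
     2 * (cmod a)\<^sup>2 * 0 + 2 * (cmod b)\<^sup>2 * 0" by (intro tendsto_intros f g)
  have "(\<lambda>n. sqn (\<lambda>z. (a * f n z + b * g n z) - (a * F z + b * G z))) \<longlonglongrightarrow> 0"
    by (rule LIMSEQ_squeeze_0[OF le _ sqn_nonneg]) (use lim in simp)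
  moreover have "(\<lambda>n. a * f n z + b * g n z) \<longlonglongrightarrow> a * F z + b * G z" if "z \<in> \<Omega>" for z
    using f(5)[OF that] g(5)[OF that] by (intro tendsto_intros)
  moreover have "smooth_hol \<Omega> (\<lambda>z. a * f n z + b * g n z)" for n using f(3) g(3) by (rule smooth_hol_lincomb)
  moreover have "(\<lambda>z. a * F z + b * G z) holomorphic_on \<Omega>" by (intro holomorphic_intros f g)
  ultimately show ?thesis unfolding hardy_alt using b by (intro conjI exI[of _ "\<lambda>n z. a * f n z + b * g n z"]) auto
qed

end

lemma holomorphic_zero_at_puncture:
  fixes F :: "complex \<Rightarrow> complex"
  assumes "F holomorphic_on S" "open S" "b \<in> S" "\<And>z. z \<in> S - {b} \<Longrightarrow> F z = 0"
  shows "F b = 0"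
proof -
  have "isCont F b"
    using assms(1-3) holomorphic_on_imp_continuous_on continuous_on_eq_continuous_at by blast
  then have lim: "(F \<longlongrightarrow> F b) (at b)" by (simp add: isCont_def)
  have "\<forall>\<^sub>F z in at b. F z = 0"
    using eventually_at_in_open[OF assms(2,3)] by eventually_elim (use assms(4) in auto)
  then have "(F \<longlongrightarrow> 0) (at b)" by (simp add: tendsto_eventually)
  then show ?thesis using tendsto_unique[OF _ lim] by simp
qed

section \<open>Completeness, multiplication and division in the Hardy space\<close>

context tubular
begin

lemma hardyD:
  assumes "hardy \<Omega> K \<Gamma> H"
  shows "H holomorphic_on \<Omega>" "bL2 K \<Gamma> H"
  using assms unfolding hardy_alt by auto

lemma hardy_approx:
  assumes "hardy \<Omega> K \<Gamma> H"
  obtains g where "\<And>n. bdd_hol (g n)" "\<And>n. smooth_hol \<Omega> (g n)" "(\<lambda>n. sqn (\<lambda>z. g n z - H z)) \<longlonglongrightarrow> 0"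
    "\<And>z. z \<in> \<Omega> \<Longrightarrow> (\<lambda>n. g n z) \<longlonglongrightarrow> H z"
  using assms unfolding hardy_alt by (auto intro: smooth_hol_bdd_hol that)

lemma hardy_diff: "hardy \<Omega> K \<Gamma> F \<Longrightarrow> hardy \<Omega> K \<Gamma> G \<Longrightarrow> hardy \<Omega> K \<Gamma> (\<lambda>z. F z - G z)"
  using hardy_lincomb[of F G 1 "-1"] by simp

text \<open>Point evaluation is continuous in the square norm, uniformly over points whose ball of
  radius \<open>d\<close> lies in \<Omega>. The estimate for bounded functions is applied to
  approximants of \<open>H\<close> and passed to the limit.\<close>

lemma hardy_small:
  assumes e: "e > 0" and d: "d > 0"
  shows "\<exists>\<delta>>0. \<forall>H w. hardy \<Omega> K \<Gamma> H \<and> ball w d \<subseteq> \<Omega> \<and> sqn H < \<delta> \<longrightarrow> cmod (H w) < e"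
proof (rule pointwise_bound, goal_cases)
  case (1 c)
  \<comment> \<open>With this value \<open>c / d * (\<eta> + \<eta>)\<close> is
    \<open>e / 2\<close>, and \<open>sqn H < \<eta>\<^sup>2 / 2\<close> makes the second summand
    smaller than \<eta>.\<close>
  define \<eta> where "\<eta> = e * d / (4 * c)"
  have \<eta>: "\<eta> > 0" using e d 1(1) by (simp add: \<eta>_def)
  define \<delta> where "\<delta> = \<eta>\<^sup>2 / 2"
  have "cmod (H w) < e" if H: "hardy \<Omega> K \<Gamma> H" "ball w d \<subseteq> \<Omega>" "sqn H < \<delta>" for H w
  proof (rule hardy_approx[OF H(1)], goal_cases)
    case g: (1 g)
    have w: "w \<in> \<Omega>" using H(2) d by auto
    have b: "bL2 K \<Gamma> (g n)" "bL2 K \<Gamma> H" for n using bdd_hol_bL2[OF g(1)] hardyD[OF H(1)] by auto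
    have le: "cmod (g n w) \<le> c / d * (\<eta> + (2 * sqn (\<lambda>z. g n z - H z) + 2 * sqn H) / \<eta>)" for n
    proof -
      have "sqn (g n) \<le> 2 * sqn (\<lambda>z. g n z - H z) + 2 * sqn H"
        using sqn_add_le[OF bL2_diff[OF b] b(2), of n] by simp
      then have "c / d * (\<eta> + sqn (g n) / \<eta>) \<le> c / d * (\<eta> + (2 * sqn (\<lambda>z. g n z - H z) + 2 * sqn H) / \<eta>)"
        using \<eta> d 1(1) by (intro mult_left_mono add_left_mono divide_right_mono) auto
      then show ?thesis using 1(2)[OF g(1) d H(2) \<eta>, of n] by linarith
    qed
    have "cmod (H w) \<le> c / d * (\<eta> + (2 * 0 + 2 * sqn H) / \<eta>)"
    proof (rule LIMSEQ_le)
      show "(\<lambda>n. cmod (g n w)) \<longlonglongrightarrow> cmod (H w)" using g(4)[OF w] by (rule tendsto_norm)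
      show "(\<lambda>n. c / d * (\<eta> + (2 * sqn (\<lambda>z. g n z - H z) + 2 * sqn H) / \<eta>)) \<longlonglongrightarrow> c / d * (\<eta> + (2 * 0 + 2 * sqn H) / \<eta>)"
        using \<eta> by (intro tendsto_intros g(3)) auto
    qed (use le in blast)
    also have "\<dots> < c / d * (\<eta> + \<eta>)"
    proof (rule mult_strict_left_mono)
      have "2 * sqn H < \<eta> * \<eta>" using H(3) by (simp add: \<delta>_def power2_eq_square)
      then have "2 * sqn H / \<eta> < \<eta>" using \<eta> by (simp add: pos_divide_less_eq)
      then show "\<eta> + (2 * 0 + 2 * sqn H) / \<eta> < \<eta> + \<eta>" by simp
    qed (use d 1(1) in simp)
    also have "\<dots> \<le> e" using d 1(1) e by (simp add: \<eta>_def)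
    finally show ?thesis .
  qed
  moreover have "\<delta> > 0" using \<eta> by (simp add: \<delta>_def)
  ultimately show ?thesis by blast
qed

lemma hardy_null_pointwise:
  assumes "\<And>n. hardy \<Omega> K \<Gamma> (H n)" "(\<lambda>n. sqn (H n)) \<longlonglongrightarrow> 0" "w \<in> \<Omega>"
  shows "(\<lambda>n. H n w) \<longlonglongrightarrow> 0"
proof (rule LIMSEQ_I)
  fix e :: real assume e: "e > 0"
  obtain d where d: "d > 0" "ball w d \<subseteq> \<Omega>" using assms(3) \<Omega>(1) open_contains_ball by blast
  obtain \<delta> where \<delta>: "\<delta> > 0" "\<And>H w. hardy \<Omega> K \<Gamma> H \<Longrightarrow> ball w d \<subseteq> \<Omega> \<Longrightarrow> sqn H < \<delta> \<Longrightarrow> cmod (H w) < e"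
    using hardy_small[OF e d(1)] by blast
  obtain N where N: "\<And>n. n \<ge> N \<Longrightarrow> norm (sqn (H n) - 0) < \<delta>" using LIMSEQ_D[OF assms(2) \<delta>(1)] by blast
  show "\<exists>N. \<forall>n\<ge>N. norm (H n w - 0) < e"
  proof (intro exI[of _ N] allI impI)
    fix n assume "n \<ge> N"
    then have "sqn (H n) < \<delta>" using N[of n] sqn_nonneg[of "H n"] by simp
    then show "norm (H n w - 0) < e" using \<delta>(2)[OF assms(1) d(2)] by simp
  qed
qed

text \<open>Completeness. Replacing each \<open>u n\<close> by a nearby smooth approximant gives a
  sequence that is Cauchy in square mean, hence uniformly Cauchy away from the boundary; its
  holomorphic limit inside and \<open>U\<close> on the boundary form the required function.\<close>

lemma hardy_closed:
  assumes u: "\<And>n. hardy \<Omega> K \<Gamma> (u n)" and U: "bL2 K \<Gamma> U" and lim: "(\<lambda>n. sqn (\<lambda>z. u n z - U z)) \<longlonglongrightarrow> 0"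
  obtains H where "hardy \<Omega> K \<Gamma> H" "\<And>z. z \<in> frontier \<Omega> \<Longrightarrow> H z = U z" "\<And>w. w \<in> \<Omega> \<Longrightarrow> (\<lambda>n. u n w) \<longlonglongrightarrow> H w"
proof -
  have "\<exists>g. smooth_hol \<Omega> g \<and> sqn (\<lambda>z. g z - u n z) < inverse (real (Suc n))" for n
  proof (rule hardy_approx[OF u[of n]], goal_cases)
    case (1 g)
    have "inverse (real (Suc n)) > 0" by simp
    from LIMSEQ_D[OF 1(3) this] obtain N where "norm (sqn (\<lambda>z. g N z - u n z) - 0) < inverse (real (Suc n))" by blast
    then show ?case using 1(2) by (intro exI[of _ "g N"]) auto
  qed
  then obtain g where g: "\<And>n. smooth_hol \<Omega> (g n)" "\<And>n. sqn (\<lambda>z. g n z - u n z) < inverse (real (Suc n))"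
    by metis
  have gh: "hardy \<Omega> K \<Gamma> (g n)" for n using g(1) by (intro bdd_hol_hardy smooth_hol_bdd_hol)
  have bu: "bL2 K \<Gamma> (u n)" and bg: "bL2 K \<Gamma> (g n)" for n using u gh hardyD by auto
  have gu: "(\<lambda>n. sqn (\<lambda>z. g n z - u n z)) \<longlonglongrightarrow> 0"
    by (rule LIMSEQ_squeeze_0[OF less_imp_le[OF g(2)] LIMSEQ_inverse_real_of_nat sqn_nonneg])
  have gU: "(\<lambda>n. sqn (\<lambda>z. g n z - U z)) \<longlonglongrightarrow> 0"
  proof (rule LIMSEQ_squeeze_0[OF _ _ sqn_nonneg])
    show "sqn (\<lambda>z. g n z - U z) \<le> 2 * sqn (\<lambda>z. g n z - u n z) + 2 * sqn (\<lambda>z. u n z - U z)" for n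
      using sqn_triangle[OF bg U bu, of n n] sqn_cong[of "\<lambda>z. U z - u n z" "\<lambda>z. u n z - U z"]
      by (simp add: norm_minus_commute)
    show "(\<lambda>n. 2 * sqn (\<lambda>z. g n z - u n z) + 2 * sqn (\<lambda>z. u n z - U z)) \<longlonglongrightarrow> 0"
      using tendsto_add[OF tendsto_mult_left[OF gu, of 2] tendsto_mult_left[OF lim, of 2]] by simp
  qed
  define L where "L w = lim (\<lambda>n. g n w)" for w
  have unif: "uniform_limit X g L sequentially" if X: "d > 0" "\<And>w. w \<in> X \<Longrightarrow> ball w d \<subseteq> \<Omega>" for X d
  proof -
    have "uniformly_Cauchy_on X g"
      unfolding uniformly_Cauchy_on_def
    proof (intro allI impI)
      fix e :: real assume e: "e > 0"
      obtain \<delta> where \<delta>: "\<delta> > 0" "\<And>H w. hardy \<Omega> K \<Gamma> H \<Longrightarrow> ball w d \<subseteq> \<Omega> \<Longrightarrow> sqn H < \<delta> \<Longrightarrow> cmod (H w) < e"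
        using hardy_small[OF e X(1)] by blast
      have "\<delta> / 4 > 0" using \<delta> by simp
      from LIMSEQ_D[OF gU this] obtain N where N: "\<And>n. n \<ge> N \<Longrightarrow> sqn (\<lambda>z. g n z - U z) < \<delta> / 4"
        by (metis abs_of_nonneg diff_zero real_norm_def sqn_nonneg)
      have "dist (g i w) (g j w) < e" if w: "w \<in> X" and ij: "i \<ge> N" "j \<ge> N" for w i j
      proof -
        have "sqn (\<lambda>z. g i z - g j z) < \<delta>"
          using sqn_triangle[OF bg bg U, of i j] N[OF ij(1)] N[OF ij(2)] by linarith
        from \<delta>(2)[OF hardy_diff[OF gh gh] X(2)[OF w] this] show ?thesis by (simp add: dist_norm)
      qed
      then show "\<exists>N. \<forall>w\<in>X. \<forall>i\<ge>N. \<forall>j\<ge>N. dist (g i w) (g j w) < e" by blast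
    qed
    then have "uniformly_convergent_on X g" by (rule Cauchy_uniformly_convergent)
    then show ?thesis unfolding L_def uniformly_convergent_uniform_limit_iff .
  qed
  have glim: "(\<lambda>n. g n w) \<longlonglongrightarrow> L w" if w: "w \<in> \<Omega>" for w
  proof -
    obtain d where d: "d > 0" "ball w d \<subseteq> \<Omega>" using w \<Omega>(1) open_contains_ball by blast
    then have "uniform_limit {w} g L sequentially" by (intro unif[of d]) auto
    then show ?thesis by (rule tendsto_uniform_limitI) simp
  qed
  have hol: "L holomorphic_on \<Omega>"
  proof (rule holomorphic_uniform_sequence[OF \<Omega>(1)])
    show "g n holomorphic_on \<Omega>" for n using gh hardyD by blast
    fix x assume "x \<in> \<Omega>"
    then obtain d where d: "d > 0" "ball x d \<subseteq> \<Omega>" using \<Omega>(1) open_contains_ball by blast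
    have sub: "ball w (d / 2) \<subseteq> \<Omega>" if "w \<in> cball x (d / 2)" for w
    proof
      fix v assume "v \<in> ball w (d / 2)"
      then have "dist x v < d" using that dist_triangle[of x v w] by simp
      then show "v \<in> \<Omega>" using d(2) by auto
    qed
    have "cball x (d / 2) \<subseteq> \<Omega>" using d by auto
    then show "\<exists>d>0. cball x d \<subseteq> \<Omega> \<and> uniform_limit (cball x d) g L sequentially"
      using unif[of "d / 2" "cball x (d / 2)", OF _ sub] d(1) by (intro exI[of _ "d / 2"]) auto
  qed
  define H where "H z = (if z \<in> \<Omega> then L z else U z)" for z
  have HU: "H z = U z" if "z \<in> frontier \<Omega>" for z using that frontier_disjoint by (auto simp: H_def)
  have "H holomorphic_on \<Omega>" using hol by (rule holomorphic_transform) (simp add: H_def)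
  moreover have "bL2 K \<Gamma> H" using bL2_cong[OF U] HU by simp
  moreover have "sqn (\<lambda>z. g n z - H z) = sqn (\<lambda>z. g n z - U z)" for n by (rule sqn_cong) (simp add: HU)
  ultimately have "hardy \<Omega> K \<Gamma> H"
    unfolding hardy_alt using g(1) gU glim by (intro conjI exI[of _ g]) (auto simp: H_def)
  moreover have "(\<lambda>n. u n w) \<longlonglongrightarrow> H w" if w: "w \<in> \<Omega>" for w
  proof -
    have "(\<lambda>n. g n w - u n w) \<longlonglongrightarrow> 0" by (rule hardy_null_pointwise[OF hardy_diff[OF gh u] gu w])
    then have "(\<lambda>n. g n w - (g n w - u n w)) \<longlonglongrightarrow> L w - 0" by (intro tendsto_diff glim[OF w])
    then show ?thesis using w by (simp add: H_def)
  qed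
  ultimately show ?thesis using HU that by blast
qed

text \<open>For the smooth approximants \<open>g n\<close> of \<open>H\<close> the products lie in
  \<open>bdd_hol\<close>. They converge in square mean because \<open>h\<close> is bounded, and
  completeness applies; the limit agrees with the product on the whole closure.\<close>

lemma hardy_mult:
  assumes h: "bdd_hol h" and H: "hardy \<Omega> K \<Gamma> H"
  shows "hardy \<Omega> K \<Gamma> (\<lambda>z. h z * H z)"
proof (rule hardy_approx[OF H], goal_cases)
  case g: (1 g)
  obtain B where B: "B > 0" "\<And>z. z \<in> closure \<Omega> \<Longrightarrow> cmod (h z) \<le> B" by (rule bdd_hol_bound[OF h]) (rule that)
  have Bf: "cmod (h (\<Gamma> k t)) \<le> B" if "k < K" for k t using \<Gamma>_in_frontier[OF that] by (intro B(2)) (simp add: frontier_def)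
  have bH: "bL2 K \<Gamma> H" using hardyD H by blast
  have bU: "bL2 K \<Gamma> (\<lambda>z. h z * H z)" by (rule bL2_mult[OF bH bdd_hol_measurable[OF h] Bf])
  have hu: "hardy \<Omega> K \<Gamma> (\<lambda>z. h z * g n z)" for n using g(1) by (intro bdd_hol_hardy bdd_hol_mult h)
  have bd: "bL2 K \<Gamma> (\<lambda>z. g n z - H z)" for n by (rule bL2_diff[OF bdd_hol_bL2[OF g(1)] bH])
  have le: "sqn (\<lambda>z. h z * g n z - h z * H z) \<le> B\<^sup>2 * sqn (\<lambda>z. g n z - H z)" for n
  proof -
    have "sqn (\<lambda>z. h z * g n z - h z * H z) \<le> B\<^sup>2 * sqn (\<lambda>z. g n z - H z) + 0 * sqn (\<lambda>z. g n z - H z)"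
    proof (rule sqn_mono[OF bd bd bL2_diff[OF hardyD(2)[OF hu] bU]])
      fix z assume "z \<in> frontier \<Omega>"
      then have "cmod (h z) \<le> B" by (intro B(2)) (simp add: frontier_def)
      then have "(cmod (h z))\<^sup>2 * (cmod (g n z - H z))\<^sup>2 \<le> B\<^sup>2 * (cmod (g n z - H z))\<^sup>2"
        by (intro mult_right_mono power_mono) auto
      then show "(cmod (h z * g n z - h z * H z))\<^sup>2 \<le> B\<^sup>2 * (cmod (g n z - H z))\<^sup>2 + 0 * (cmod (g n z - H z))\<^sup>2"
        by (simp add: norm_mult power_mult_distrib flip: right_diff_distrib)
    qed
    then show ?thesis by simp
  qed
  have "(\<lambda>n. B\<^sup>2 * sqn (\<lambda>z. g n z - H z)) \<longlonglongrightarrow> 0" using tendsto_mult_left[OF g(3), of "B\<^sup>2"] by simp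
  then have lim: "(\<lambda>n. sqn (\<lambda>z. h z * g n z - h z * H z)) \<longlonglongrightarrow> 0" by (rule LIMSEQ_squeeze_0[OF le _ sqn_nonneg])
  show ?thesis
  proof (rule hardy_closed[OF hu bU lim], goal_cases)
    case (1 G)
    show ?case
    proof (rule hardy_cong[OF 1(1)])
      fix z assume z: "z \<in> closure \<Omega>"
      show "G z = h z * H z"
      proof (cases "z \<in> \<Omega>")
        case True
        have "(\<lambda>n. h z * g n z) \<longlonglongrightarrow> h z * H z" by (rule tendsto_mult_left) (rule g(4)[OF True])
        then show ?thesis using LIMSEQ_unique[OF 1(3)[OF True]] by simp
      next
        case False
        then show ?thesis using z 1(2) by (simp add: closure_Un_frontier)
      qed
    qed
  qed
qed

text \<open>The difference quotients at \<open>a\<close> of the approximants lie in the Hardy space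
  and converge in square mean to \<open>H z / (z - a)\<close>: on the boundary \<open>z - a\<close>
  is bounded below, and the subtracted values \<open>g n a\<close> tend to
  \<open>H a = 0\<close>.\<close>

lemma hardy_divide_root:
  assumes H: "hardy \<Omega> K \<Gamma> H" and a: "a \<in> \<Omega>" "H a = 0"
  obtains G where "hardy \<Omega> K \<Gamma> G" "\<And>z. z \<in> closure \<Omega> \<Longrightarrow> H z = (z - a) * G z"
proof (rule hardy_approx[OF H], goal_cases)
  case g: (1 g)
  define u where "u n z = (if z = a then deriv (g n) a else (g n z - g n a) / (z - a))" for n z
  have hu: "hardy \<Omega> K \<Gamma> (u n)" for n
    unfolding u_def[abs_def] by (intro bdd_hol_hardy bdd_hol_difference_quotient g(2) a(1))
  obtain d where d: "d > 0" "ball a d \<subseteq> \<Omega>" using a \<Omega>(1) open_contains_ball by blast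
  have far: "d \<le> cmod (z - a)" if "z \<in> frontier \<Omega>" for z
    using that d(2) frontier_disjoint by (auto simp: subset_eq dist_norm norm_minus_commute not_less[symmetric])
  have ne: "z \<noteq> a" if "z \<in> frontier \<Omega>" for z using far[OF that] d(1) by auto
  have bH: "bL2 K \<Gamma> H" using hardyD H by blast
  have "bL2 K \<Gamma> (\<lambda>z. (1 / (z - a)) * H z)"
  proof (rule bL2_mult[OF bH])
    fix k assume k: "k < K"
    show "(\<lambda>t. 1 / (\<Gamma> k t - a)) \<in> borel_measurable borel" using curve_measurable(1)[OF k] by measurable
    show "cmod (1 / (\<Gamma> k t - a)) \<le> 1 / d" for t
      using far[OF \<Gamma>_in_frontier[OF k]] d(1) by (simp add: norm_divide frac_le)
  qed
  then have bU: "bL2 K \<Gamma> (\<lambda>z. H z / (z - a))" by simp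
  have bd: "bL2 K \<Gamma> (\<lambda>z. g n z - H z)" for n by (rule bL2_diff[OF bdd_hol_bL2[OF g(2)] bH])
  have bc: "bL2 K \<Gamma> (\<lambda>_. c)" for c by (rule bdd_hol_bL2[OF bdd_hol_const])
  have le: "sqn (\<lambda>z. u n z - H z / (z - a)) \<le> 2 / d\<^sup>2 * sqn (\<lambda>z. g n z - H z) + 2 / d\<^sup>2 * (cmod (g n a))\<^sup>2 * sqn (\<lambda>_. 1)" for n
  proof (rule sqn_mono[OF bd bc bL2_diff[OF hardyD(2)[OF hu] bU]])
    fix z assume z: "z \<in> frontier \<Omega>"
    have "u n z - H z / (z - a) = ((g n z - H z) + (- g n a)) / (z - a)"
      using ne[OF z] by (simp add: u_def diff_divide_distrib)
    then have "(cmod (u n z - H z / (z - a)))\<^sup>2 = (cmod ((g n z - H z) + (- g n a)))\<^sup>2 / (cmod (z - a))\<^sup>2"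
      by (simp only: norm_divide power_divide)
    also have "\<dots> \<le> (2 * (cmod (g n z - H z))\<^sup>2 + 2 * (cmod (- g n a))\<^sup>2) / d\<^sup>2"
      using far[OF z] d(1) by (intro frac_le cmod_add_square_le power_mono) auto
    also have "\<dots> = 2 / d\<^sup>2 * (cmod (g n z - H z))\<^sup>2 + 2 / d\<^sup>2 * (cmod (g n a))\<^sup>2 * (cmod 1)\<^sup>2"
      by (simp add: add_divide_distrib)
    finally show "(cmod (u n z - H z / (z - a)))\<^sup>2 \<le> 2 / d\<^sup>2 * (cmod (g n z - H z))\<^sup>2 + 2 / d\<^sup>2 * (cmod (g n a))\<^sup>2 * (cmod 1)\<^sup>2" .
  qed
  have "(\<lambda>n. 2 / d\<^sup>2 * sqn (\<lambda>z. g n z - H z) + 2 / d\<^sup>2 * (cmod (g n a))\<^sup>2 * sqn (\<lambda>_. 1)) \<longlonglongrightarrow>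
      2 / d\<^sup>2 * 0 + 2 / d\<^sup>2 * (cmod (H a))\<^sup>2 * sqn (\<lambda>_. 1)"
    by (intro tendsto_intros g(4) g(5)[OF a(1)])
  then have "(\<lambda>n. 2 / d\<^sup>2 * sqn (\<lambda>z. g n z - H z) + 2 / d\<^sup>2 * (cmod (g n a))\<^sup>2 * sqn (\<lambda>_. 1)) \<longlonglongrightarrow> 0"
    by (simp add: a(2))
  then have lim: "(\<lambda>n. sqn (\<lambda>z. u n z - H z / (z - a))) \<longlonglongrightarrow> 0" by (rule LIMSEQ_squeeze_0[OF le _ sqn_nonneg])
  show ?thesis
  proof (rule hardy_closed[OF hu bU lim], goal_cases)
    case (1 G)
    show ?case
    proof (rule that[OF 1(1)])
      fix z assume z: "z \<in> closure \<Omega>"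
      consider "z = a" | "z \<in> \<Omega>" "z \<noteq> a" | "z \<in> frontier \<Omega>" using z by (auto simp: closure_Un_frontier)
      then show "H z = (z - a) * G z"
      proof cases
        case 2
        have "(\<lambda>n. (z - a) * u n z) \<longlonglongrightarrow> (z - a) * G z" by (rule tendsto_mult_left[OF 1(3)[OF 2(1)]])
        then have "(\<lambda>n. g n z - g n a) \<longlonglongrightarrow> (z - a) * G z" using 2(2) by (simp add: u_def)
        moreover have "(\<lambda>n. g n z - g n a) \<longlonglongrightarrow> H z - H a"
          by (intro tendsto_diff) (rule g(5), rule 2 a)+
        ultimately show ?thesis using LIMSEQ_unique a(2) by fastforce
      qed (use a(2) 1(2) ne in auto)
    qed
  qed
qed

text \<open>Division by \<open>p\<close> respects the Hardy space: a quotient that exists as a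
  holomorphic function in \<Omega> also has boundary values making it a Hardy function. Keeping the
  interior quotient \<open>E\<close> apart from \<open>G\<close> makes the property multiplicative,
  so products of powers of linear factors inherit it.\<close>

definition divisor :: "(complex \<Rightarrow> complex) \<Rightarrow> bool" where
  "divisor p \<longleftrightarrow> p holomorphic_on \<Omega> \<and> (\<forall>H E. hardy \<Omega> K \<Gamma> H \<longrightarrow> E holomorphic_on \<Omega> \<longrightarrow> (\<forall>z\<in>\<Omega>. H z = p z * E z) \<longrightarrow>
     (\<exists>G. hardy \<Omega> K \<Gamma> G \<and> (\<forall>z\<in>\<Omega>. G z = E z) \<and> (\<forall>z\<in>frontier \<Omega>. H z = p z * G z)))"

lemma divisor_root:
  assumes a: "a \<in> \<Omega>"
  shows "divisor (\<lambda>z. z - a)"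
  unfolding divisor_def
proof (intro conjI allI impI)
  fix H E assume H: "hardy \<Omega> K \<Gamma> H" and E: "E holomorphic_on \<Omega>" and eq: "\<forall>z\<in>\<Omega>. H z = (z - a) * E z"
  have "H a = 0" using eq a by simp
  show "\<exists>G. hardy \<Omega> K \<Gamma> G \<and> (\<forall>z\<in>\<Omega>. G z = E z) \<and> (\<forall>z\<in>frontier \<Omega>. H z = (z - a) * G z)"
  proof (rule hardy_divide_root[OF H a \<open>H a = 0\<close>], goal_cases)
    case (1 G)
    have off: "G z - E z = 0" if "z \<in> \<Omega> - {a}" for z
    proof -
      have "(z - a) * G z = (z - a) * E z" using 1(2)[of z] eq that closure_subset by fastforce
      then show ?thesis using that by simp
    qed
    moreover have "G a - E a = 0"
      by (rule holomorphic_zero_at_puncture[of "\<lambda>z. G z - E z" \<Omega>])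
         (use hardyD(1)[OF 1(1)] E \<Omega>(1) a off in \<open>auto intro!: holomorphic_intros\<close>)
    ultimately have "\<forall>z\<in>\<Omega>. G z = E z" by (metis DiffI eq_iff_diff_eq_0 singletonD)
    then show ?case using 1 by (auto simp: frontier_def)
  qed
qed (intro holomorphic_intros)

lemma divisor_one: "divisor (\<lambda>_. 1)"
  unfolding divisor_def by auto

lemma divisor_mult:
  assumes p: "divisor p" and q: "divisor q"
  shows "divisor (\<lambda>z. p z * q z)"
proof -
  have hol: "p holomorphic_on \<Omega>" "q holomorphic_on \<Omega>" using p q unfolding divisor_def by auto
  show ?thesis
    unfolding divisor_def
  proof (intro conjI allI impI)
    fix H E assume H: "hardy \<Omega> K \<Gamma> H" and E: "E holomorphic_on \<Omega>" and eq: "\<forall>z\<in>\<Omega>. H z = p z * q z * E z"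
    have "(\<lambda>z. q z * E z) holomorphic_on \<Omega>" by (intro holomorphic_intros hol E)
    moreover have "\<forall>z\<in>\<Omega>. H z = p z * (q z * E z)" using eq by (simp add: mult.assoc)
    ultimately obtain G1 where G1: "hardy \<Omega> K \<Gamma> G1" "\<forall>z\<in>\<Omega>. G1 z = q z * E z" "\<forall>z\<in>frontier \<Omega>. H z = p z * G1 z"
      using p H unfolding divisor_def by fast
    then obtain G where G: "hardy \<Omega> K \<Gamma> G" "\<forall>z\<in>\<Omega>. G z = E z" "\<forall>z\<in>frontier \<Omega>. G1 z = q z * G z"
      using q E unfolding divisor_def by fast
    then show "\<exists>G. hardy \<Omega> K \<Gamma> G \<and> (\<forall>z\<in>\<Omega>. G z = E z) \<and> (\<forall>z\<in>frontier \<Omega>. H z = p z * q z * G z)"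
      using G1 by (intro exI[of _ G]) (auto simp: mult.assoc)
  qed (intro holomorphic_intros hol)
qed

lemma divisor_power: "divisor p \<Longrightarrow> divisor (\<lambda>z. p z ^ n)"
  by (induction n) (auto intro: divisor_one divisor_mult)

lemma divisor_prod: "(\<And>i. i \<in> I \<Longrightarrow> divisor (p i)) \<Longrightarrow> divisor (\<lambda>z. \<Prod>i\<in>I. p i z)"
  by (induction I rule: infinite_finite_induct) (auto intro: divisor_one divisor_mult)

end

subsection \<open>Boundary behaviour of proper maps onto the disc\<close>

text \<open>The Schwarz lemma for the rescaled \<open>f\<close> followed by the Moebius map that
  sends \<open>f z\<close> to 0. The bound \<open>1 - (cmod a)\<^sup>2\<close> is weakened to the
  linear quantity used in the boundary estimate.\<close>

lemma Schwarz_Pick_deriv: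
  assumes hol: "f holomorphic_on ball z R" and R: "R > 0" and f: "f ` ball z R \<subseteq> ball 0 1"
  shows "cmod (deriv f z) * R \<le> 2 * (1 - cmod (f z))"
proof -
  define a where "a = f z"
  have f1': "cmod (f w) < 1" if "w \<in> ball z R" for w using f that by (auto simp: image_subset_iff)
  have a: "cmod a < 1" unfolding a_def using R by (intro f1') simp
  let ?M = "\<lambda>w. (w - a) / (1 - cnj a * w)"
  define g where "g \<zeta> = ?M (f (z + of_real R * \<zeta>))" for \<zeta>
  have inb: "z + of_real R * \<zeta> \<in> ball z R" if "cmod \<zeta> < 1" for \<zeta>
    using that R by (simp add: dist_norm norm_mult)
  have f1: "cmod (f (z + of_real R * \<zeta>)) < 1" if "cmod \<zeta> < 1" for \<zeta>
    by (rule f1'[OF inb[OF that]])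
  have nz: "1 - cnj a * w \<noteq> 0" if "cmod w < 1" for w
  proof
    assume "1 - cnj a * w = 0"
    then have "cmod (cnj a * w) = 1" by (metis eq_iff_diff_eq_0 norm_one)
    moreover have "cmod (cnj a * w) \<le> cmod a * 1" using that by (simp add: norm_mult mult_left_le)
    ultimately show False using a by simp
  qed
  have holc: "(\<lambda>\<zeta>. f (z + of_real R * \<zeta>)) holomorphic_on ball 0 1"
  proof -
    have "(\<lambda>\<zeta>. z + of_real R * \<zeta>) holomorphic_on ball 0 1" by (intro holomorphic_intros)
    moreover have "(\<lambda>\<zeta>. z + of_real R * \<zeta>) ` ball 0 1 \<subseteq> ball z R" using inb by auto
    ultimately have "f \<circ> (\<lambda>\<zeta>. z + of_real R * \<zeta>) holomorphic_on ball 0 1"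
      using hol by (intro holomorphic_on_compose_gen)
    then show ?thesis by (simp add: o_def)
  qed
  have holg: "g holomorphic_on ball 0 1"
    unfolding g_def[abs_def] using nz f1 by (intro holomorphic_intros holc) auto
  have "cmod (g \<zeta>) < 1" if "cmod \<zeta> < 1" for \<zeta>
    using Moebius_function_norm_lt_1[OF a f1[OF that], of 0] by (simp add: g_def Moebius_function_simple)
  moreover have "g 0 = 0" by (simp add: g_def a_def)
  ultimately have le: "cmod (deriv g 0) \<le> 1" using Schwarz_Lemma(2)[OF holg, of 0] by simp
  have d: "(f has_field_derivative deriv f z) (at z)"
    using hol R by (intro holomorphic_derivI[of f "ball z R"]) auto
  have "((\<lambda>\<zeta>. z + of_real R * \<zeta>) has_field_derivative of_real R) (at 0)"
    by (auto intro!: derivative_eq_intros)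
  then have d1: "((\<lambda>\<zeta>. f (z + of_real R * \<zeta>)) has_field_derivative deriv f z * of_real R) (at 0)"
    using DERIV_chain[of f "deriv f z" "\<lambda>\<zeta>. z + of_real R * \<zeta>" 0 "of_real R" UNIV] d by (simp add: o_def)
  have "1 - cnj a * a \<noteq> 0" using nz[OF a] .
  then have "(g has_field_derivative (deriv f z * of_real R) / (1 - cnj a * a)) (at 0)"
    unfolding g_def[abs_def]
    by (auto intro!: derivative_eq_intros d1 simp: a_def[symmetric] divide_simps)
  then have "deriv g 0 = deriv f z * of_real R / (1 - cnj a * a)" by (rule DERIV_imp_deriv)
  moreover have pos: "1 - (cmod a)\<^sup>2 > 0" using a by (simp add: power_less_one_iff abs_square_less_1)
  moreover have "1 - cnj a * a = of_real (1 - (cmod a)\<^sup>2)"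
    using complex_norm_square[of a] by (simp add: mult.commute)
  ultimately have "cmod (deriv f z) * R / (1 - (cmod a)\<^sup>2) \<le> 1"
    using le R by (simp add: norm_divide norm_mult del: of_real_diff of_real_power)
  then have "cmod (deriv f z) * R \<le> 1 - (cmod a)\<^sup>2" using pos by (simp add: pos_divide_le_eq)
  also have "\<dots> = (1 + cmod a) * (1 - cmod a)" by (simp add: power2_eq_square algebra_simps)
  also have "\<dots> \<le> 2 * (1 - cmod a)" using a by (intro mult_right_mono) auto
  finally show ?thesis by (simp add: a_def)
qed

text \<open>Minimum principle for \<open>f (z) ((z - c) / \<rho>)\<^sup>n\<close> on the part of \<open>\<Omega>\<close> where \<open>1/2 < \<bar>f\<bar>\<close>: the power
  \<open>n\<close> makes the modulus at least one on \<open>\<bar>f\<bar> = 1/2\<close>.\<close>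

lemma proper_map_lower_bound:
  assumes \<Omega>: "open \<Omega>" "bounded \<Omega>" and hol: "f holomorphic_on \<Omega>" and proper: "proper_to_disc \<Omega> f"
    and \<rho>: "\<rho> > 0" and ext: "ball c \<rho> \<inter> \<Omega> = {}"
  shows "\<exists>n. \<forall>z\<in>\<Omega>. 1/2 < cmod (f z) \<longrightarrow> (\<rho> / cmod (z - c)) ^ n \<le> cmod (f z)"
proof -
  have f1: "cmod (f z) < 1" if "z \<in> \<Omega>" for z using proper that unfolding proper_to_disc_def by auto
  have comp: "compact {z\<in>\<Omega>. f z \<in> C}" if "compact C" "C \<subseteq> ball 0 1" for C
    using proper that unfolding proper_to_disc_def by blast
  have far: "\<rho> < cmod (z - c)" if z: "z \<in> \<Omega>" for z
  proof -
    have "z \<notin> closure (ball c \<rho>)"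
      using open_Int_closure_eq_empty[OF \<Omega>(1), of "ball c \<rho>"] ext z by blast
    then show ?thesis using \<rho> by (simp add: dist_norm norm_minus_commute)
  qed
  have q1: "\<rho> / cmod (z - c) < 1" if "z \<in> \<Omega>" for z using far[OF that] \<rho> by (simp add: divide_less_eq)
  define A where "A = {z\<in>\<Omega>. f z \<in> cball 0 (1/2)}"
  have "compact A" unfolding A_def by (intro comp) auto
  have "\<exists>n. \<forall>z\<in>A. (\<rho> / cmod (z - c)) ^ n \<le> 1/2"
  proof (cases "A = {}")
    case False
    have cont: "continuous_on A (\<lambda>z. \<rho> / cmod (z - c))"
      by (intro continuous_intros) (use far[of c] \<rho> in \<open>auto simp: A_def\<close>)
    obtain z0 where z0: "z0 \<in> A" "\<forall>z\<in>A. \<rho> / cmod (z - c) \<le> \<rho> / cmod (z0 - c)"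
      using continuous_attains_sup[OF \<open>compact A\<close> False cont] by blast
    have "\<rho> / cmod (z0 - c) < 1" using z0(1) q1 by (simp add: A_def)
    then obtain n where n: "(\<rho> / cmod (z0 - c)) ^ n < 1/2"
      using real_arch_pow_inv[of "1/2"] by auto
    have "(\<rho> / cmod (z - c)) ^ n \<le> (\<rho> / cmod (z0 - c)) ^ n" if "z \<in> A" for z
      using z0(2) that \<rho> by (intro power_mono) auto
    then show ?thesis using n by (intro exI[of _ n]) fastforce
  qed auto
  then obtain n where n: "\<And>z. z \<in> A \<Longrightarrow> (\<rho> / cmod (z - c)) ^ n \<le> 1/2" by blast
  have main: "(\<rho> / cmod (z - c)) ^ n * (1 - \<eta>) \<le> cmod (f z)"
    if z: "z \<in> \<Omega>" "1/2 < cmod (f z)" and \<eta>: "0 < \<eta>" "\<eta> < 1 - cmod (f z)" for z \<eta>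
  proof -
    \<comment> \<open>Properness makes \<open>L\<close> a compact subset of \<Omega>, so the closure
      of the region \<open>S\<close> stays away from the boundary of \<Omega> and no boundary values
      of \<open>f\<close> enter the maximum principle; \<eta> tends to 0 afterwards.\<close>
    define S where "S = \<Omega> \<inter> f -` (ball 0 (1 - \<eta>) - cball 0 (1/2))"
    define L where "L = {z\<in>\<Omega>. f z \<in> cball 0 (1 - \<eta>) - ball 0 (1/2)}"
    have "compact L" unfolding L_def using \<eta>(1) by (intro comp compact_diff) (auto simp: subset_eq)
    have "open S" unfolding S_def
      by (rule continuous_open_preimage[OF holomorphic_on_imp_continuous_on[OF hol] \<Omega>(1)]) (auto intro: open_Diff)
    have "S \<subseteq> L" by (auto simp: S_def L_def)
    then have clS: "closure S \<subseteq> L" using \<open>compact L\<close> by (simp add: closure_minimal compact_imp_closed)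
    have L\<Omega>: "L \<subseteq> \<Omega>" by (auto simp: L_def)
    have nz: "f z \<noteq> 0" "z - c \<noteq> 0" if "z \<in> L" for z using that far[of z] \<rho> by (auto simp: L_def)
    \<comment> \<open>The maximum principle is applied to the reciprocal: on the level
      \<open>1 - \<eta>\<close> its modulus is at most \<open>1 / (1 - \<eta>)\<close>, and on the
      level 1/2 the choice of \<open>n\<close> bounds it by 1.\<close>
    let ?\<Phi> = "\<lambda>z. (of_real \<rho> / (z - c)) ^ n / f z"
    have norm\<Phi>: "cmod (?\<Phi> z) = (\<rho> / cmod (z - c)) ^ n / cmod (f z)" for z
      using \<rho> by (simp add: norm_divide norm_power)
    have hol\<Phi>: "?\<Phi> holomorphic_on L"
      using nz by (intro holomorphic_intros holomorphic_on_subset[OF hol L\<Omega>]) auto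
    have "cmod (?\<Phi> z) \<le> 1 / (1 - \<eta>)"
    proof (rule maximum_modulus_frontier[where f = ?\<Phi> and S = S])
      show "?\<Phi> holomorphic_on interior S"
        using holomorphic_on_subset[OF hol\<Phi>] \<open>S \<subseteq> L\<close> interior_subset by blast
      show "continuous_on (closure S) ?\<Phi>"
        using continuous_on_subset[OF holomorphic_on_imp_continuous_on[OF hol\<Phi>] clS] .
      show "bounded S" using \<Omega>(2) by (rule bounded_subset) (auto simp: S_def)
      show "z \<in> S" using z \<eta> by (auto simp: S_def)
      fix v assume "v \<in> frontier S"
      then have v: "v \<in> L" "v \<notin> S" using clS \<open>open S\<close> by (auto simp: frontier_def interior_open)
      have fv: "cmod (f v) > 0" using nz(1)[OF v(1)] by simp
      have \<eta>1: "1 - \<eta> > 0" using \<eta> z(2) by simp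
      consider "cmod (f v) = 1/2" | "cmod (f v) = 1 - \<eta>" using v by (auto simp: L_def S_def)
      then show "cmod (?\<Phi> v) \<le> 1 / (1 - \<eta>)"
      proof cases
        case 1
        then have "(\<rho> / cmod (v - c)) ^ n \<le> 1/2" using v(1) L\<Omega> by (intro n) (auto simp: A_def)
        then have "(\<rho> / cmod (v - c)) ^ n \<le> 1 * cmod (f v)" using 1 by linarith
        then have "(\<rho> / cmod (v - c)) ^ n / cmod (f v) \<le> 1"
          using fv by (simp only: pos_divide_le_eq)
        then have "cmod (?\<Phi> v) \<le> 1" unfolding norm\<Phi> .
        also have "\<dots> \<le> 1 / (1 - \<eta>)" using \<eta>(1) \<eta>1 by (simp add: pos_le_divide_eq)
        finally show ?thesis .
      next
        case 2
        have "(\<rho> / cmod (v - c)) ^ n \<le> 1" using q1[of v] v(1) L\<Omega> \<rho> by (intro power_le_one) auto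
        then show ?thesis unfolding norm\<Phi> 2 using \<eta>1 by (intro divide_right_mono) auto
      qed
    qed
    then have "(\<rho> / cmod (z - c)) ^ n / cmod (f z) \<le> 1 / (1 - \<eta>)" unfolding norm\<Phi> .
    moreover have "cmod (f z) > 0" "1 - \<eta> > 0" using z(2) \<eta> by auto
    ultimately have "(\<rho> / cmod (z - c)) ^ n \<le> 1 / (1 - \<eta>) * cmod (f z)" by (simp only: pos_divide_le_eq)
    then have "(\<rho> / cmod (z - c)) ^ n * (1 - \<eta>) \<le> (1 / (1 - \<eta>) * cmod (f z)) * (1 - \<eta>)"
      using \<open>1 - \<eta> > 0\<close> by (intro mult_right_mono) auto
    then show ?thesis using \<open>1 - \<eta> > 0\<close> by simp
  qed
  have "(\<rho> / cmod (z - c)) ^ n \<le> cmod (f z)" if z: "z \<in> \<Omega>" "1/2 < cmod (f z)" for z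
  proof (rule field_le_epsilon)
    fix e :: real assume e: "e > 0"
    define \<eta> where "\<eta> = min e ((1 - cmod (f z)) / 2)"
    have \<eta>: "0 < \<eta>" "\<eta> < 1 - cmod (f z)" "\<eta> \<le> e" using e f1[OF z(1)] by (auto simp: \<eta>_def min_def)
    have le1: "(\<rho> / cmod (z - c)) ^ n \<le> 1" using q1[OF z(1)] \<rho> by (intro power_le_one) auto
    have "(\<rho> / cmod (z - c)) ^ n = (\<rho> / cmod (z - c)) ^ n * (1 - \<eta>) + (\<rho> / cmod (z - c)) ^ n * \<eta>"
      by (simp add: algebra_simps)
    also have "\<dots> \<le> cmod (f z) + 1 * \<eta>"
      using main[OF z \<eta>(1,2)] le1 \<eta>(1) by (intro add_mono mult_right_mono) auto
    finally show "(\<rho> / cmod (z - c)) ^ n \<le> cmod (f z) + e" using \<eta>(3) by simp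
  qed
  then show ?thesis by blast
qed

section \<open>Touching balls and extension by normal limits\<close>

context tubular
begin

lemma cmod_normal: "k < K \<Longrightarrow> cmod (normal k t) = cmod (\<Gamma>' k t)"
  using sg by (simp add: normal_def norm_mult)

lemma normal_nonzero: "k < K \<Longrightarrow> cmod (normal k t) > 0"
  using cmod_normal smooth_curve.nonzero[OF curve] by simp

text \<open>By \<open>shift_distance\<close> every boundary point is at least the radius away from
  the centre, so the ball misses the frontier. It is the disc for the Schwarz-Pick estimate; its
  mirror image \<open>outer_ball\<close> is the exterior disc for the minimum principle.\<close>

lemma inner_ball:
  assumes k: "k < K" and e: "0 < e" "e \<le> r"
  shows "ball (shift k e t) (e * cmod (normal k t)) \<subseteq> \<Omega>"
proof (rule connected_disjoint_frontier[OF connected_ball])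
  have "e * cmod (normal k t) \<le> dist (shift k e t) (\<Gamma> l s)" if "l < K" for l s
  proof (rule power2_le_imp_le)
    show "(e * cmod (normal k t))\<^sup>2 \<le> (dist (shift k e t) (\<Gamma> l s))\<^sup>2"
      using shift_distance(2)[OF k that less_imp_le[OF e(1)] e(2), of s t] zero_le_power2[of "cmod (\<Gamma> l s - \<Gamma> k t)"]
      unfolding cmod_normal[OF k] dist_norm norm_minus_commute[of "shift k e t"] by linarith
  qed simp
  then show "ball (shift k e t) (e * cmod (normal k t)) \<inter> frontier \<Omega> = {}"
    unfolding frontier_ranges by (force simp: not_less[symmetric])
  have "shift k e t \<in> ball (shift k e t) (e * cmod (normal k t))" using e(1) normal_nonzero[OF k] by simp
  then show "ball (shift k e t) (e * cmod (normal k t)) \<inter> \<Omega> \<noteq> {}" using shift_in[OF k e] by blast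
qed

lemma outer_ball:
  assumes k: "k < K" and e: "0 < e" "e \<le> r"
  shows "ball (shift k (- e) t) (e * cmod (normal k t)) \<inter> \<Omega> = {}"
proof (rule ccontr)
  assume *: "\<not> ?thesis"
  have "e * cmod (normal k t) \<le> dist (shift k (- e) t) (\<Gamma> l s)" if "l < K" for l s
  proof (rule power2_le_imp_le)
    show "(e * cmod (normal k t))\<^sup>2 \<le> (dist (shift k (- e) t) (\<Gamma> l s))\<^sup>2"
      using shift_distance(1)[OF k that less_imp_le[OF e(1)] e(2), of s t] zero_le_power2[of "cmod (\<Gamma> l s - \<Gamma> k t)"]
      unfolding cmod_normal[OF k] dist_norm norm_minus_commute[of "shift k (- e) t"] by linarith
  qed simp
  then have "ball (shift k (- e) t) (e * cmod (normal k t)) \<inter> frontier \<Omega> = {}"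
    unfolding frontier_ranges by (force simp: not_less[symmetric])
  then have "ball (shift k (- e) t) (e * cmod (normal k t)) \<subseteq> \<Omega>"
    using * by (intro connected_disjoint_frontier[OF connected_ball]) auto
  moreover have "shift k (- e) t \<in> ball (shift k (- e) t) (e * cmod (normal k t))"
    using e(1) normal_nonzero[OF k] by simp
  ultimately show False using shift_notin[OF k e, of t] closure_subset by blast
qed

text \<open>The Lipschitz bound forces equal normals at equal points. A boundary point with several
  parameters thus has a single normal segment, and a limit along it does not depend on the
  parameter.\<close>

lemma normal_unique:
  assumes "k < K" "l < K" "\<Gamma> k t = \<Gamma> l s"
  shows "shift k e t = shift l e s"
  using normal_lipschitz[OF assms(1,2), of s t] assms(3) by (simp add: shift_def normal_def)

lemma shift_tendsto: "((\<lambda>e. shift k e t) \<longlongrightarrow> \<Gamma> k t) (at_right 0)"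
  unfolding shift_def by (auto intro!: tendsto_eq_intros)

text \<open>The given \<open>h\<close> may have arbitrary values on the boundary; they are replaced
  by its limits along normals, chosen pointwise and consistent because normals are unique.\<close>

lemma bdd_hol_extension:
  assumes hol: "h holomorphic_on \<Omega>" and B: "\<And>z. z \<in> \<Omega> \<Longrightarrow> cmod (h z) \<le> B"
    and lim: "\<And>k t. k < K \<Longrightarrow> \<exists>l. ((\<lambda>e. h (shift k e t)) \<longlongrightarrow> l) (at_right 0)"
  obtains F where "bdd_hol F" "\<And>z. z \<in> \<Omega> \<Longrightarrow> F z = h z"
proof -
  define F where "F z = (if z \<in> \<Omega> then h z else SOME l. \<exists>k<K. \<exists>t. z = \<Gamma> k t \<and> ((\<lambda>e. h (shift k e t)) \<longlongrightarrow> l) (at_right 0))" for z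
  have F\<Omega>: "F z = h z" if "z \<in> \<Omega>" for z using that by (simp add: F_def)
  have "((\<lambda>e. F (shift k e t)) \<longlongrightarrow> F (\<Gamma> k t)) (at_right 0)" if k: "k < K" for k t
  proof -
    have "\<exists>l. \<exists>k'<K. \<exists>t'. \<Gamma> k t = \<Gamma> k' t' \<and> ((\<lambda>e. h (shift k' e t')) \<longlongrightarrow> l) (at_right 0)" using lim k by blast
    then have "\<exists>k'<K. \<exists>t'. \<Gamma> k t = \<Gamma> k' t' \<and> ((\<lambda>e. h (shift k' e t')) \<longlongrightarrow> F (\<Gamma> k t)) (at_right 0)"
      unfolding F_def using \<Gamma>_notin[OF k, of t] by (simp only: if_False) (rule someI_ex)
    then obtain k' t' where kt: "k' < K" "\<Gamma> k t = \<Gamma> k' t'" "((\<lambda>e. h (shift k' e t')) \<longlongrightarrow> F (\<Gamma> k t)) (at_right 0)" by blast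
    have "shift k' e t' = shift k e t" for e using normal_unique[OF k kt(1,2)] by simp
    then have "((\<lambda>e. h (shift k e t)) \<longlongrightarrow> F (\<Gamma> k t)) (at_right 0)" using kt(3) by simp
    moreover have "\<forall>\<^sub>F e in at_right 0. F (shift k e t) = h (shift k e t)"
      using eventually_at_right_real[OF r] by eventually_elim (use shift_in[OF k] in \<open>auto intro!: F\<Omega>\<close>)
    ultimately show ?thesis by (simp add: tendsto_cong)
  qed
  moreover have "F holomorphic_on \<Omega>" using hol by (rule holomorphic_transform) (simp add: F\<Omega>)
  ultimately have "bdd_hol F" unfolding bdd_hol_def using B F\<Omega> by auto
  then show ?thesis using that F\<Omega> by blast
qed

section \<open>Boundary values of a proper map\<close>

context
  fixes f :: "complex \<Rightarrow> complex"
  assumes hol: "f holomorphic_on \<Omega>" and proper: "proper_to_disc \<Omega> f"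
begin

lemma map_to_disc: "z \<in> \<Omega> \<Longrightarrow> cmod (f z) < 1"
  using proper unfolding proper_to_disc_def by auto

lemma eventually_off_compact:
  assumes "compact A" "A \<subseteq> \<Omega>" "k < K"
  shows "\<forall>\<^sub>F e in at_right 0. shift k e t \<notin> A"
proof -
  have "open (- A)" using assms(1) by (simp add: compact_imp_closed open_Compl)
  moreover have "\<Gamma> k t \<in> - A" using \<Gamma>_notin[OF assms(3)] assms(2) by blast
  ultimately have "\<forall>\<^sub>F e in at_right 0. shift k e t \<in> - A" by (rule topological_tendstoD[OF shift_tendsto])
  then show ?thesis by eventually_elim simp
qed

lemma eventually_large:
  assumes "k < K" "x < 1"
  shows "\<forall>\<^sub>F e in at_right 0. x < cmod (f (shift k e t))"
proof -
  have "compact {z\<in>\<Omega>. f z \<in> cball 0 x}"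
    using proper assms(2) unfolding proper_to_disc_def
    by (elim conjE allE[of _ "cball 0 x"]) (auto simp: subset_eq)
  from eventually_off_compact[OF this _ assms(1), of t]
  have "\<forall>\<^sub>F e in at_right 0. shift k e t \<notin> {z\<in>\<Omega>. f z \<in> cball 0 x}" by auto
  then show ?thesis using eventually_at_right_real[OF r]
    by eventually_elim (use shift_in[OF assms(1)] in auto)
qed

lemma norm_tendsto_1:
  assumes k: "k < K"
  shows "((\<lambda>e. cmod (f (shift k e t))) \<longlongrightarrow> 1) (at_right 0)"
proof (rule order_tendstoI)
  show "\<forall>\<^sub>F e in at_right 0. x < cmod (f (shift k e t))" if "x < 1" for x by (rule eventually_large[OF k that])
  show "\<forall>\<^sub>F e in at_right 0. cmod (f (shift k e t)) < x" if "1 < x" for x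
    using eventually_at_right_real[OF r]
  proof eventually_elim
    case (elim e)
    then have "cmod (f (shift k e t)) < 1" using shift_in[OF k, of e t] by (intro map_to_disc) auto
    then show ?case using that by simp
  qed
qed

text \<open>Both touching balls are used. The exterior one bounds \<open>1 - cmod (f z)\<close> by a
  multiple of \<open>e\<close>; the interior one has radius proportional to \<open>e\<close>, so the
  factor \<open>e\<close> cancels in the Schwarz-Pick estimate.\<close>

lemma deriv_bound_along_normal:
  assumes k: "k < K"
  shows "\<exists>L. \<forall>\<^sub>F e in at_right 0. cmod (deriv f (shift k e t) * normal k t) \<le> L"
proof -
  define \<nu> where "\<nu> = cmod (normal k t)"
  have \<nu>: "\<nu> > 0" using normal_nonzero[OF k] by (simp add: \<nu>_def)
  have "\<exists>n. \<forall>z\<in>\<Omega>. 1/2 < cmod (f z) \<longrightarrow> (r * \<nu> / cmod (z - shift k (- r) t)) ^ n \<le> cmod (f z)"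
    using outer_ball[OF k r order.refl, of t] r \<nu>
    by (intro proper_map_lower_bound[OF \<Omega>(1,4) hol proper]) (auto simp: \<nu>_def)
  then obtain n where n: "\<And>z. z \<in> \<Omega> \<Longrightarrow> 1/2 < cmod (f z) \<Longrightarrow> (r * \<nu> / cmod (z - shift k (- r) t)) ^ n \<le> cmod (f z)" by blast
  have "\<forall>\<^sub>F e in at_right 0. 1/2 < cmod (f (shift k e t))" by (rule eventually_large[OF k]) simp
  then have "\<forall>\<^sub>F e in at_right 0. cmod (deriv f (shift k e t) * normal k t) \<le> 2 * n / r"
    using eventually_at_right_real[OF r]
  proof eventually_elim
    case (elim e)
    then have e: "0 < e" "e < r" "e \<le> r" by auto
    have z: "shift k e t \<in> \<Omega>" by (rule shift_in[OF k e(1,3)])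
    have "shift k e t - shift k (- r) t = (e + r) *\<^sub>R normal k t" by (simp add: shift_def algebra_simps)
    then have dist: "cmod (shift k e t - shift k (- r) t) = (e + r) * \<nu>" using e r by (simp add: \<nu>_def)
    \<comment> \<open>Bernoulli's inequality turns the power of the ratio of distances
      \<open>r / (e + r)\<close> into a lower bound linear in \<open>e\<close>.\<close>
    have "1 - n * (e / r) \<le> (1 - e / r) ^ n" using Bernoulli_inequality[of "- (e / r)" n] e r by simp
    also have "\<dots> \<le> (r / (e + r)) ^ n"
    proof (rule power_mono)
      have "(1 - e / r) * (e + r) \<le> r" using e r by (simp add: field_simps)
      then show "1 - e / r \<le> r / (e + r)" using e r by (simp add: pos_le_divide_eq)
    qed (use e r in simp)
    also have "r / (e + r) = r * \<nu> / ((e + r) * \<nu>)" using \<nu> by simp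
    also have "(r * \<nu> / ((e + r) * \<nu>)) ^ n \<le> cmod (f (shift k e t))" using n[OF z elim(1)] unfolding dist .
    finally have low: "1 - cmod (f (shift k e t)) \<le> n * (e / r)" by simp
    have ball: "ball (shift k e t) (e * \<nu>) \<subseteq> \<Omega>" using inner_ball[OF k e(1,3), of t] by (simp add: \<nu>_def)
    have "cmod (deriv f (shift k e t)) * (e * \<nu>) \<le> 2 * (1 - cmod (f (shift k e t)))"
      using ball map_to_disc e(1) \<nu> by (intro Schwarz_Pick_deriv holomorphic_on_subset[OF hol]) auto
    also have "\<dots> \<le> (2 * n / r) * e" using low by simp
    finally have "(cmod (deriv f (shift k e t)) * \<nu>) * e \<le> (2 * n / r) * e" by (simp add: mult_ac)
    then have "cmod (deriv f (shift k e t)) * \<nu> \<le> 2 * n / r" using e(1) by (rule mult_right_le_imp_le)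
    then show ?case by (simp add: norm_mult \<nu>_def)
  qed
  then show ?thesis by blast
qed

lemma normal_limit_exists:
  assumes k: "k < K"
  shows "\<exists>l. ((\<lambda>e. f (shift k e t)) \<longlongrightarrow> l) (at_right 0)"
proof -
  obtain L0 where "\<forall>\<^sub>F e in at_right 0. cmod (deriv f (shift k e t) * normal k t) \<le> L0"
    using deriv_bound_along_normal[OF k] by blast
  then obtain b where b: "b > 0" "\<And>e. 0 < e \<Longrightarrow> e < b \<Longrightarrow> cmod (deriv f (shift k e t) * normal k t) \<le> L0"
    unfolding eventually_at_right_field by blast
  define L where "L = \<bar>L0\<bar> + 1"
  define b' where "b' = min b r"
  have b': "b' > 0" using b r by (simp add: b'_def)
  have lip: "cmod (f (shift k x t) - f (shift k y t)) \<le> L * \<bar>x - y\<bar>" if "0 < x" "x < b'" "0 < y" "y < b'" for x y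
  proof (rule vector_derivative_bound)
    fix e assume "e \<in> closed_segment y x"
    then have e: "0 < e" "e < b" "e \<le> r" using that by (auto simp: closed_segment_eq_real_ivl b'_def split: if_splits)
    have "((\<lambda>e. shift k e t) has_vector_derivative normal k t) (at e)"
      unfolding shift_def by (auto intro!: derivative_eq_intros)
    moreover have "(f has_field_derivative deriv f (shift k e t)) (at (shift k e t))"
      using holomorphic_derivI[OF hol \<Omega>(1) shift_in[OF k e(1,3)]] .
    ultimately have "(f \<circ> (\<lambda>e. shift k e t) has_vector_derivative normal k t * deriv f (shift k e t)) (at e)"
      by (rule field_vector_diff_chain_at)
    then show "((\<lambda>e. f (shift k e t)) has_vector_derivative normal k t * deriv f (shift k e t)) (at e)" by (simp add: o_def)
    show "cmod (normal k t * deriv f (shift k e t)) \<le> L" using b(2)[OF e(1,2)] by (simp add: L_def mult.commute)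
  qed
  have L: "L > 0" by (simp add: L_def)
  define x where "x n = b' / 2 * inverse (real (Suc n))" for n
  have x: "0 < x n" "x n < b'" for n
  proof -
    have "inverse (real (Suc n)) \<le> 1" by (simp add: field_simps)
    then have "x n \<le> b' / 2 * 1" unfolding x_def using b' by (intro mult_left_mono) auto
    then show "0 < x n" "x n < b'" using b' by (auto simp: x_def)
  qed
  have x0: "x \<longlonglongrightarrow> 0" unfolding x_def using tendsto_mult_left[OF LIMSEQ_inverse_real_of_nat, of "b' / 2"] by simp
  have "Cauchy (\<lambda>n. f (shift k (x n) t))"
  proof (rule CauchyI)
    fix e :: real assume e: "e > 0"
    have "Cauchy x" using x0 by (simp add: LIMSEQ_imp_Cauchy)
    then obtain N where N: "\<And>i j. i \<ge> N \<Longrightarrow> j \<ge> N \<Longrightarrow> norm (x i - x j) < e / L"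
      using CauchyD[of x "e / L"] e L by auto
    show "\<exists>N. \<forall>i\<ge>N. \<forall>j\<ge>N. norm (f (shift k (x i) t) - f (shift k (x j) t)) < e"
    proof (intro exI[of _ N] allI impI)
      fix i j assume "i \<ge> N" "j \<ge> N"
      then have "L * \<bar>x i - x j\<bar> < L * (e / L)" using N[of i j] L by (intro mult_strict_left_mono) auto
      then show "norm (f (shift k (x i) t) - f (shift k (x j) t)) < e" using lip[OF x x, of i j] L by simp
    qed
  qed
  then obtain l where l: "(\<lambda>n. f (shift k (x n) t)) \<longlonglongrightarrow> l" using Cauchy_convergent convergent_def by blast
  have bound: "cmod (f (shift k e t) - l) \<le> L * e" if e: "0 < e" "e < b'" for e
  proof (rule LIMSEQ_le)
    show "(\<lambda>n. cmod (f (shift k e t) - f (shift k (x n) t))) \<longlonglongrightarrow> cmod (f (shift k e t) - l)" by (intro tendsto_intros l)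
    have "(\<lambda>n. L * \<bar>e - x n\<bar>) \<longlonglongrightarrow> L * \<bar>e - 0\<bar>" by (intro tendsto_intros x0)
    then show "(\<lambda>n. L * \<bar>e - x n\<bar>) \<longlonglongrightarrow> L * e" using e by simp
  qed (use lip[OF e x] in blast)
  have "((\<lambda>e. f (shift k e t) - l) \<longlongrightarrow> 0) (at_right 0)"
  proof (rule Lim_null_comparison)
    show "\<forall>\<^sub>F e in at_right 0. norm (f (shift k e t) - l) \<le> L * e"
      using eventually_at_right_real[OF b'] by eventually_elim (use bound in auto)
    show "((\<lambda>e. L * e) \<longlongrightarrow> 0) (at_right 0)" by (auto intro!: tendsto_eq_intros)
  qed
  then show ?thesis using Lim_null by blast
qed

lemma inner_extension:
  obtains F where "bdd_hol F" "\<And>z. z \<in> \<Omega> \<Longrightarrow> F z = f z" "\<And>z. z \<in> frontier \<Omega> \<Longrightarrow> cmod (F z) = 1"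
proof (rule bdd_hol_extension[OF hol, of 1], goal_cases)
  case (1 z)
  then show ?case using map_to_disc[of z] by simp
next
  case (2 k t)
  then show ?case by (intro normal_limit_exists) simp
next
  case (3 F)
  have "cmod (F (\<Gamma> k t)) = 1" if k: "k < K" for k t
  proof -
    have "((\<lambda>e. cmod (F (shift k e t))) \<longlongrightarrow> cmod (F (\<Gamma> k t))) (at_right 0)"
      using 3(2) k unfolding bdd_hol_def by (intro tendsto_norm) blast
    moreover have "\<forall>\<^sub>F e in at_right 0. cmod (F (shift k e t)) = cmod (f (shift k e t))"
      using eventually_at_right_real[OF r] by eventually_elim (use shift_in[OF k] 3(3) in auto)
    ultimately have "((\<lambda>e. cmod (f (shift k e t))) \<longlongrightarrow> cmod (F (\<Gamma> k t))) (at_right 0)"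
      by (simp add: tendsto_cong)
    then show ?thesis using tendsto_unique[OF _ _ norm_tendsto_1[OF k]] by simp
  qed
  then show ?thesis
    using frontier_eq_\<Gamma>[of "\<lambda>z. cmod (F z) = 1"] by (intro 3(1)[OF 3(2,3)]) auto
qed

text \<open>Off the compact set where \<open>cmod (f z)\<close> is at most 1/2, \<open>q\<close>
  equals \<open>p / f\<close>; on that set it is continuous. So \<open>q\<close> is bounded and its
  normal limits are \<open>p / F\<close>. Applied to the polynomial with the zeros of
  \<open>f\<close>, this writes that polynomial as \<open>F\<close> times a function in
  \<open>bdd_hol\<close>.\<close>

lemma quotient_extension:
  assumes F: "bdd_hol F" "\<And>z. z \<in> \<Omega> \<Longrightarrow> F z = f z" "\<And>z. z \<in> frontier \<Omega> \<Longrightarrow> cmod (F z) = 1"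
    and p: "bdd_hol p" and q: "q holomorphic_on \<Omega>" "\<And>z. z \<in> \<Omega> \<Longrightarrow> p z = f z * q z"
  obtains Q where "bdd_hol Q" "\<And>z. z \<in> \<Omega> \<Longrightarrow> Q z = q z" "\<And>z. z \<in> closure \<Omega> \<Longrightarrow> p z = F z * Q z"
proof -
  obtain B where B: "B > 0" "\<And>z. z \<in> closure \<Omega> \<Longrightarrow> cmod (p z) \<le> B" by (rule bdd_hol_bound[OF p]) (rule that)
  define A where "A = {z\<in>\<Omega>. f z \<in> cball 0 (1/2)}"
  have "compact A" using proper unfolding proper_to_disc_def A_def
    by (elim conjE allE[of _ "cball 0 (1/2)"]) (auto simp: subset_eq)
  then have "compact (q ` A)"
    by (rule compact_continuous_image[rotated])
       (rule continuous_on_subset[OF holomorphic_on_imp_continuous_on[OF q(1)]], auto simp: A_def)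
  then have "bounded (q ` A)" by (rule compact_imp_bounded)
  then obtain B' where B': "\<And>z. z \<in> A \<Longrightarrow> cmod (q z) \<le> B'" by (auto simp: bounded_iff)
  have bound: "cmod (q z) \<le> max B' (2 * B)" if z: "z \<in> \<Omega>" for z
  proof (cases "z \<in> A")
    case False
    then have f: "1/2 < cmod (f z)" using z by (auto simp: A_def)
    then have "q z = p z / f z" using q(2)[OF z] by auto
    moreover have "cmod (p z) \<le> B" using z closure_subset by (intro B(2)) blast
    ultimately have "cmod (q z) \<le> B / (1/2)"
      unfolding norm_divide using f B(1) by (simp only: norm_divide) (intro frac_le, auto)
    then show ?thesis by (simp add: le_max_iff_disj)
  qed (use B' in \<open>simp add: le_max_iff_disj\<close>)
  have lim: "((\<lambda>e. q (shift k e t)) \<longlongrightarrow> p (\<Gamma> k t) / F (\<Gamma> k t)) (at_right 0)" if k: "k < K" for k t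
  proof -
    have "F (\<Gamma> k t) \<noteq> 0" using F(3)[OF \<Gamma>_in_frontier[OF k, of t]] by auto
    moreover have "((\<lambda>e. F (shift k e t)) \<longlongrightarrow> F (\<Gamma> k t)) (at_right 0)" "((\<lambda>e. p (shift k e t)) \<longlongrightarrow> p (\<Gamma> k t)) (at_right 0)"
      using F(1) p k unfolding bdd_hol_def by blast+
    ultimately have "((\<lambda>e. p (shift k e t) / F (shift k e t)) \<longlongrightarrow> p (\<Gamma> k t) / F (\<Gamma> k t)) (at_right 0)" by (intro tendsto_intros)
    moreover have "\<forall>\<^sub>F e in at_right 0. p (shift k e t) / F (shift k e t) = q (shift k e t)"
      using eventually_at_right_real[OF r] eventually_large[OF k, of 0 t, simplified]
    proof eventually_elim
      case (elim e)
      then have z: "shift k e t \<in> \<Omega>" by (intro shift_in[OF k]) auto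
      show ?case using q(2)[OF z] F(2)[OF z] elim by auto
    qed
    ultimately show ?thesis by (simp add: tendsto_cong)
  qed
  show ?thesis
  proof (rule bdd_hol_extension[OF q(1) bound], goal_cases)
    case (2 k t)
    then show ?case using lim by blast
  next
    case (3 Q)
    have "Q (\<Gamma> k t) = p (\<Gamma> k t) / F (\<Gamma> k t)" if k: "k < K" for k t
    proof -
      have "((\<lambda>e. Q (shift k e t)) \<longlongrightarrow> Q (\<Gamma> k t)) (at_right 0)" using 3(1) k unfolding bdd_hol_def by blast
      moreover have "\<forall>\<^sub>F e in at_right 0. Q (shift k e t) = q (shift k e t)"
        using eventually_at_right_real[OF r] by eventually_elim (use shift_in[OF k] 3(2) in auto)
      ultimately have "((\<lambda>e. q (shift k e t)) \<longlongrightarrow> Q (\<Gamma> k t)) (at_right 0)" by (simp add: tendsto_cong)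
      then show ?thesis using tendsto_unique[OF _ _ lim[OF k]] by simp
    qed
    moreover have "F (\<Gamma> k t) \<noteq> 0" if "k < K" for k t using F(3)[OF \<Gamma>_in_frontier[OF that, of t]] by auto
    ultimately have "p z = F z * Q z" if "z \<in> frontier \<Omega>" for z
      using that unfolding frontier_ranges by auto
    moreover have "p z = F z * Q z" if "z \<in> \<Omega>" for z using that q(2) F(2) 3(2) by simp
    ultimately show ?thesis using 3 by (intro that[of Q]) (auto simp: closure_Un_frontier)
  qed
qed

end

end

subsection \<open>The kernel formula\<close>

lemma factor_power_of_derivs:
  assumes hol: "H holomorphic_on ball a s" and s: "s > 0" and zero: "\<And>n. n < M \<Longrightarrow> (deriv ^^ n) H a = 0"
  shows "\<exists>g. g holomorphic_on ball a s \<and> (\<forall>w\<in>ball a s. H w = (w - a) ^ M * g w)"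
proof -
  define c where "c n = (deriv ^^ n) H a / fact n" for n
  define g where "g w = (if w = a then c M else H w / (w - a) ^ M)" for w
  have H: "(\<lambda>n. c n * (w - a) ^ n) sums H w" if "w \<in> ball a s" for w
    using holomorphic_power_series[OF hol that] by (simp add: c_def)
  have c0: "c n = 0" if "n < M" for n using zero[OF that] by (simp add: c_def)
  have g: "(\<lambda>n. c (n + M) * (w - a) ^ n) sums g w" if w: "w \<in> ball a s" for w
  proof (cases "w = a")
    case True
    have "(\<lambda>n. c (n + M) * (w - a) ^ n) = (\<lambda>n. if n = 0 then c M else 0)" using True by (auto simp: fun_eq_iff)
    then show ?thesis using sums_single[of 0 "\<lambda>_. c M"] True by (simp add: g_def)
  next
    case False
    have "(\<lambda>n. c (n + M) * (w - a) ^ (n + M)) sums (H w - (\<Sum>n<M. c n * (w - a) ^ n))"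
      using sums_split_initial_segment[OF H[OF w], of M] .
    then have "(\<lambda>n. c (n + M) * (w - a) ^ (n + M)) sums H w" by (simp add: c0)
    then have "(\<lambda>n. c (n + M) * (w - a) ^ (n + M) / (w - a) ^ M) sums (H w / (w - a) ^ M)" by (rule sums_divide)
    then show ?thesis using False by (simp add: g_def power_add)
  qed
  have "g holomorphic_on ball a s" using g by (rule power_series_holomorphic)
  moreover have "H w = (w - a) ^ M * g w" if w: "w \<in> ball a s" for w
  proof (cases "w = a")
    case True
    have "H a = c 0" using sums_unique2[OF H[of a]] s sums_single[of 0 "\<lambda>_. c 0"]
      by (metis (no_types, lifting) c_def centre_in_ball div_by_1 fact_0 funpow_0)
    then show ?thesis using True c0[of 0] by (cases "M = 0") (auto simp: g_def)
  qed (simp add: g_def)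
  ultimately show ?thesis by blast
qed

text \<open>Induction over the points: dividing by one factor leaves a function holomorphic on
  \<open>S\<close>, and the local factorisation at each other point persists, its cofactor being
  divided by a function without zeros nearby.\<close>

lemma factor_out_zeros:
  assumes "finite I" "open S" "H holomorphic_on S" "inj_on a I"
    and "\<And>i. i \<in> I \<Longrightarrow> \<exists>s g. s > 0 \<and> ball (a i) s \<subseteq> S \<and> g holomorphic_on ball (a i) s \<and>
      (\<forall>w\<in>ball (a i) s. H w = (w - a i) ^ M i * g w)"
  shows "\<exists>E. E holomorphic_on S \<and> (\<forall>z\<in>S. H z = (\<Prod>i\<in>I. (z - a i) ^ M i) * E z)"
  using assms(1,3,4,5)
proof (induction I arbitrary: H rule: finite_induct)
  case empty
  then show ?case by auto
next
  case (insert i I)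
  obtain s g where sg: "s > 0" "ball (a i) s \<subseteq> S" "g holomorphic_on ball (a i) s"
    "\<And>w. w \<in> ball (a i) s \<Longrightarrow> H w = (w - a i) ^ M i * g w" using insert.prems(3)[of i] by blast
  define H1 where "H1 z = (if z = a i then g z else H z / (z - a i) ^ M i)" for z
  have H1g: "H1 w = g w" if "w \<in> ball (a i) s" for w using sg(4)[OF that] by (simp add: H1_def)
  have HH1: "H z = (z - a i) ^ M i * H1 z" if "z \<in> S" for z
    using sg(1) sg(4)[of "a i"] by (simp add: H1_def)
  have "H1 holomorphic_on (S - {a i}) \<union> ball (a i) s"
  proof (rule holomorphic_on_Un)
    have "(\<lambda>z. H z / (z - a i) ^ M i) holomorphic_on S - {a i}"
      by (intro holomorphic_intros holomorphic_on_subset[OF insert.prems(1)]) auto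
    then show "H1 holomorphic_on S - {a i}" by (rule holomorphic_transform) (simp add: H1_def)
    show "H1 holomorphic_on ball (a i) s" using sg(3) by (rule holomorphic_transform) (simp add: H1g)
  qed (use assms(2) in auto)
  moreover have "S \<subseteq> (S - {a i}) \<union> ball (a i) s" using sg(1) by auto
  ultimately have hol1: "H1 holomorphic_on S" by (rule holomorphic_on_subset)
  have "\<exists>E. E holomorphic_on S \<and> (\<forall>z\<in>S. H1 z = (\<Prod>i\<in>I. (z - a i) ^ M i) * E z)"
  proof (rule insert.IH[OF hol1])
    show "inj_on a I" using insert.prems(2) by simp
    fix j assume j: "j \<in> I"
    then have ne: "a j \<noteq> a i" using insert.prems(2) insert.hyps(2) by (auto simp: inj_on_def)
    obtain s' g' where sg': "s' > 0" "ball (a j) s' \<subseteq> S" "g' holomorphic_on ball (a j) s'"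
      "\<And>w. w \<in> ball (a j) s' \<Longrightarrow> H w = (w - a j) ^ M j * g' w" using insert.prems(3)[of j] j by blast
    define s'' where "s'' = min s' (dist (a j) (a i))"
    have sub: "ball (a j) s'' \<subseteq> ball (a j) s'" "a i \<notin> ball (a j) s''" by (auto simp: s''_def)
    show "\<exists>s g. s > 0 \<and> ball (a j) s \<subseteq> S \<and> g holomorphic_on ball (a j) s \<and>
      (\<forall>w\<in>ball (a j) s. H1 w = (w - a j) ^ M j * g w)"
    proof (intro exI[of _ s''] exI[of _ "\<lambda>w. g' w / (w - a i) ^ M i"] conjI ballI)
      show "s'' > 0" using sg'(1) ne by (simp add: s''_def)
      show "ball (a j) s'' \<subseteq> S" using sub sg' by blast
      show "(\<lambda>w. g' w / (w - a i) ^ M i) holomorphic_on ball (a j) s''"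
        using sub(2) by (intro holomorphic_intros holomorphic_on_subset[OF sg'(3) sub(1)]) auto
      fix w assume w: "w \<in> ball (a j) s''"
      then have "w \<noteq> a i" using sub(2) by blast
      then show "H1 w = (w - a j) ^ M j * (g' w / (w - a i) ^ M i)"
        using sg'(4)[OF subsetD[OF sub(1) w]] by (simp add: H1_def)
    qed
  qed
  then obtain E where E: "E holomorphic_on S" "\<And>z. z \<in> S \<Longrightarrow> H1 z = (\<Prod>i\<in>I. (z - a i) ^ M i) * E z" by blast
  then show ?case
    using insert.hyps HH1 by (intro exI[of _ E]) (auto simp: mult_ac)
qed

text \<open>A form of Gaussian elimination: elements \<open>X s\<close> are found such that
  subtracting their combination sends every \<open>H\<close> into the common kernel of the
  functionals. They are a dual system when the functionals are independent on \<open>V\<close>; a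
  functional that depends on those already treated receives the zero function.\<close>

lemma finite_functionals_dual:
  fixes V :: "('a \<Rightarrow> complex) set" and l :: "'s \<Rightarrow> ('a \<Rightarrow> complex) \<Rightarrow> complex"
  assumes "finite S"
    and V: "\<And>F G a b. F \<in> V \<Longrightarrow> G \<in> V \<Longrightarrow> (\<lambda>z. a * F z + b * G z) \<in> V" "(\<lambda>_. 0) \<in> V"
    and l: "\<And>s F G a b. F \<in> V \<Longrightarrow> G \<in> V \<Longrightarrow> l s (\<lambda>z. a * F z + b * G z) = a * l s F + b * l s G"
  shows "\<exists>X. (\<forall>s\<in>S. X s \<in> V) \<and> (\<forall>H\<in>V. \<forall>t\<in>S. l t (\<lambda>z. H z - (\<Sum>s\<in>S. l s H * X s z)) = 0)"
proof -
  have lz: "l s (\<lambda>_. 0) = 0" for s using l[OF V(2) V(2), of s 0 0] by simp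
  have Vs: "(\<lambda>z. \<Sum>s\<in>S. c s * X s z) \<in> V" if "finite S" "\<forall>s\<in>S. X s \<in> V" for c X and S :: "'s set"
    using that
  proof (induction S rule: finite_induct)
    case (insert s S)
    then show ?case using V(1)[of "X s" "\<lambda>z. \<Sum>s\<in>S. c s * X s z" "c s" 1] by simp
  qed (simp add: V(2))
  have ls: "l t (\<lambda>z. \<Sum>s\<in>S. c s * X s z) = (\<Sum>s\<in>S. c s * l t (X s))" if "finite S" "\<forall>s\<in>S. X s \<in> V" for c X t and S :: "'s set"
    using that
  proof (induction S rule: finite_induct)
    case (insert s S)
    then show ?case using l[of "X s" "\<lambda>z. \<Sum>s\<in>S. c s * X s z" t "c s" 1] Vs[of S X c] by simp
  qed (simp add: lz)
  have Vd: "(\<lambda>z. H z - G z) \<in> V" if "H \<in> V" "G \<in> V" for H G using V(1)[OF that, of 1 "-1"] by simp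
  have ld: "l s (\<lambda>z. H z - G z) = l s H - l s G" if "H \<in> V" "G \<in> V" for s H G using l[OF that, of s 1 "-1"] by simp
  have Vc: "(\<lambda>z. c * G z) \<in> V" if "G \<in> V" for c G using V(1)[OF that that, of c 0] by simp
  have lc: "l s (\<lambda>z. c * G z) = c * l s G" if "G \<in> V" for s c G using l[OF that that, of s c 0] by simp
  show ?thesis
    using assms(1)
  proof (induction S rule: finite_induct)
    case (insert s S)
    then obtain X where X: "\<forall>s\<in>S. X s \<in> V" "\<And>H t. H \<in> V \<Longrightarrow> t \<in> S \<Longrightarrow> l t (\<lambda>z. H z - (\<Sum>s\<in>S. l s H * X s z)) = 0"
      by blast
    define R where "R H = (\<lambda>z. H z - (\<Sum>s\<in>S. l s H * X s z))" for H
    have sV: "(\<lambda>z. \<Sum>s\<in>S. c s * X s z) \<in> V" for c by (rule Vs[OF insert.hyps(1) X(1)])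
    have R: "R H \<in> V" "\<And>t. t \<in> S \<Longrightarrow> l t (R H) = 0" "\<And>t. l t (R H) = l t H - (\<Sum>s\<in>S. l s H * l t (X s))" if "H \<in> V" for H
    proof -
      show "R H \<in> V" unfolding R_def by (rule Vd[OF that sV])
      show "l t (R H) = 0" if "t \<in> S" for t using X(2)[OF \<open>H \<in> V\<close> that] by (simp add: R_def)
      show "l t (R H) = l t H - (\<Sum>s\<in>S. l s H * l t (X s))" for t
        unfolding R_def ld[OF that sV] ls[OF insert.hyps(1) X(1)] ..
    qed
    show ?case
    proof (cases "\<exists>H\<in>V. l s (R H) \<noteq> 0")
      case False
      define Y where "Y t = (if t = s then (\<lambda>_. 0) else X t)" for t
      have YX: "Y t = X t" if "t \<in> S" for t using that insert.hyps(2) by (auto simp: Y_def)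
      have "(\<lambda>z. H z - (\<Sum>t\<in>insert s S. l t H * Y t z)) = R H" for H
        using insert.hyps YX by (simp add: R_def Y_def[of s] cong: sum.cong)
      moreover have "\<forall>t\<in>insert s S. Y t \<in> V" using X(1) YX V(2) by (auto simp: Y_def)
      ultimately show ?thesis using False R(2) by (intro exI[of _ Y]) auto
    next
      case True
      then obtain H0 where H0: "H0 \<in> V" "l s (R H0) \<noteq> 0" by blast
      \<comment> \<open>On the residuals \<open>R H\<close> the earlier functionals vanish.
        Normalising a residual with \<open>l s (R H0) \<noteq> 0\<close> gives an element dual to
        \<open>l s\<close>, which then corrects the other \<open>X t\<close>.\<close>
      define W where "W = (\<lambda>z. (1 / l s (R H0)) * R H0 z)"
      have "W \<in> V" unfolding W_def by (rule Vc[OF R(1)[OF H0(1)]])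
      moreover have "l s W = 1" "\<And>t. t \<in> S \<Longrightarrow> l t W = 0"
        using H0(2) R(2)[OF H0(1)] unfolding W_def lc[OF R(1)[OF H0(1)]] by simp_all
      ultimately have W: "W \<in> V" "l s W = 1" "\<And>t. t \<in> S \<Longrightarrow> l t W = 0" by auto
      define Y where "Y t = (if t = s then W else (\<lambda>z. X t z - l s (X t) * W z))" for t
      have Ys: "Y s = W" and Yt: "\<And>t. t \<in> S \<Longrightarrow> Y t = (\<lambda>z. X t z - l s (X t) * W z)"
        using insert.hyps(2) by (auto simp: Y_def)
      have YV: "\<forall>t\<in>insert s S. Y t \<in> V" using Ys Yt W(1) X(1) Vd Vc by auto
      have eq: "(\<lambda>z. H z - (\<Sum>t\<in>insert s S. l t H * Y t z)) = (\<lambda>z. R H z - l s (R H) * W z)" if H: "H \<in> V" for H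
      proof
        fix z
        have "(\<Sum>t\<in>S. l t H * Y t z) = (\<Sum>t\<in>S. l t H * X t z) - (\<Sum>t\<in>S. l t H * l s (X t)) * W z"
          using Yt by (simp add: sum_subtractf sum_distrib_right right_diff_distrib mult.assoc cong: sum.cong)
        moreover have "R H z = H z - (\<Sum>t\<in>S. l t H * X t z)" by (simp add: R_def)
        moreover have "(\<Sum>t\<in>insert s S. l t H * Y t z) = l s H * W z + (\<Sum>t\<in>S. l t H * Y t z)"
          using insert.hyps by (simp add: Ys)
        ultimately show "H z - (\<Sum>t\<in>insert s S. l t H * Y t z) = R H z - l s (R H) * W z"
          unfolding R(3)[OF H] by (simp only: left_diff_distrib) simp
      qed
      have "l t (\<lambda>z. R H z - l s (R H) * W z) = 0" if H: "H \<in> V" and t: "t \<in> insert s S" for H t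
        using ld[OF R(1)[OF H] Vc[OF W(1)]] lc[OF W(1)] W(2,3) R(2)[OF H] t by auto
      then show ?thesis using YV eq by (intro exI[of _ Y]) auto
    qed
  qed simp
qed

lemma linear_functional_sum:
  fixes V :: "('a \<Rightarrow> complex) set" and e :: "('a \<Rightarrow> complex) \<Rightarrow> complex"
  assumes V: "\<And>F G a b. F \<in> V \<Longrightarrow> G \<in> V \<Longrightarrow> (\<lambda>z. a * F z + b * G z) \<in> V" "(\<lambda>_. 0) \<in> V"
    and e: "\<And>F G a b. F \<in> V \<Longrightarrow> G \<in> V \<Longrightarrow> e (\<lambda>z. a * F z + b * G z) = a * e F + b * e G"
    and S: "finite S" "\<And>s. s \<in> S \<Longrightarrow> X s \<in> V"
  shows "(\<lambda>z. \<Sum>s\<in>S. c s * X s z) \<in> V \<and> e (\<lambda>z. \<Sum>s\<in>S. c s * X s z) = (\<Sum>s\<in>S. c s * e (X s))"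
  using S
proof (induction S rule: finite_induct)
  case empty
  then show ?case using V(2) e[OF V(2) V(2), of 0 0] by simp
next
  case (insert s S)
  then have "(\<lambda>z. \<Sum>s\<in>S. c s * X s z) \<in> V" "e (\<lambda>z. \<Sum>s\<in>S. c s * X s z) = (\<Sum>s\<in>S. c s * e (X s))" "X s \<in> V" by auto
  then show ?case
    using V(1)[of "X s" "\<lambda>z. \<Sum>s\<in>S. c s * X s z" "c s" 1] e[of "X s" "\<lambda>z. \<Sum>s\<in>S. c s * X s z" "c s" 1] insert.hyps
    by simp
qed

text \<open>The elements \<open>X\<close> are obtained before \<open>e\<close> is given and do not
  depend on it. A family of functionals indexed by the points of \<Omega> can therefore be expanded
  with the same \<open>X\<close> throughout.\<close>

lemma functionals_vanishing_on_common_kernel: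
  fixes V :: "('a \<Rightarrow> complex) set" and l :: "'s \<Rightarrow> ('a \<Rightarrow> complex) \<Rightarrow> complex"
  assumes S: "finite S"
    and V: "\<And>F G a b. F \<in> V \<Longrightarrow> G \<in> V \<Longrightarrow> (\<lambda>z. a * F z + b * G z) \<in> V" "(\<lambda>_. 0) \<in> V"
    and l: "\<And>s F G a b. F \<in> V \<Longrightarrow> G \<in> V \<Longrightarrow> l s (\<lambda>z. a * F z + b * G z) = a * l s F + b * l s G"
  obtains X where "\<And>s. s \<in> S \<Longrightarrow> X s \<in> V"
    "\<And>e H. (\<And>F G a b. F \<in> V \<Longrightarrow> G \<in> V \<Longrightarrow> e (\<lambda>z. a * F z + b * G z) = a * e F + b * e G) \<Longrightarrow>
       (\<And>F. F \<in> V \<Longrightarrow> (\<And>s. s \<in> S \<Longrightarrow> l s F = 0) \<Longrightarrow> e F = 0) \<Longrightarrow> H \<in> V \<Longrightarrow> e H = (\<Sum>s\<in>S. l s H * e (X s) :: complex)"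
proof -
  obtain X where X: "\<forall>s\<in>S. X s \<in> V" "\<forall>H\<in>V. \<forall>t\<in>S. l t (\<lambda>z. H z - (\<Sum>s\<in>S. l s H * X s z)) = 0"
  proof -
    have "\<exists>X. (\<forall>s\<in>S. X s \<in> V) \<and> (\<forall>H\<in>V. \<forall>t\<in>S. l t (\<lambda>z. H z - (\<Sum>s\<in>S. l s H * X s z)) = 0)"
      by (rule finite_functionals_dual) (assumption | rule S V l)+
    then show ?thesis using that by blast
  qed
  show ?thesis
  proof (rule that)
    show "X s \<in> V" if "s \<in> S" for s using X(1) that by blast
    fix e :: "('a \<Rightarrow> complex) \<Rightarrow> complex" and H
    assume e: "\<And>F G a b. F \<in> V \<Longrightarrow> G \<in> V \<Longrightarrow> e (\<lambda>z. a * F z + b * G z) = a * e F + b * e G"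
      and van: "\<And>F. F \<in> V \<Longrightarrow> (\<And>s. s \<in> S \<Longrightarrow> l s F = 0) \<Longrightarrow> e F = 0" and H: "H \<in> V"
    let ?P = "\<lambda>z. \<Sum>s\<in>S. l s H * X s z"
    have "?P \<in> V \<and> e ?P = (\<Sum>s\<in>S. l s H * e (X s))"
      by (rule linear_functional_sum[where c = "\<lambda>s. l s H" and X = X])
         (assumption | rule V e S X(1)[rule_format])+
    then have P: "?P \<in> V" "e ?P = (\<Sum>s\<in>S. l s H * e (X s))" by auto
    have D: "(\<lambda>z. H z - ?P z) \<in> V" "e (\<lambda>z. H z - ?P z) = e H - e ?P"
      using V(1)[OF H P(1), of 1 "-1"] e[OF H P(1), of 1 "-1"] by simp_all
    have "e (\<lambda>z. H z - ?P z) = 0" using X(2) H by (intro van[OF D(1)]) blast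
    then show "e H = (\<Sum>s\<in>S. l s H * e (X s))" using D(2) P(2) by simp
  qed
qed

text \<open>The \<open>dbar\<close> derivative of the conjugate of a holomorphic function is the
  conjugate of its derivative, and openness of \<open>S\<close> allows iteration. It turns
  \<open>sigma_bar\<close> into holomorphic derivatives of the kernel in its first variable.\<close>

lemma dbar_iterate_cnj:
  assumes h: "h holomorphic_on S" "open S" and eq: "\<And>w. w \<in> S \<Longrightarrow> g w = cnj (h w)" and w: "w \<in> S"
  shows "(dbar ^^ n) g w = cnj ((deriv ^^ n) h w)"
  using w
proof (induction n arbitrary: w)
  case 0
  then show ?case using eq by simp
next
  case (Suc n)
  define D where "D = deriv ((deriv ^^ n) h) w"
  have "((deriv ^^ n) h has_field_derivative D) (at w)"
    unfolding D_def using holomorphic_derivI[OF holomorphic_higher_deriv[OF h] h(2) Suc.prems] .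
  then have "((\<lambda>w. cnj ((deriv ^^ n) h w)) has_derivative (\<lambda>v. cnj (D * v))) (at w)"
    unfolding has_field_derivative_def by (rule bounded_linear.has_derivative[OF bounded_linear_cnj])
  then have "((dbar ^^ n) g has_derivative (\<lambda>v. cnj (D * v))) (at w)"
    by (rule has_derivative_transform_within_open[OF _ h(2) Suc.prems]) (simp add: Suc.IH)
  from frechet_derivative_at[OF this]
  have "frechet_derivative ((dbar ^^ n) g) (at w) = (\<lambda>v. cnj (D * v))" by simp
  then have "dbar ((dbar ^^ n) g) w = cnj D" by (simp add: dbar_def[of "(dbar ^^ n) g"] complex_eq_iff)
  then show ?case by (simp add: D_def)
qed

section \<open>The weighted inner product and the kernel\<close>

context tubular
begin

definition ip :: "(complex \<Rightarrow> real) \<Rightarrow> (complex \<Rightarrow> complex) \<Rightarrow> (complex \<Rightarrow> complex) \<Rightarrow> complex" where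
  "ip \<phi> F G = bint K \<Gamma> (\<lambda>\<zeta>. F \<zeta> * cnj (G \<zeta>) * of_real (\<phi> \<zeta>))"

lemma ip_integrable:
  assumes F: "bL2 K \<Gamma> F" and G: "bL2 K \<Gamma> G" and \<phi>: "\<forall>k<K. continuous_on UNIV (\<lambda>t. \<phi> (\<Gamma> k t))" and k: "k < K"
  shows "set_integrable lborel {0..1} (\<lambda>t. F (\<Gamma> k t) * cnj (G (\<Gamma> k t)) * of_real (\<phi> (\<Gamma> k t)) * of_real (norm (\<Gamma>' k t)))"
proof -
  have "compact ((\<lambda>t. \<phi> (\<Gamma> k t)) ` {0..1})"
    using \<phi> k by (intro compact_continuous_image) (auto intro: continuous_on_subset)
  then have "bounded ((\<lambda>t. \<phi> (\<Gamma> k t)) ` {0..1})" by (rule compact_imp_bounded)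
  then obtain P where P: "\<And>t. t \<in> {0..1} \<Longrightarrow> \<bar>\<phi> (\<Gamma> k t)\<bar> \<le> P"
    unfolding bounded_iff real_norm_def by fast
  obtain V where V: "V > 0" "\<And>t. cmod (\<Gamma>' k t) \<le> V" using speed_bounded k by blast
  have FG: "(\<lambda>t. F (\<Gamma> k t)) \<in> borel_measurable borel" "(\<lambda>t. G (\<Gamma> k t)) \<in> borel_measurable borel"
    "set_integrable lborel {0..1} (\<lambda>t. (cmod (F (\<Gamma> k t)))\<^sup>2)" "set_integrable lborel {0..1} (\<lambda>t. (cmod (G (\<Gamma> k t)))\<^sup>2)"
    using F G k unfolding bL2_alt by auto
  have m: "(\<lambda>t. cnj (G (\<Gamma> k t))) \<in> borel_measurable borel"
    "(\<lambda>t. of_real (\<phi> (\<Gamma> k t)) :: complex) \<in> borel_measurable borel"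
    "(\<lambda>t. of_real (norm (\<Gamma>' k t)) :: complex) \<in> borel_measurable borel"
  proof -
    show "(\<lambda>t. cnj (G (\<Gamma> k t))) \<in> borel_measurable borel"
      by (rule borel_measurable_continuous_on[OF _ FG(2)]) (intro continuous_intros)
    have "continuous_on UNIV (\<lambda>t. \<phi> (\<Gamma> k t))" using \<phi> k by blast
    then show "(\<lambda>t. of_real (\<phi> (\<Gamma> k t)) :: complex) \<in> borel_measurable borel"
      by (intro borel_measurable_continuous_onI continuous_intros)
    show "(\<lambda>t. of_real (norm (\<Gamma>' k t)) :: complex) \<in> borel_measurable borel"
      by (intro borel_measurable_continuous_onI continuous_intros cont_curve(2)[OF k])
  qed
  show ?thesis
  proof (rule set_integrable_real_bound)
    show "set_integrable lborel {0..1} (\<lambda>t. (P * V) * ((cmod (F (\<Gamma> k t)))\<^sup>2 + (cmod (G (\<Gamma> k t)))\<^sup>2))"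
      using FG(3,4) by (intro set_integrable_mult_right set_integral_add)
    show "(\<lambda>t. F (\<Gamma> k t) * cnj (G (\<Gamma> k t)) * of_real (\<phi> (\<Gamma> k t)) * of_real (norm (\<Gamma>' k t))) \<in> borel_measurable borel"
      by (intro borel_measurable_times FG(1) m)
    fix t :: real assume t: "t \<in> {0..1}"
    have P0: "P \<ge> 0" using P[OF t] by linarith
    have "cmod (F (\<Gamma> k t)) * cmod (G (\<Gamma> k t)) \<le> (cmod (F (\<Gamma> k t)))\<^sup>2 + (cmod (G (\<Gamma> k t)))\<^sup>2"
    proof -
      have "2 * (cmod (F (\<Gamma> k t)) * cmod (G (\<Gamma> k t))) \<le> (cmod (F (\<Gamma> k t)))\<^sup>2 + (cmod (G (\<Gamma> k t)))\<^sup>2"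
        using zero_le_power2[of "cmod (F (\<Gamma> k t)) - cmod (G (\<Gamma> k t))"] unfolding power2_diff by linarith
      moreover have "0 \<le> cmod (F (\<Gamma> k t)) * cmod (G (\<Gamma> k t))" by simp
      ultimately show ?thesis by linarith
    qed
    then have "(\<bar>\<phi> (\<Gamma> k t)\<bar> * cmod (\<Gamma>' k t)) * (cmod (F (\<Gamma> k t)) * cmod (G (\<Gamma> k t)))
        \<le> (P * V) * ((cmod (F (\<Gamma> k t)))\<^sup>2 + (cmod (G (\<Gamma> k t)))\<^sup>2)"
      using P[OF t] V P0 by (intro mult_mono) auto
    then show "norm (F (\<Gamma> k t) * cnj (G (\<Gamma> k t)) * of_real (\<phi> (\<Gamma> k t)) * of_real (norm (\<Gamma>' k t)))
        \<le> (P * V) * ((cmod (F (\<Gamma> k t)))\<^sup>2 + (cmod (G (\<Gamma> k t)))\<^sup>2)"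
      by (simp add: norm_mult mult_ac)
  qed simp
qed

lemma ip_lincomb:
  assumes "bL2 K \<Gamma> F" "bL2 K \<Gamma> F'" "bL2 K \<Gamma> G" "\<forall>k<K. continuous_on UNIV (\<lambda>t. \<phi> (\<Gamma> k t))"
  shows "ip \<phi> (\<lambda>z. a * F z + b * F' z) G = a * ip \<phi> F G + b * ip \<phi> F' G"
proof -
  have "(LINT t:{0..1}|lborel. (a * F (\<Gamma> k t) + b * F' (\<Gamma> k t)) * cnj (G (\<Gamma> k t)) * of_real (\<phi> (\<Gamma> k t)) * of_real (norm (\<Gamma>' k t)))
    = a * (LINT t:{0..1}|lborel. F (\<Gamma> k t) * cnj (G (\<Gamma> k t)) * of_real (\<phi> (\<Gamma> k t)) * of_real (norm (\<Gamma>' k t)))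
    + b * (LINT t:{0..1}|lborel. F' (\<Gamma> k t) * cnj (G (\<Gamma> k t)) * of_real (\<phi> (\<Gamma> k t)) * of_real (norm (\<Gamma>' k t)))" if k: "k < K" for k
  proof -
    have i: "set_integrable lborel {0..1} (\<lambda>t. a * (F (\<Gamma> k t) * cnj (G (\<Gamma> k t)) * of_real (\<phi> (\<Gamma> k t)) * of_real (norm (\<Gamma>' k t))))"
      "set_integrable lborel {0..1} (\<lambda>t. b * (F' (\<Gamma> k t) * cnj (G (\<Gamma> k t)) * of_real (\<phi> (\<Gamma> k t)) * of_real (norm (\<Gamma>' k t))))"
      using ip_integrable[OF assms(1,3,4) k] ip_integrable[OF assms(2,3,4) k] by (auto intro: set_integrable_mult_right)
    show ?thesis
      unfolding set_integral_mult_right[symmetric] set_integral_add(2)[OF i, symmetric]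
      by (simp add: algebra_simps)
  qed
  then show ?thesis
    unfolding ip_def bint_def by (simp add: sum.distrib sum_distrib_left)
qed

lemma cnj_ip: "cnj (ip \<phi> F G) = ip \<phi> G F"
  unfolding ip_def bint_def cnj_sum set_lebesgue_integral_def
  by (intro sum.cong refl)
     (simp add: mult_ac integral_bounded_linear'[OF bounded_linear_cnj bounded_linear_cnj, symmetric])

lemma ip_cong:
  assumes "\<And>z. z \<in> frontier \<Omega> \<Longrightarrow> F z * cnj (G z) = F' z * cnj (G' z)"
  shows "ip \<phi> F G = ip \<phi> F' G'"
  unfolding ip_def bint_def using assms[OF \<Gamma>_in_frontier] by (intro sum.cong refl) simp

lemma bdd_hol_linear: "bdd_hol (\<lambda>z. z - a)"
proof -
  obtain B where "\<And>z. z \<in> \<Omega> \<Longrightarrow> cmod z \<le> B" using \<Omega>(4) unfolding bounded_iff by blast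
  then have "cmod (z - a) \<le> B + cmod a" if "z \<in> \<Omega>" for z
    using that by (intro order_trans[OF norm_triangle_ineq4] add_mono) auto
  then show ?thesis
    unfolding bdd_hol_def by (auto intro!: holomorphic_intros tendsto_intros shift_tendsto)
qed

lemma bdd_hol_power: "bdd_hol f \<Longrightarrow> bdd_hol (\<lambda>z. f z ^ n)"
  by (induction n) (auto intro: bdd_hol_const bdd_hol_mult)

lemma bdd_hol_prod: "(\<And>i. i \<in> I \<Longrightarrow> bdd_hol (f i)) \<Longrightarrow> bdd_hol (\<lambda>z. \<Prod>i\<in>I. f i z)"
  by (induction I rule: infinite_finite_induct) (auto intro: bdd_hol_const bdd_hol_mult)

text \<open>Dividing \<open>f\<close> by its zero factors leaves \<open>E\<close> without zeros,
  whose reciprocal is \<open>q\<close>. At \<open>a i\<close> the local factor \<open>g\<close> of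
  \<open>f\<close> is nonzero and equals \<open>E\<close> times the remaining linear factors, first
  off \<open>a i\<close> and then at \<open>a i\<close> by continuity, so \<open>E\<close> cannot
  vanish there.\<close>

lemma zero_factorization:
  fixes N :: nat
  assumes hol: "f holomorphic_on \<Omega>" and onto: "f ` \<Omega> = ball 0 1" and inj: "inj_on a {1..N}"
    and zeros: "{z\<in>\<Omega>. f z = 0} = a ` {1..N}" and mult: "\<forall>i\<in>{1..N}. int (M i) = zorder f (a i)"
  obtains q where "q holomorphic_on \<Omega>" "\<And>z. z \<in> \<Omega> \<Longrightarrow> (\<Prod>i\<in>{1..N}. (z - a i) ^ M i) = f z * q z"
proof -
  have "1/2 \<in> f ` \<Omega>" unfolding onto by (simp add: norm_divide)
  then have nc: "\<exists>w\<in>\<Omega>. f w \<noteq> 0" by force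
  have loc: "\<exists>s g. s > 0 \<and> ball (a i) s \<subseteq> \<Omega> \<and> g holomorphic_on ball (a i) s \<and>
      (\<forall>w\<in>ball (a i) s. f w = (w - a i) ^ M i * g w) \<and> g (a i) \<noteq> 0" if i: "i \<in> {1..N}" for i
  proof -
    have ai: "a i \<in> \<Omega>" using zeros i by blast
    from zorder_exist_zero[OF hol \<Omega>(1,2) ai nc] obtain s where s: "s > 0" "cball (a i) s \<subseteq> \<Omega>"
      "zor_poly f (a i) holomorphic_on cball (a i) s"
      "\<And>w. w \<in> cball (a i) s \<Longrightarrow> f w = zor_poly f (a i) w * (w - a i) ^ nat (zorder f (a i)) \<and> zor_poly f (a i) w \<noteq> 0"
      by blast
    have M: "nat (zorder f (a i)) = M i" using mult i by (metis nat_int)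
    have sub: "ball (a i) s \<subseteq> cball (a i) s" by auto
    show ?thesis
      using s(1,2) sub holomorphic_on_subset[OF s(3) sub] s(4)[unfolded M]
      by (intro exI[of _ s] exI[of _ "zor_poly f (a i)"]) (auto simp: mult.commute)
  qed
  then have loc': "\<exists>s g. s > 0 \<and> ball (a i) s \<subseteq> \<Omega> \<and> g holomorphic_on ball (a i) s \<and>
      (\<forall>w\<in>ball (a i) s. f w = (w - a i) ^ M i * g w)" if "i \<in> {1..N}" for i using that by meson
  obtain E where E: "E holomorphic_on \<Omega>" "\<And>z. z \<in> \<Omega> \<Longrightarrow> f z = (\<Prod>i\<in>{1..N}. (z - a i) ^ M i) * E z"
    using factor_out_zeros[OF _ \<Omega>(1) hol inj loc'] by blast
  have "E z \<noteq> 0" if z: "z \<in> \<Omega>" for z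
  proof (cases "f z = 0")
    case False
    then show ?thesis using E(2)[OF z] by auto
  next
    case True
    then obtain i where i: "i \<in> {1..N}" "z = a i" using zeros z by blast
    obtain s g where sg: "s > 0" "ball (a i) s \<subseteq> \<Omega>" "g holomorphic_on ball (a i) s"
      "\<And>w. w \<in> ball (a i) s \<Longrightarrow> f w = (w - a i) ^ M i * g w" "g (a i) \<noteq> 0" using loc[OF i(1)] by blast
    define P where "P w = (\<Prod>j\<in>{1..N} - {i}. (w - a j) ^ M j)" for w
    have "g (a i) - P (a i) * E (a i) = 0"
    proof (rule holomorphic_zero_at_puncture[of "\<lambda>w. g w - P w * E w" "ball (a i) s"])
      show "(\<lambda>w. g w - P w * E w) holomorphic_on ball (a i) s"
        unfolding P_def by (intro holomorphic_intros sg holomorphic_on_subset[OF E(1) sg(2)])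
      show "g w - P w * E w = 0" if w: "w \<in> ball (a i) s - {a i}" for w
      proof -
        have "(\<Prod>j\<in>{1..N}. (w - a j) ^ M j) = (w - a i) ^ M i * P w"
          unfolding P_def using i(1) by (intro prod.remove) auto
        then have "(w - a i) ^ M i * g w = (w - a i) ^ M i * (P w * E w)"
          using sg(2) sg(4)[of w] E(2)[of w] w by (auto simp: mult.assoc)
        then show ?thesis using w by simp
      qed
    qed (use sg in auto)
    then show ?thesis using sg(5) i(2) by auto
  qed
  then have "(\<lambda>z. 1 / E z) holomorphic_on \<Omega>" "\<And>z. z \<in> \<Omega> \<Longrightarrow> (\<Prod>i\<in>{1..N}. (z - a i) ^ M i) = f z * (1 / E z)"
    using E by (auto intro!: holomorphic_intros)
  then show ?thesis by (rule that)
qed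

text \<open>The functional expansion is used twice, so that the coefficients depend neither on
  \<open>z\<close> nor on \<open>w\<close>: once to see that all kernel functions lie in a suitable
  subspace \<open>W\<close>, and once within \<open>W\<close>.\<close>

lemma szego_kernel_formula:
  fixes N :: nat
  assumes hol: "f holomorphic_on \<Omega>" and proper: "proper_to_disc \<Omega> f" and onto: "f ` \<Omega> = ball 0 1"
    and inj: "inj_on a {1..N}" and zeros: "{z\<in>\<Omega>. f z = 0} = a ` {1..N}"
    and mult: "\<forall>i\<in>{1..N}. int (M i) = zorder f (a i)"
    and \<phi>: "\<forall>k<K. continuous_on UNIV (\<lambda>t. \<phi> (\<Gamma> k t))"
    and szego: "weighted_szego \<Omega> K \<Gamma> \<phi> \<sigma>"
  shows "\<exists>c :: nat \<Rightarrow> nat \<Rightarrow> nat \<Rightarrow> nat \<Rightarrow> complex. \<forall>z\<in>\<Omega>. \<forall>w\<in>\<Omega>.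
     \<sigma> z w = 1 / (1 - f z * cnj (f w)) *
       (\<Sum>i=1..N. \<Sum>j=1..N. \<Sum>n=0..M i. \<Sum>m=0..M j.
          c i j n m * sigma_bar \<sigma> n z (a i) * cnj (sigma_bar \<sigma> m w (a j)))"
proof (rule inner_extension[OF hol proper], goal_cases)
  case F: (1 F)
  let ?S = "\<lambda>w z. \<sigma> z w"
  have a_in: "a i \<in> \<Omega>" if "i \<in> {1..N}" for i using zeros that by blast
  have hS: "hardy \<Omega> K \<Gamma> (?S w)" and repro: "hardy \<Omega> K \<Gamma> H \<Longrightarrow> H w = ip \<phi> H (?S w)" if "w \<in> \<Omega>" for w H
    using szego that unfolding weighted_szego_def ip_def by auto
  have herm: "\<sigma> z w = cnj (\<sigma> w z)" if "z \<in> \<Omega>" "w \<in> \<Omega>" for z w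
    using repro[OF that(1) hS[OF that(2)]] repro[OF that(2) hS[OF that(1)]] cnj_ip[of \<phi> "?S z" "?S w"] by simp
  define p where "p z = (\<Prod>i\<in>{1..N}. (z - a i) ^ M i)" for z
  have bp: "bdd_hol p" unfolding p_def[abs_def] by (intro bdd_hol_prod bdd_hol_power bdd_hol_linear)
  have dp: "divisor p" unfolding p_def[abs_def] by (intro divisor_prod divisor_power divisor_root a_in)
  obtain q where q0: "q holomorphic_on \<Omega>" "\<And>z. z \<in> \<Omega> \<Longrightarrow> (\<Prod>i\<in>{1..N}. (z - a i) ^ M i) = f z * q z"
    by (rule zero_factorization[OF hol onto inj zeros mult]) (rule that)
  have q: "q holomorphic_on \<Omega>" "\<And>z. z \<in> \<Omega> \<Longrightarrow> p z = f z * q z" using q0 by (simp_all add: p_def)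
  obtain Q where Q: "bdd_hol Q" "\<And>z. z \<in> closure \<Omega> \<Longrightarrow> p z = F z * Q z"
    by (rule quotient_extension[OF hol proper F(1,2,3) bp q]) (assumption | rule that)+
  define I where "I = Sigma {1..N} (\<lambda>i. {..<M i})"
  define l where "l s H = (deriv ^^ snd s) H (a (fst s))" for s :: "nat \<times> nat" and H
  have finI: "finite I" by (simp add: I_def)
  \<comment> \<open>Vanishing derivatives let \<open>p\<close> be divided out of \<open>H\<close>,
    and \<open>p = F * Q\<close> turns this into division by \<open>F\<close> with a quotient in the
    Hardy space.\<close>
  have div: "\<exists>G. hardy \<Omega> K \<Gamma> G \<and> (\<forall>z\<in>closure \<Omega>. H z = F z * G z)"
    if H: "hardy \<Omega> K \<Gamma> H" and l0: "\<And>s. s \<in> I \<Longrightarrow> l s H = 0" for H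
  proof -
    have holH: "H holomorphic_on \<Omega>" using hardyD(1)[OF H] .
    have "\<exists>s g. s > 0 \<and> ball (a i) s \<subseteq> \<Omega> \<and> g holomorphic_on ball (a i) s \<and>
      (\<forall>w\<in>ball (a i) s. H w = (w - a i) ^ M i * g w)" if i: "i \<in> {1..N}" for i
    proof -
      obtain s where s: "s > 0" "ball (a i) s \<subseteq> \<Omega>" using a_in[OF i] \<Omega>(1) open_contains_ball by blast
      have "(deriv ^^ n) H (a i) = 0" if "n < M i" for n
        using l0[of "(i, n)"] i that by (simp add: I_def l_def)
      from factor_power_of_derivs[OF holomorphic_on_subset[OF holH s(2)] s(1) this] s show ?thesis by blast
    qed
    from factor_out_zeros[OF _ \<Omega>(1) holH inj this] obtain E where
      E: "E holomorphic_on \<Omega>" "\<forall>z\<in>\<Omega>. H z = p z * E z" unfolding p_def by auto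
    then obtain G where G: "hardy \<Omega> K \<Gamma> G" "\<forall>z\<in>\<Omega>. G z = E z" "\<forall>z\<in>frontier \<Omega>. H z = p z * G z"
      using dp H unfolding divisor_def by fast
    have "H z = F z * (Q z * G z)" if z: "z \<in> closure \<Omega>" for z
    proof -
      have "H z = p z * G z" using z G(2,3) E(2) by (auto simp: closure_Un_frontier)
      then show ?thesis using Q(2)[OF z] by (simp add: mult.assoc)
    qed
    then show ?thesis using hardy_mult[OF Q(1) G(1)] by blast
  qed
  \<comment> \<open>The inner product sees only boundary values, so it uses \<open>F\<close>; the
    factor in front is evaluated in \<Omega>, where \<open>f\<close> and \<open>F\<close>
    agree.\<close>
  define e where "e w H = H w - f w * ip \<phi> H (\<lambda>z. F z * \<sigma> z w)" for w H
  have hFS: "hardy \<Omega> K \<Gamma> (\<lambda>z. F z * \<sigma> z w)" if "w \<in> \<Omega>" for w by (rule hardy_mult[OF F(1) hS[OF that]])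
  have e_lin: "e w (\<lambda>z. x * H z + y * G z) = x * e w H + y * e w G"
    if "w \<in> \<Omega>" "hardy \<Omega> K \<Gamma> H" "hardy \<Omega> K \<Gamma> G" for w H G x y
    using ip_lincomb[OF hardyD(2)[OF that(2)] hardyD(2)[OF that(3)] hardyD(2)[OF hFS[OF that(1)]] \<phi>, of x y]
    by (simp add: e_def algebra_simps)
  have e_van: "e w H = 0" if w: "w \<in> \<Omega>" and H: "hardy \<Omega> K \<Gamma> H" and l0: "\<And>s. s \<in> I \<Longrightarrow> l s H = 0" for w H
  proof -
    obtain G where G: "hardy \<Omega> K \<Gamma> G" "\<forall>z\<in>closure \<Omega>. H z = F z * G z" using div[OF H l0] by blast
    have "ip \<phi> H (\<lambda>z. F z * \<sigma> z w) = ip \<phi> G (?S w)"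
    proof (rule ip_cong)
      fix z assume z: "z \<in> frontier \<Omega>"
      have "F z * cnj (F z) = 1" using F(3)[OF z] complex_norm_square[of "F z"] by simp
      then have "F z * cnj (F z) * (G z * cnj (\<sigma> z w)) = G z * cnj (\<sigma> z w)" by simp
      then show "H z * cnj (F z * \<sigma> z w) = G z * cnj (\<sigma> z w)"
        using G(2) z by (simp add: frontier_def mult_ac)
    qed
    also have "\<dots> = G w" using repro[OF w G(1)] by simp
    finally have "ip \<phi> H (\<lambda>z. F z * \<sigma> z w) = G w" .
    moreover have "H w = f w * G w" using G(2) F(2)[OF w] subsetD[OF closure_subset w] by simp
    ultimately show ?thesis by (simp add: e_def)
  qed
  have e_ker: "e w (?S z) = \<sigma> w z * (1 - f w * cnj (f z))" if z: "z \<in> \<Omega>" and w: "w \<in> \<Omega>" for z w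
  proof -
    have "ip \<phi> (?S z) (\<lambda>v. F v * \<sigma> v w) = cnj (ip \<phi> (\<lambda>v. F v * \<sigma> v w) (?S z))" by (simp add: cnj_ip)
    also have "\<dots> = cnj (F z * \<sigma> z w)" using repro[OF z hFS[OF w]] by simp
    also have "\<dots> = cnj (f z) * \<sigma> w z" using herm[OF w z] F(2)[OF z] by simp
    finally show ?thesis by (simp add: e_def algebra_simps)
  qed
  define V where "V = {H. hardy \<Omega> K \<Gamma> H}"
  have V: "(\<lambda>z. x * H z + y * G z) \<in> V" if "H \<in> V" "G \<in> V" for H G x y
    using that hardy_lincomb by (simp add: V_def)
  have V0: "(\<lambda>_. 0) \<in> V" by (simp add: V_def bdd_hol_hardy bdd_hol_const)
  have l_lin: "l s (\<lambda>z. x * H z + y * G z) = x * l s H + y * l s G" if "s \<in> I" "H \<in> V" "G \<in> V" for s H G x y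
  proof -
    have hG: "H holomorphic_on \<Omega>" "G holomorphic_on \<Omega>" using that hardyD(1) by (auto simp: V_def)
    have as: "a (fst s) \<in> \<Omega>" using that(1) a_in by (auto simp: I_def)
    have "(deriv ^^ snd s) (\<lambda>z. x * H z + y * G z) (a (fst s)) =
        (deriv ^^ snd s) (\<lambda>z. x * H z) (a (fst s)) + (deriv ^^ snd s) (\<lambda>z. y * G z) (a (fst s))"
      by (rule higher_deriv_add[OF _ _ \<Omega>(1) as]) (intro holomorphic_intros hG)+
    also have "\<dots> = x * (deriv ^^ snd s) H (a (fst s)) + y * (deriv ^^ snd s) G (a (fst s))"
      using higher_deriv_cmult[OF hG(1) as \<Omega>(1)] higher_deriv_cmult[OF hG(2) as \<Omega>(1)] by simp
    finally show ?thesis by (simp add: l_def)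
  qed
  \<comment> \<open>Extended by zero outside \<open>I\<close>, so that linearity holds for every
    index: for other \<open>s\<close> the point \<open>a (fst s)\<close> may lie outside
    \<Omega>.\<close>
  define l' where "l' s = (if s \<in> I then l s else (\<lambda>_. 0))" for s
  have l'_lin: "l' s (\<lambda>z. x * H z + y * G z) = x * l' s H + y * l' s G" if "H \<in> V" "G \<in> V" for s H G x y
    using l_lin that by (simp add: l'_def)
  have l'_eq: "l' s H = l s H" if "s \<in> I" for s H using that by (simp add: l'_def)
  have SV: "?S z \<in> V" if "z \<in> \<Omega>" for z using hS[OF that] by (simp add: V_def)
  \<comment> \<open>The expansion is applied to \<open>e z\<close> at the kernel function of
    \<open>w\<close> and carried over by Hermitian symmetry, so the coefficients depend on
    \<open>z\<close> but not on \<open>w\<close>.\<close>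
  have "\<exists>d. \<forall>w\<in>\<Omega>. e w (?S z) = (\<Sum>t\<in>I. d t * cnj (l t (?S w)))" if z: "z \<in> \<Omega>" for z
  proof (rule functionals_vanishing_on_common_kernel[of I V l', OF finI V V0 l'_lin], goal_cases)
    case (5 X)
    have "e z (?S w) = (\<Sum>t\<in>I. l' t (?S w) * e z (X t))" if w: "w \<in> \<Omega>" for w
    proof (rule 5(2)[OF _ _ SV[OF w]])
      show "e z (\<lambda>v. x * H v + y * G v) = x * e z H + y * e z G" if "H \<in> V" "G \<in> V" for H G x y
        using e_lin[OF z] that by (simp add: V_def)
      show "e z H = 0" if "H \<in> V" "\<And>s. s \<in> I \<Longrightarrow> l' s H = 0" for H
        using e_van[OF z, of H] that l'_eq by (simp add: V_def)
    qed
    moreover have "e w (?S z) = cnj (e z (?S w))" if "w \<in> \<Omega>" for w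
      using e_ker[OF z that] e_ker[OF that z] herm[OF that z] by (simp add: mult.commute)
    ultimately show ?case
      by (intro exI[of _ "\<lambda>t. cnj (e z (X t))"]) (simp add: l'_eq mult.commute cong: sum.cong)
  qed auto
  then have SW: "?S z \<in> {H \<in> V. \<exists>d. \<forall>w\<in>\<Omega>. e w H = (\<Sum>t\<in>I. d t * cnj (l t (?S w)))}" if "z \<in> \<Omega>" for z
    using that SV by blast
  \<comment> \<open>The subspace of all \<open>H\<close> for which \<open>e w H\<close>, as a
    function of \<open>w\<close>, is such a combination with coefficients free of \<open>w\<close>.
    Repeating the expansion in \<open>W\<close> instead of \<open>V\<close> picks the elements
    \<open>X s\<close> in \<open>W\<close>, and the values \<open>e w (X s)\<close> then have this
    form, which produces the double sum.\<close>
  define W where "W = {H \<in> V. \<exists>d. \<forall>w\<in>\<Omega>. e w H = (\<Sum>t\<in>I. d t * cnj (l t (?S w)))}"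
  have WV: "H \<in> V" if "H \<in> W" for H using that by (simp add: W_def)
  have W: "(\<lambda>z. x * H z + y * G z) \<in> W" if "H \<in> W" "G \<in> W" for H G x y
  proof -
    obtain d d' where d: "\<forall>w\<in>\<Omega>. e w H = (\<Sum>t\<in>I. d t * cnj (l t (?S w)))" "\<forall>w\<in>\<Omega>. e w G = (\<Sum>t\<in>I. d' t * cnj (l t (?S w)))"
      using \<open>H \<in> W\<close> \<open>G \<in> W\<close> unfolding W_def by blast
    have "\<forall>w\<in>\<Omega>. e w (\<lambda>z. x * H z + y * G z) = (\<Sum>t\<in>I. (x * d t + y * d' t) * cnj (l t (?S w)))"
    proof
      fix w assume w: "w \<in> \<Omega>"
      have "e w (\<lambda>z. x * H z + y * G z) = x * e w H + y * e w G"
        using WV that e_lin[OF w] by (simp add: V_def)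
      also have "\<dots> = (\<Sum>t\<in>I. (x * d t + y * d' t) * cnj (l t (?S w)))"
        using d w by (simp add: sum_distrib_left distrib_right sum.distrib mult.assoc)
      finally show "e w (\<lambda>z. x * H z + y * G z) = (\<Sum>t\<in>I. (x * d t + y * d' t) * cnj (l t (?S w)))" .
    qed
    then show ?thesis
      using V[OF WV[OF that(1)] WV[OF that(2)], of x y] unfolding W_def
      by (intro CollectI conjI exI[of _ "\<lambda>t. x * d t + y * d' t"])
  qed
  have W0: "(\<lambda>_. 0) \<in> W"
  proof -
    have "l s (\<lambda>_. 0) = 0" if "s \<in> I" for s using l_lin[OF that V0 V0, of 0 0] by simp
    then have "e w (\<lambda>_. 0) = 0" if "w \<in> \<Omega>" for w using e_van[OF that, of "\<lambda>_. 0"] V0 by (simp add: V_def)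
    then show ?thesis using V0 unfolding W_def by (intro CollectI conjI exI[of _ "\<lambda>_. 0"]) auto
  qed
  have "\<exists>\<kappa>. \<forall>z\<in>\<Omega>. \<forall>w\<in>\<Omega>. e w (?S z) = (\<Sum>s\<in>I. \<Sum>t\<in>I. \<kappa> s t * l s (?S z) * cnj (l t (?S w)))"
  proof (rule functionals_vanishing_on_common_kernel[of I W l', OF finI W W0 l'_lin[OF WV WV]], goal_cases)
    case (5 X)
    have "\<forall>s. \<exists>d. s \<in> I \<longrightarrow> (\<forall>w\<in>\<Omega>. e w (X s) = (\<Sum>t\<in>I. d t * cnj (l t (?S w))))"
      using 5(1) unfolding W_def by blast
    then obtain \<kappa> where \<kappa>: "\<And>s w. s \<in> I \<Longrightarrow> w \<in> \<Omega> \<Longrightarrow> e w (X s) = (\<Sum>t\<in>I. \<kappa> s t * cnj (l t (?S w)))"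
      unfolding choice_iff by blast
    have "e w (?S z) = (\<Sum>s\<in>I. \<Sum>t\<in>I. \<kappa> s t * l s (?S z) * cnj (l t (?S w)))" if z: "z \<in> \<Omega>" and w: "w \<in> \<Omega>" for z w
    proof -
      have "e w (?S z) = (\<Sum>s\<in>I. l' s (?S z) * e w (X s))"
      proof (rule 5(2))
        show "e w (\<lambda>v. x * H v + y * G v) = x * e w H + y * e w G" if "H \<in> W" "G \<in> W" for H G x y
          using e_lin[OF w] WV that by (simp add: V_def)
        show "e w H = 0" if "H \<in> W" "\<And>s. s \<in> I \<Longrightarrow> l' s H = 0" for H
          using e_van[OF w, of H] WV that l'_eq by (simp add: V_def)
        show "?S z \<in> W" using SW[OF z] by (simp add: W_def)
      qed
      also have "\<dots> = (\<Sum>s\<in>I. \<Sum>t\<in>I. \<kappa> s t * l s (?S z) * cnj (l t (?S w)))"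
        by (intro sum.cong refl) (simp add: \<kappa>[OF _ w] l'_eq sum_distrib_left mult_ac)
      finally show ?thesis .
    qed
    then show ?case by blast
  qed auto
  then obtain \<kappa> where \<kappa>: "\<And>z w. z \<in> \<Omega> \<Longrightarrow> w \<in> \<Omega> \<Longrightarrow>
      e w (?S z) = (\<Sum>s\<in>I. \<Sum>t\<in>I. \<kappa> s t * l s (?S z) * cnj (l t (?S w)))" by blast
  \<comment> \<open>As a function of its second argument the kernel is the conjugate of a Hardy
    function, so its iterated \<open>dbar\<close> at \<open>a i\<close> is the conjugate of the
    functional \<open>l (i, n)\<close>.\<close>
  have bar: "sigma_bar \<sigma> n z (a i) = cnj (l (i, n) (?S z))" if "z \<in> \<Omega>" "i \<in> {1..N}" for z i n
    unfolding sigma_bar_def l_def fst_conv snd_conv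
    using that by (intro dbar_iterate_cnj[OF hardyD(1)[OF hS] \<Omega>(1)] herm a_in) auto
  \<comment> \<open>Only orders below the multiplicities occur, so the coefficients with
    \<open>n = M i\<close> or \<open>m = M j\<close> are zero. The index pairs of \<kappa> appear in
    reverse order because the expansion of \<open>e w (?S z)\<close> is used with \<open>z\<close>
    and \<open>w\<close> interchanged.\<close>
  define c where "c i j n m = (if n < M i \<and> m < M j then \<kappa> (j, m) (i, n) else 0)" for i j n m
  show ?case
  proof (intro exI[of _ c] ballI)
    fix z w assume z: "z \<in> \<Omega>" and w: "w \<in> \<Omega>"
    let ?T = "\<lambda>i j n m. \<kappa> (j, m) (i, n) * l (j, m) (?S w) * cnj (l (i, n) (?S z))"
    have "(\<Sum>i=1..N. \<Sum>j=1..N. \<Sum>n=0..M i. \<Sum>m=0..M j. c i j n m * sigma_bar \<sigma> n z (a i) * cnj (sigma_bar \<sigma> m w (a j)))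
      = (\<Sum>i=1..N. \<Sum>j=1..N. \<Sum>n<M i. \<Sum>m<M j. ?T i j n m)"
    proof (rule sum.cong[OF refl], rule sum.cong[OF refl])
      fix i j assume ij: "i \<in> {1..N}" "j \<in> {1..N}"
      have "(\<Sum>n=0..M i. \<Sum>m=0..M j. c i j n m * sigma_bar \<sigma> n z (a i) * cnj (sigma_bar \<sigma> m w (a j)))
        = (\<Sum>n<M i. \<Sum>m=0..M j. c i j n m * sigma_bar \<sigma> n z (a i) * cnj (sigma_bar \<sigma> m w (a j)))"
        by (rule sum.mono_neutral_right) (auto simp: c_def)
      also have "\<dots> = (\<Sum>n<M i. \<Sum>m<M j. c i j n m * sigma_bar \<sigma> n z (a i) * cnj (sigma_bar \<sigma> m w (a j)))"
        by (intro sum.cong refl sum.mono_neutral_right) (auto simp: c_def)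
      also have "\<dots> = (\<Sum>n<M i. \<Sum>m<M j. ?T i j n m)"
        by (intro sum.cong refl) (simp add: c_def bar[OF z ij(1)] bar[OF w ij(2)])
      finally show "(\<Sum>n=0..M i. \<Sum>m=0..M j. c i j n m * sigma_bar \<sigma> n z (a i) * cnj (sigma_bar \<sigma> m w (a j)))
        = (\<Sum>n<M i. \<Sum>m<M j. ?T i j n m)" .
    qed
    also have "\<dots> = (\<Sum>i=1..N. \<Sum>n<M i. \<Sum>j=1..N. \<Sum>m<M j. ?T i j n m)"
      by (intro sum.cong refl sum.swap)
    also have "\<dots> = (\<Sum>i=1..N. \<Sum>n<M i. \<Sum>(j, m)\<in>I. ?T i j n m)"
      unfolding I_def by (intro sum.cong refl sum.Sigma) auto
    also have "\<dots> = (\<Sum>(i, n)\<in>I. \<Sum>(j, m)\<in>I. ?T i j n m)"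
      unfolding I_def by (rule sum.Sigma) auto
    also have "\<dots> = (\<Sum>t\<in>I. \<Sum>s\<in>I. \<kappa> s t * l s (?S w) * cnj (l t (?S z)))"
      by (simp add: case_prod_beta')
    also have "\<dots> = e z (?S w)" unfolding \<kappa>[OF w z] by (rule sum.swap)
    also have "\<dots> = \<sigma> z w * (1 - f z * cnj (f w))" by (rule e_ker[OF w z])
    finally have eq: "(\<Sum>i=1..N. \<Sum>j=1..N. \<Sum>n=0..M i. \<Sum>m=0..M j. c i j n m * sigma_bar \<sigma> n z (a i) * cnj (sigma_bar \<sigma> m w (a j)))
      = \<sigma> z w * (1 - f z * cnj (f w))" .
    have "cmod (f z * cnj (f w)) < 1"
      using map_to_disc[OF hol proper z] map_to_disc[OF hol proper w] norm_mult_less[of "f z" 1 "cnj (f w)" 1] by simp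
    then have "1 - f z * cnj (f w) \<noteq> 0" by (metis eq_iff_diff_eq_0 less_irrefl norm_one)
    then show "\<sigma> z w = 1 / (1 - f z * cnj (f w)) *
       (\<Sum>i=1..N. \<Sum>j=1..N. \<Sum>n=0..M i. \<Sum>m=0..M j. c i j n m * sigma_bar \<sigma> n z (a i) * cnj (sigma_bar \<sigma> m w (a j)))"
      unfolding eq by simp
  qed
qed

end

theorem theorem2p6:
  fixes \<Omega> :: "complex set" and K :: nat and \<Gamma> :: "nat \<Rightarrow> real \<Rightarrow> complex"
    and f :: "complex \<Rightarrow> complex" and N :: nat and a :: "nat \<Rightarrow> complex" and M :: "nat \<Rightarrow> nat"
    and \<phi> :: "complex \<Rightarrow> real" and \<sigma> :: "complex \<Rightarrow> complex \<Rightarrow> complex"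
  assumes dom: "smooth_bounded_domain \<Omega> K \<Gamma>"
    and hol: "f holomorphic_on \<Omega>"
    and proper: "proper_to_disc \<Omega> f"
    and onto: "f ` \<Omega> = ball 0 1"
    and a_in: "\<forall>i\<in>{1..N}. a i \<in> \<Omega>"
    and a_inj: "inj_on a {1..N}"
    and zeros: "{z\<in>\<Omega>. f z = 0} = a ` {1..N}"
    and mult: "\<forall>i\<in>{1..N}. int (M i) = zorder f (a i)"
    and phi_pos: "\<forall>\<zeta>\<in>frontier \<Omega>. \<phi> \<zeta> > 0"
    and phi_smooth: "\<forall>k<K. smooth (\<lambda>t. \<phi> (\<Gamma> k t))"
    and szego: "weighted_szego \<Omega> K \<Gamma> \<phi> \<sigma>"
  shows "\<exists>c :: nat \<Rightarrow> nat \<Rightarrow> nat \<Rightarrow> nat \<Rightarrow> complex. \<forall>z\<in>\<Omega>. \<forall>w\<in>\<Omega>.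
     \<sigma> z w = 1 / (1 - f z * cnj (f w)) *
       (\<Sum>i=1..N. \<Sum>j=1..N. \<Sum>n=0..M i. \<Sum>m=0..M j.
          c i j n m * sigma_bar \<sigma> n z (a i) * cnj (sigma_bar \<sigma> m w (a j)))"
proof -
  interpret smooth_domain \<Omega> K \<Gamma> using dom by (rule smooth_domain.intro)
  obtain sg \<omega> \<alpha> \<beta> r m C where "tubular \<Omega> K \<Gamma> sg \<omega> \<alpha> \<beta> r m C" using ex_tubular by blast
  moreover have "\<forall>k<K. continuous_on UNIV (\<lambda>t. \<phi> (\<Gamma> k t))" using phi_smooth smooth_imp_continuous by blast
  ultimately show ?thesis
    using tubular.szego_kernel_formula[OF _ hol proper onto a_inj zeros mult _ szego] by blast
qed

end
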